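(* Let $\Omega\subset\mathbb{C}^n$ be a bounded strictly pseudo-convex domain with smooth boundary, let $\varphi\in C^{\infty}(\partial\Omega)$, let $p>1$ with conjugate exponent $p^*=\frac{p}{p-1}$, and let $0\le f\in L^p(\Omega)$. Let $u\in C^{\infty}(\bar\Omega)$ be a pluri-subharmonic solution of the Dirichlet problem $$(dd^c u)^n=f\,d\mu \ \text{ in } \Omega,\qquad u=\varphi \ \text{ on } \partial\Omega,$$ where $\mu$ is Lebesgue measure. Then for every $\delta\in\left(0,\frac{1}{np^*}\right)$ there is a constant $C>0$ depending only on $n$, $p$, $\delta$ and $\mathrm{diam}(\Omega)$ such that $$\Big|\inf_{\Omega}u\Big|\le \Big|\inf_{\partial\Omega}\varphi\Big|+C\,\|f\|_{L^p(\Omega)}^{\frac1n}\,|\Omega|^{\delta},$$ where $|\Omega|$ denotes the Lebesgue measure of $\Omega$.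
   Context: $(dd^c u)^n$ denotes the complex Monge–Ampère measure of $u$ (with the usual operators $d=\partial+\bar\partial$, $d^c$ a fixed real multiple of $\sqrt{-1}(\bar\partial-\partial)$). *)

theory Defs
  imports "HOL-Analysis.Analysis"
begin

definition dirderiv :: "('a::real_normed_vector \<Rightarrow> real) \<Rightarrow> 'a \<Rightarrow> 'a \<Rightarrow> real" where
  "dirderiv f v x = deriv (\<lambda>t. f (x + t *\<^sub>R v)) 0"

fun iter_dd :: "('a::real_normed_vector \<Rightarrow> real) \<Rightarrow> 'a list \<Rightarrow> 'a \<Rightarrow> real" where
  "iter_dd f [] = f"
| "iter_dd f (v # vs) = dirderiv (iter_dd f vs) v"

definition Cinf_on :: "'a::real_normed_vector set \<Rightarrow> ('a \<Rightarrow> real) \<Rightarrow> bool" where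
  "Cinf_on U f \<longleftrightarrow> open U \<and>
     (\<forall>vs. continuous_on U (iter_dd f vs) \<and>
        (\<forall>x\<in>U. \<forall>v. (\<lambda>t. iter_dd f vs (x + t *\<^sub>R v)) differentiable (at 0)))"

definition Cinf_on_set :: "'a::real_normed_vector set \<Rightarrow> ('a \<Rightarrow> real) \<Rightarrow> bool" where
  "Cinf_on_set S \<phi> \<longleftrightarrow> (\<exists>U g. S \<subseteq> U \<and> Cinf_on U g \<and> (\<forall>x\<in>S. g x = \<phi> x))"

definition dz :: "(complex^'n \<Rightarrow> real) \<Rightarrow> 'n \<Rightarrow> complex^'n \<Rightarrow> complex" where
  "dz u j x = complex_of_real (dirderiv u (axis j 1) x / 2)
              - \<i> * complex_of_real (dirderiv u (axis j \<i>) x / 2)"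

text \<open>Complex Hessian (u_{j kbar}) = d^2 u / dz_j dzbar_k.\<close>
definition cHess :: "(complex^'n \<Rightarrow> real) \<Rightarrow> complex^'n \<Rightarrow> complex^'n^'n" where
  "cHess u x = (\<chi> j k.
      complex_of_real ((iter_dd u [axis j 1, axis k 1] x + iter_dd u [axis j \<i>, axis k \<i>] x) / 4)
    + \<i> * complex_of_real ((iter_dd u [axis j 1, axis k \<i>] x - iter_dd u [axis j \<i>, axis k 1] x) / 4))"

text \<open>Density of (dd^c u)^n w.r.t. Lebesgue measure for smooth u, with the
  normalisation d^c = i(dbar - d), so dd^c u = 2i ddbar u and
  (dd^c u)^n = 4^n n! det(u_{j kbar}) d mu.\<close>
definition MA_density :: "(complex^'n \<Rightarrow> real) \<Rightarrow> complex^'n \<Rightarrow> real" where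
  "MA_density u x = 4 ^ CARD('n) * fact CARD('n) * Re (det (cHess u x))"

definition psh :: "(complex^'n) set \<Rightarrow> (complex^'n \<Rightarrow> real) \<Rightarrow> bool" where
  "psh \<Omega> u \<longleftrightarrow>
     (\<forall>x\<in>\<Omega>. \<forall>e>0. \<forall>\<^sub>F y in at x. u y < u x + e) \<and>
     (\<forall>a b. (\<forall>\<zeta>. cmod \<zeta> \<le> 1 \<longrightarrow> a + \<zeta> *s b \<in> \<Omega>) \<longrightarrow>
        u a \<le> (1 / (2 * pi)) * integral {0..2*pi} (\<lambda>\<theta>. u (a + cis \<theta> *s b)))"

definition bdd_strictly_pseudoconvex :: "(complex^'n) set \<Rightarrow> bool" where
  "bdd_strictly_pseudoconvex \<Omega> \<longleftrightarrow> open \<Omega> \<and> connected \<Omega> \<and> \<Omega> \<noteq> {} \<and> bounded \<Omega> \<and>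
     (\<exists>U \<rho>. closure \<Omega> \<subseteq> U \<and> Cinf_on U \<rho> \<and> \<Omega> = {z\<in>U. \<rho> z < 0} \<and>
        (\<forall>z\<in>frontier \<Omega>. (\<exists>v. dirderiv \<rho> v z \<noteq> 0) \<and>
           (\<forall>w::complex^'n. w \<noteq> 0 \<and> (\<Sum>j\<in>UNIV. dz \<rho> j z * w$j) = 0 \<longrightarrow>
              Re (\<Sum>j\<in>UNIV. \<Sum>k\<in>UNIV. cHess \<rho> z $ j $ k * w$j * cnj (w$k)) > 0)))"

definition Lp_norm_on :: "real \<Rightarrow> ('a::euclidean_space) set \<Rightarrow> ('a \<Rightarrow> real) \<Rightarrow> real" where
  "Lp_norm_on p S f = (\<integral>x. \<bar>f x\<bar> powr p \<partial>lebesgue_on S) powr (1 / p)"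

end

theory Submission
  imports Defs "HOL-Complex_Analysis.Complex_Analysis" "HOL-Computational_Algebra.Fundamental_Theorem_Algebra"
begin

text \<open>
  Fix \<open>s' < s\<close> above \<open>- inf \<phi>\<close> and cover \<open>{u \<le> - s}\<close> by small ellipsoids of equal size \<open>r\<close> for
  the complex Hessian of \<open>u\<close>, with disjoint shrunken copies inside \<open>{u < - s'}\<close>.  Each copy carries
  Monge-Ampere mass comparable to \<open>r\<^sup>2\<^sup>n\<close>, so their number \<open>N\<close> is at most a constant times
  \<open>r\<^sup>-\<^sup>2\<^sup>n\<close> times the mass of \<open>{u < - s'}\<close>.  Linear algebra gives a nonzero polynomial \<open>P\<close> of degree
  \<open>O(N\<^sup>1\<^sup>/\<^sup>n)\<close> in each variable vanishing at all centres.  The function \<open>u - 50 r\<^sup>2 log |P|\<close> has no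
  minimum in \<open>{u < - s}\<close>: on the complex line through such a point and a nearby centre, the zero of
  \<open>P\<close> contradicts the maximum principle.  Hence \<open>{u < - s - t}\<close> lies in a sublevel set of
  \<open>|P|\<close>, whose volume decays exponentially by a Cartan-type estimate.  This bounds the volume of
  \<open>{u < - s - t}\<close> by any power of \<open>mass({u < - s'})\<^sup>1\<^sup>/\<^sup>n / t\<close>; Hoelder's inequality and De Giorgi's
  iteration finish the proof.  Choosing the power \<open>1 / (1 / (n p\<^sup>*) - \<delta>)\<close> makes the exponent of
  \<open>|\<Omega>|\<close> equal to \<open>\<delta>\<close>.
\<close>

subsection \<open>Directional derivatives\<close>

text \<open>The scaling makes the scheme close. \<open>N\<close> is at most a constant times mass /
  \<open>r^(2n)\<close> and the degree \<open>D\<close> is comparable to the n-th root of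
  \<open>N\<close>, so \<open>D r^2\<close> is bounded by a constant times mass^(1/n), whatever
  \<open>r\<close> is. Up to a constant, sublevel sets of |P| shrink like exp(- t / (100 D r^2)), so
  the final bound does not see \<open>r\<close>, which may have to be tiny: nothing controls the
  modulus of continuity of the Hessian of \<open>u\<close>. The explicit function log |P| does the
  work of an auxiliary psh function with prescribed Monge-Ampere mass, so no existence theory for
  the equation enters. The Levi form may degenerate; a small multiple of the Euclidean form is
  added, and the resulting volume error tends to 0 at the end. On a complex line the second order
  Taylor polynomial of \<open>u\<close> is the real part of a holomorphic polynomial plus the Levi
  term. The former can be divided out by a holomorphic exponential. On a disc of radius 5 a zero at
  distance 1 from the centre gains a factor 4, which beats e; 50 is the squared radius 25 times the
  factor 2 in the bound \<open>2 r^2\<close> for the form at the nearby centre.\<close>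

definition C1_dir :: "'a::real_normed_vector set \<Rightarrow> ('a \<Rightarrow> real) \<Rightarrow> bool" where
  "C1_dir U f \<longleftrightarrow> open U \<and> (\<forall>v. continuous_on U (dirderiv f v)) \<and>
     (\<forall>x\<in>U. \<forall>v. (\<lambda>t. f (x + t *\<^sub>R v)) differentiable (at 0))"

lemma Cinf_on_imp_C1_dir: "Cinf_on U u \<Longrightarrow> C1_dir U (iter_dd u vs)"
  unfolding Cinf_on_def C1_dir_def by (metis iter_dd.simps(2))

lemma C1_dir_line:
  assumes "C1_dir U f" "x + t *\<^sub>R v \<in> U"
  shows "((\<lambda>s. f (x + s *\<^sub>R v)) has_real_derivative dirderiv f v (x + t *\<^sub>R v)) (at t)"
proof -
  have "((\<lambda>s. f ((x + t *\<^sub>R v) + s *\<^sub>R v)) has_real_derivative dirderiv f v (x + t *\<^sub>R v)) (at 0)"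
    using assms DERIV_deriv_iff_real_differentiable unfolding C1_dir_def dirderiv_def by blast
  then have "((\<lambda>s. f (x + (s + t) *\<^sub>R v)) has_real_derivative dirderiv f v (x + t *\<^sub>R v)) (at 0)"
    by (simp add: scaleR_add_left add.assoc add.commute add.left_commute)
  then show ?thesis
    using DERIV_shift[of "\<lambda>s. f (x + s *\<^sub>R v)" _ 0 t] by simp
qed

lemma dirderiv_eqI:
  assumes "((\<lambda>t. f (x + t *\<^sub>R v)) has_real_derivative d) (at 0)"
  shows "dirderiv f v x = d"
  using assms unfolding dirderiv_def by (rule DERIV_imp_deriv)

lemma dirderiv_scaleR:
  assumes "C1_dir U f" "x \<in> U"
  shows "dirderiv f (c *\<^sub>R v) x = c * dirderiv f v x"
proof (rule dirderiv_eqI)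
  have "((\<lambda>s. f (x + s *\<^sub>R v)) has_real_derivative dirderiv f v x) (at (c * 0))"
    using C1_dir_line[OF assms(1), of x 0 v] assms(2) by simp
  moreover have "((\<lambda>t. c * t) has_real_derivative c) (at 0)" by (auto intro!: derivative_eq_intros)
  ultimately have "((\<lambda>s. f (x + s *\<^sub>R v)) \<circ> (\<lambda>t. c * t) has_real_derivative dirderiv f v x * c) (at 0)"
    by (rule DERIV_chain)
  then show "((\<lambda>t. f (x + t *\<^sub>R c *\<^sub>R v)) has_real_derivative c * dirderiv f v x) (at 0)"
    by (simp add: o_def mult.commute)
qed

text \<open>\<open>C1_dir\<close> says nothing about the dependence on the direction, so additivity
  comes from continuity: move along \<open>v\<close> first, then compare the increment along
  \<open>w\<close> from the moved base point with the derivative at \<open>x\<close> by the mean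
  value inequality.\<close>

lemma dirderiv_add:
  assumes f: "C1_dir U f" and x: "x \<in> U"
  shows "dirderiv f (v + w) x = dirderiv f v x + dirderiv f w x"
proof (rule dirderiv_eqI)
  have op: "open U" using f by (simp add: C1_dir_def)
  let ?G = "\<lambda>t. f (x + t *\<^sub>R v + t *\<^sub>R w) - f (x + t *\<^sub>R v)"
  have "(?G has_real_derivative dirderiv f w x) (at 0)"
    unfolding DERIV_def LIM_eq
  proof safe
    fix e :: real assume e: "e > 0"
    from op x obtain r where r: "r > 0" "ball x r \<subseteq> U" by (meson openE)
    have "continuous_on U (dirderiv f w)" using f by (simp add: C1_dir_def)
    then obtain d where d: "d > 0" "\<And>y. y \<in> U \<Longrightarrow> dist y x < d \<Longrightarrow> dist (dirderiv f w y) (dirderiv f w x) < e/2"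
      using x e unfolding continuous_on_iff by (metis half_gt_zero)
    define K where "K = norm v + norm w + 1"
    have K: "K > 0" unfolding K_def by (smt (verit) norm_ge_zero)
    define s where "s = min r d / K"
    have s: "s > 0" using r d K by (simp add: s_def)
    show "\<exists>s>0. \<forall>t. t \<noteq> 0 \<and> norm (t - 0) < s \<longrightarrow>
       norm ((?G (0 + t) - ?G 0) / t - dirderiv f w x) < e"
    proof (intro exI[of _ s] conjI allI impI s)
      fix t :: real assume t: "t \<noteq> 0 \<and> norm (t - 0) < s"
      have near: "dist (x + t *\<^sub>R v + q *\<^sub>R w) x < min r d" if "\<bar>q\<bar> \<le> \<bar>t\<bar>" for q
      proof -
        have "dist (x + t *\<^sub>R v + q *\<^sub>R w) x \<le> \<bar>t\<bar> * norm v + \<bar>q\<bar> * norm w"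
          by (simp add: dist_norm add.assoc) (metis norm_scaleR norm_triangle_ineq)
        also have "\<dots> \<le> \<bar>t\<bar> * norm v + \<bar>t\<bar> * norm w" using that by (simp add: mult_right_mono)
        also have "\<dots> \<le> \<bar>t\<bar> * K" by (simp add: K_def algebra_simps)
        also have "\<dots> < s * K" using t K by simp
        finally show ?thesis using K by (simp add: s_def)
      qed
      have inU: "x + t *\<^sub>R v + q *\<^sub>R w \<in> U" if "\<bar>q\<bar> \<le> \<bar>t\<bar>" for q
        using near[OF that] r by (auto simp: dist_commute subset_eq)
      let ?h = "\<lambda>q. f (x + t *\<^sub>R v + q *\<^sub>R w) - q * dirderiv f w x"
      have "norm (?h t - ?h 0) \<le> e/2 * norm (t - 0)"
      proof (rule field_differentiable_bound[where S = "cball 0 \<bar>t\<bar>"])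
        fix q :: real assume q: "q \<in> cball 0 \<bar>t\<bar>"
        then have q': "\<bar>q\<bar> \<le> \<bar>t\<bar>" by simp
        show "(?h has_field_derivative dirderiv f w (x + t *\<^sub>R v + q *\<^sub>R w) - dirderiv f w x) (at q within cball 0 \<bar>t\<bar>)"
          by (rule has_field_derivative_at_within)
             (rule derivative_eq_intros C1_dir_line[OF f] inU[OF q'] refl | simp)+
        show "norm (dirderiv f w (x + t *\<^sub>R v + q *\<^sub>R w) - dirderiv f w x) \<le> e/2"
          using d(2)[OF inU[OF q']] near[OF q'] by (simp add: dist_norm)
      qed auto
      then have "\<bar>?G t - t * dirderiv f w x\<bar> \<le> e/2 * \<bar>t\<bar>" by (simp add: algebra_simps)
      moreover have "(?G (0 + t) - ?G 0) / t - dirderiv f w x = (?G t - t * dirderiv f w x) / t"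
        using t by (simp add: field_simps)
      ultimately have "\<bar>(?G (0 + t) - ?G 0) / t - dirderiv f w x\<bar> \<le> e/2"
        using t by (simp add: abs_divide pos_divide_le_eq)
      then show "norm ((?G (0 + t) - ?G 0) / t - dirderiv f w x) < e" using e by simp
    qed
  qed
  moreover have "((\<lambda>t. f (x + t *\<^sub>R v)) has_real_derivative dirderiv f v x) (at 0)"
    using C1_dir_line[OF f, of x 0 v] x by simp
  ultimately have "((\<lambda>t. ?G t + f (x + t *\<^sub>R v)) has_real_derivative dirderiv f w x + dirderiv f v x) (at 0)"
    by (rule DERIV_add)
  then show "((\<lambda>t. f (x + t *\<^sub>R (v + w))) has_real_derivative dirderiv f v x + dirderiv f w x) (at 0)"
    by (simp add: scaleR_add_right add.assoc add.commute add.left_commute)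
qed

lemma dirderiv_linear:
  assumes "C1_dir U f" "x \<in> U"
  shows "linear (\<lambda>v. dirderiv f v x)"
  by (rule linearI) (simp_all add: dirderiv_add[OF assms] dirderiv_scaleR[OF assms])

text \<open>Allows differentiating an identity that is known only on \<open>U\<close>; it is applied
  to the linearity of the first derivative.\<close>

lemma dirderiv_cong_open:
  assumes "open U" "x \<in> U" "\<And>y. y \<in> U \<Longrightarrow> f y = g y"
    "((\<lambda>t. g (x + t *\<^sub>R v)) has_real_derivative d) (at 0)"
  shows "dirderiv f v x = d"
proof (rule dirderiv_eqI)
  have "open ((\<lambda>t. x + t *\<^sub>R v) -` U)"
    by (rule open_vimage[OF assms(1)]) (intro continuous_intros)
  moreover have "(0::real) \<in> ((\<lambda>t. x + t *\<^sub>R v) -` U)" using assms(2) by simp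
  ultimately show "((\<lambda>t. f (x + t *\<^sub>R v)) has_real_derivative d) (at 0)"
    using has_field_derivative_transform_within_open[OF assms(4), of "(\<lambda>t. x + t *\<^sub>R v) -` U" "\<lambda>t. f (x + t *\<^sub>R v)"] assms(3)
    by (simp only: vimage_eq)
qed

lemma iter_dd2_linear_left:
  assumes "Cinf_on U u" "x \<in> U"
  shows "linear (\<lambda>v. iter_dd u [v, w] x)"
  using dirderiv_linear[OF Cinf_on_imp_C1_dir[OF assms(1), of "[w]"] assms(2)] by simp

text \<open>Linearity of the inner derivative holds at every point of the open set \<open>U\<close>,
  so it survives the outer differentiation.\<close>

lemma iter_dd2_linear_right:
  assumes u: "Cinf_on U u" and x: "x \<in> U"
  shows "linear (\<lambda>w. iter_dd u [v, w] x)"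
proof -
  have op: "open U" using u by (simp add: Cinf_on_def)
  note C = Cinf_on_imp_C1_dir[OF u]
  have line: "((\<lambda>t. dirderiv u w (x + t *\<^sub>R v)) has_real_derivative dirderiv (dirderiv u w) v x) (at 0)" for w
    using C1_dir_line[OF C, of x 0 v "[w]"] x by simp
  show ?thesis
  proof (rule linearI)
    fix w w'
    show "iter_dd u [v, w + w'] x = iter_dd u [v, w] x + iter_dd u [v, w'] x"
      using dirderiv_cong_open[OF op x, of "dirderiv u (w+w')" "\<lambda>y. dirderiv u w y + dirderiv u w' y" v]
        dirderiv_add[OF C[of "[]", simplified]] DERIV_add[OF line line, of w w'] by simp
  next
    fix c w
    show "iter_dd u [v, c *\<^sub>R w] x = c *\<^sub>R iter_dd u [v, w] x"
      using dirderiv_cong_open[OF op x, of "dirderiv u (c *\<^sub>R w)" "\<lambda>y. c * dirderiv u w y" v]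
        dirderiv_scaleR[OF C[of "[]", simplified]] DERIV_cmult[OF line, of c w] by simp
  qed
qed

text \<open>The mean value theorem is applied along \<open>v\<close> to the difference of two copies
  shifted by \<open>h w\<close>, then along \<open>w\<close>. The head of the list is the direction
  differentiated last.\<close>

lemma iter_dd2_second_difference:
  assumes u: "Cinf_on U u" and h: "h > 0" and sub: "ball x r \<subseteq> U" and hr: "h * (norm v + norm w) < r"
  shows "\<exists>y. dist y x \<le> h * (norm v + norm w) \<and>
    u (x + h *\<^sub>R v + h *\<^sub>R w) - u (x + h *\<^sub>R v) - u (x + h *\<^sub>R w) + u x = h * h * iter_dd u [w, v] y"
proof -
  note C = Cinf_on_imp_C1_dir[OF u]
  have near: "dist (x + s *\<^sub>R v + q *\<^sub>R w) x \<le> h * (norm v + norm w)"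
    if "0 \<le> s" "s \<le> h" "0 \<le> q" "q \<le> h" for s q
  proof -
    have "dist (x + s *\<^sub>R v + q *\<^sub>R w) x \<le> \<bar>s\<bar> * norm v + \<bar>q\<bar> * norm w"
      by (simp add: dist_norm add.assoc) (metis norm_scaleR norm_triangle_ineq)
    also have "\<dots> \<le> h * norm v + h * norm w" using that by (intro add_mono mult_right_mono) auto
    finally show ?thesis by (simp add: algebra_simps)
  qed
  have inU: "x + s *\<^sub>R v + q *\<^sub>R w \<in> U" if "0 \<le> s" "s \<le> h" "0 \<le> q" "q \<le> h" for s q
    using near[OF that] hr sub by (force simp: dist_commute subset_eq)
  let ?\<phi> = "\<lambda>s. u ((x + h *\<^sub>R w) + s *\<^sub>R v) - u (x + s *\<^sub>R v)"
  have "\<exists>s>0. s < h \<and> ?\<phi> h - ?\<phi> 0 = (h - 0) * (dirderiv u v ((x + h *\<^sub>R w) + s *\<^sub>R v) - dirderiv u v (x + s *\<^sub>R v))"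
  proof (rule MVT2[OF h])
    fix s assume s: "0 \<le> s" "s \<le> h"
    have 1: "(x + h *\<^sub>R w) + s *\<^sub>R v \<in> U" using inU[of s h] s h by (simp add: add.assoc add.commute add.left_commute)
    have 2: "x + s *\<^sub>R v \<in> U" using inU[of s 0] s h by simp
    show "(?\<phi> has_real_derivative dirderiv u v ((x + h *\<^sub>R w) + s *\<^sub>R v) - dirderiv u v (x + s *\<^sub>R v)) (at s)"
      using C1_dir_line[OF C[of "[]"] 1[simplified]] C1_dir_line[OF C[of "[]"] 2] by (intro DERIV_diff) auto
  qed
  then obtain s where s: "0 < s" "s < h" and
    e1: "?\<phi> h - ?\<phi> 0 = h * (dirderiv u v ((x + h *\<^sub>R w) + s *\<^sub>R v) - dirderiv u v (x + s *\<^sub>R v))" by auto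
  let ?\<psi> = "\<lambda>q. dirderiv u v ((x + s *\<^sub>R v) + q *\<^sub>R w)"
  have "\<exists>q>0. q < h \<and> ?\<psi> h - ?\<psi> 0 = (h - 0) * iter_dd u [w, v] ((x + s *\<^sub>R v) + q *\<^sub>R w)"
  proof (rule MVT2[OF h])
    fix q assume q: "0 \<le> q" "q \<le> h"
    show "(?\<psi> has_real_derivative iter_dd u [w, v] ((x + s *\<^sub>R v) + q *\<^sub>R w)) (at q)"
      using C1_dir_line[OF C[of "[v]"] inU[of s q]] s q by simp
  qed
  then obtain q where q: "0 < q" "q < h" and
    e2: "?\<psi> h - ?\<psi> 0 = h * iter_dd u [w, v] ((x + s *\<^sub>R v) + q *\<^sub>R w)" by auto
  show ?thesis
    by (rule exI[of _ "(x + s *\<^sub>R v) + q *\<^sub>R w"])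
       (use near[of s q] s q e1 e2 in \<open>simp add: algebra_simps\<close>)
qed

text \<open>Schwarz's theorem: the second difference is symmetric in \<open>v\<close> and
  \<open>w\<close>, so the two mixed derivatives take a common value at two points arbitrarily close
  to \<open>x\<close>, and continuity forces equality at \<open>x\<close>.\<close>

lemma iter_dd2_sym:
  assumes u: "Cinf_on U u" and x: "x \<in> U"
  shows "iter_dd u [v, w] x = iter_dd u [w, v] x"
proof (rule ccontr)
  assume ne: "iter_dd u [v, w] x \<noteq> iter_dd u [w, v] x"
  define e where "e = \<bar>iter_dd u [v, w] x - iter_dd u [w, v] x\<bar> / 2"
  have e: "e > 0" using ne by (simp add: e_def)
  have op: "open U" using u by (simp add: Cinf_on_def)
  then obtain r where r: "r > 0" "ball x r \<subseteq> U" using x by (meson openE)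
  have cont: "\<exists>d>0. \<forall>y\<in>U. dist y x < d \<longrightarrow> dist (iter_dd u vs y) (iter_dd u vs x) < e" for vs
    using u x e unfolding Cinf_on_def continuous_on_iff by blast
  obtain d1 where d1: "d1 > 0" "\<And>y. y \<in> U \<Longrightarrow> dist y x < d1 \<Longrightarrow> dist (iter_dd u [v,w] y) (iter_dd u [v,w] x) < e"
    using cont by metis
  obtain d2 where d2: "d2 > 0" "\<And>y. y \<in> U \<Longrightarrow> dist y x < d2 \<Longrightarrow> dist (iter_dd u [w,v] y) (iter_dd u [w,v] x) < e"
    using cont by metis
  define K where "K = norm v + norm w + 1"
  have K: "K > 0" unfolding K_def by (smt (verit) norm_ge_zero)
  define m where "m = min r (min d1 d2)"
  have m: "m > 0" using r d1 d2 by (simp add: m_def)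
  define h where "h = m / K"
  have h: "h > 0" using m K by (simp add: h_def)
  have hm: "h * (norm v + norm w) < m"
  proof -
    have "h * (norm v + norm w) < h * K" using h by (simp add: K_def)
    then show ?thesis using K by (simp add: h_def)
  qed
  have hr: "h * (norm v + norm w) < r" using hm by (simp add: m_def)
  have hr': "h * (norm w + norm v) < r" using hr by (simp add: add.commute)
  obtain y where y: "dist y x \<le> h * (norm v + norm w)"
    "u (x + h *\<^sub>R v + h *\<^sub>R w) - u (x + h *\<^sub>R v) - u (x + h *\<^sub>R w) + u x = h * h * iter_dd u [w, v] y"
    using iter_dd2_second_difference[OF u h r(2) hr] by blast
  obtain z where z: "dist z x \<le> h * (norm w + norm v)"
    "u (x + h *\<^sub>R w + h *\<^sub>R v) - u (x + h *\<^sub>R w) - u (x + h *\<^sub>R v) + u x = h * h * iter_dd u [v, w] z"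
    using iter_dd2_second_difference[OF u h r(2) hr'] by blast
  have "h * h * iter_dd u [w, v] y = h * h * iter_dd u [v, w] z"
    using y(2) z(2) by (simp add: algebra_simps)
  then have eq: "iter_dd u [w, v] y = iter_dd u [v, w] z" using h by simp
  have "y \<in> U" "dist y x < d2" "z \<in> U" "dist z x < d1"
    using y(1) z(1) hm r(2) by (auto simp: m_def dist_commute subset_eq add.commute)
  then have "\<bar>iter_dd u [w,v] y - iter_dd u [w,v] x\<bar> < e" "\<bar>iter_dd u [v,w] z - iter_dd u [v,w] x\<bar> < e"
    using d1(2) d2(2) by (auto simp: dist_real_def)
  then show False using eq unfolding e_def by (simp add: abs_if split: if_splits)
qed

lemma taylor2_segment:
  assumes u: "Cinf_on U u" and seg: "closed_segment x (x + v) \<subseteq> U"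
  shows "\<exists>y\<in>closed_segment x (x + v). u (x + v) = u x + dirderiv u v x + iter_dd u [v, v] y / 2"
proof -
  note C = Cinf_on_imp_C1_dir[OF u]
  have inS: "x + t *\<^sub>R v \<in> closed_segment x (x + v)" if "0 \<le> t" "t \<le> 1" for t
    using that by (auto simp: in_segment algebra_simps intro!: exI[of _ t])
  define diff where "diff = (\<lambda>k t. iter_dd u (replicate k v) (x + t *\<^sub>R v))"
  have "\<exists>t. 0 < t \<and> t < 1 \<and> u (x + 1 *\<^sub>R v) =
     (\<Sum>m<2. (diff m 0 / fact m) * (1 - 0) ^ m) + (diff 2 t / fact 2) * (1 - 0) ^ 2"
  proof (rule Taylor_up[of 2 diff "\<lambda>t. u (x + t *\<^sub>R v)" 0 1 0])
    show "\<forall>m t. m < 2 \<and> 0 \<le> t \<and> t \<le> 1 \<longrightarrow> (diff m has_real_derivative diff (Suc m) t) (at t)"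
    proof (intro allI impI)
      fix m :: nat and t :: real assume "m < 2 \<and> 0 \<le> t \<and> t \<le> 1"
      then have "x + t *\<^sub>R v \<in> U" using inS seg by blast
      from C1_dir_line[OF C this] show "(diff m has_real_derivative diff (Suc m) t) (at t)"
        by (simp add: diff_def)
    qed
  qed (auto simp: diff_def)
  then obtain t where t: "0 < t" "t < 1" and
    e: "u (x + v) = (\<Sum>m<2. (diff m 0 / fact m)) + (diff 2 t / fact 2)"
    by auto
  show ?thesis
    by (rule bexI[OF _ inS[of t]]) (use t e in \<open>auto simp: diff_def numeral_2_eq_2\<close>)
qed

subsection \<open>The Levi form\<close>

text \<open>The hypothesis is made for all smaller radii, so that a minimum of finitely many radii
  still works.\<close>

lemma finite_uniform_radius:
  assumes "finite I" "\<And>i. i \<in> I \<Longrightarrow> \<exists>\<rho>>0::real. \<forall>t. 0 < t \<and> t \<le> \<rho> \<longrightarrow> P i t"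
  shows "\<exists>\<rho>>0::real. \<forall>i\<in>I. P i \<rho>"
proof -
  have "\<exists>\<rho>>0::real. \<forall>i\<in>I. \<forall>t. 0 < t \<and> t \<le> \<rho> \<longrightarrow> P i t"
    using assms
  proof (induction I)
    case empty then show ?case by (auto intro: exI[of _ 1])
  next
    case (insert i I)
    from insert.prems obtain a where a: "a > 0" "\<forall>t. 0 < t \<and> t \<le> a \<longrightarrow> P i t" by blast
    from insert obtain b where b: "b > 0" "\<forall>i\<in>I. \<forall>t. 0 < t \<and> t \<le> b \<longrightarrow> P i t" by blast
    show ?case by (rule exI[of _ "min a b"]) (use a b in auto)
  qed
  then show ?thesis by blast
qed

lemma iter_dd2_expand:
  fixes u :: "'a::euclidean_space \<Rightarrow> real"
  assumes "Cinf_on U u" "x \<in> U"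
  shows "iter_dd u [v, w] x = (\<Sum>b\<in>Basis. \<Sum>c\<in>Basis. (v \<bullet> b) * (w \<bullet> c) * iter_dd u [b, c] x)"
proof -
  note l = iter_dd2_linear_left[OF assms] and l' = iter_dd2_linear_right[OF assms]
  have "iter_dd u [v, w] x = iter_dd u [\<Sum>b\<in>Basis. (v \<bullet> b) *\<^sub>R b, w] x"
    by (simp add: euclidean_representation del: iter_dd.simps)
  also have "\<dots> = (\<Sum>b\<in>Basis. (v \<bullet> b) * iter_dd u [b, w] x)"
    by (simp add: linear_sum[OF l] linear_cmul[OF l] del: iter_dd.simps)
  also have "\<dots> = (\<Sum>b\<in>Basis. (v \<bullet> b) * iter_dd u [b, \<Sum>c\<in>Basis. (w \<bullet> c) *\<^sub>R c] x)"
    by (simp add: euclidean_representation del: iter_dd.simps)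
  also have "\<dots> = (\<Sum>b\<in>Basis. (v \<bullet> b) * (\<Sum>c\<in>Basis. (w \<bullet> c) * iter_dd u [b, c] x))"
    by (simp add: linear_sum[OF l'] linear_cmul[OF l'] del: iter_dd.simps)
  finally show ?thesis by (simp add: sum_distrib_left mult.assoc del: iter_dd.simps)
qed

text \<open>One radius serves all \<open>v\<close>, because only the finitely many entries
  \<open>iter_dd u [b, c]\<close> have to be uniformly continuous on \<open>K\<close>.\<close>

lemma iter_dd2_uniform:
  fixes u :: "'a::euclidean_space \<Rightarrow> real"
  assumes u: "Cinf_on U u" and K: "compact K" "K \<subseteq> U" and e: "\<eta> > 0"
  shows "\<exists>\<rho>>0. \<forall>x\<in>K. \<forall>y\<in>K. \<forall>v. dist x y < \<rho> \<longrightarrow>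
     \<bar>iter_dd u [v, v] x - iter_dd u [v, v] y\<bar> \<le> \<eta> * (norm v)\<^sup>2"
proof -
  \<comment> \<open>The error is shared equally among the entries of the bilinear form, whose
    coefficients are at most \<open>(norm v)\<^sup>2\<close>.\<close>
  define d where "d = \<eta> / (real DIM('a) * real DIM('a))"
  have d: "d > 0" using e by (simp add: d_def)
  define P where "P i t \<longleftrightarrow> (\<forall>x\<in>K. \<forall>y\<in>K. dist x y < t \<longrightarrow>
        \<bar>iter_dd u [fst i, snd i] x - iter_dd u [fst i, snd i] y\<bar> < d)" for i :: "'a \<times> 'a" and t
  have P: "\<exists>\<rho>>0. \<forall>t. 0 < t \<and> t \<le> \<rho> \<longrightarrow> P i t" for i :: "'a \<times> 'a"
  proof -
    have "continuous_on K (iter_dd u [fst i, snd i])"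
      using u K(2) continuous_on_subset unfolding Cinf_on_def by blast
    then have "uniformly_continuous_on K (iter_dd u [fst i, snd i])"
      using K(1) by (rule compact_uniformly_continuous)
    from this[unfolded uniformly_continuous_on_def, rule_format, OF d]
    obtain \<rho> where "\<rho> > 0" and unif: "\<And>x y. x \<in> K \<Longrightarrow> y \<in> K \<Longrightarrow> dist y x < \<rho> \<Longrightarrow>
        dist (iter_dd u [fst i, snd i] y) (iter_dd u [fst i, snd i] x) < d" by blast
    have "P i t" if "0 < t \<and> t \<le> \<rho>" for t
      unfolding P_def
    proof (intro ballI impI)
      fix x y assume "x \<in> K" "y \<in> K" "dist x y < t"
      then have "x \<in> K" "y \<in> K" "dist x y < \<rho>" using that by simp_all
      from \<open>y \<in> K\<close> \<open>x \<in> K\<close> this(3) show "\<bar>iter_dd u [fst i, snd i] x - iter_dd u [fst i, snd i] y\<bar> < d"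
        by (rule unif[unfolded dist_real_def])
    qed
    with \<open>\<rho> > 0\<close> show ?thesis by blast
  qed
  have "\<exists>\<rho>>0. \<forall>i\<in>Basis \<times> Basis. P i \<rho>"
    by (rule finite_uniform_radius) (simp_all add: P)
  then obtain \<rho> where r: "\<rho> > 0" and H: "\<forall>i\<in>Basis \<times> Basis. P i \<rho>" by blast
  have r2: "\<bar>iter_dd u [b, c] x - iter_dd u [b, c] y\<bar> < d"
    if "b \<in> Basis" "c \<in> Basis" "x \<in> K" "y \<in> K" "dist x y < \<rho>" for b c x y
    using bspec[OF H, of "(b, c)"] that unfolding P_def mem_Times_iff fst_conv snd_conv by blast
  show ?thesis
  proof (intro exI[of _ \<rho>] conjI ballI allI impI r)
    fix x y v assume xy: "x \<in> K" "y \<in> K" "dist x y < \<rho>"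
    have "\<bar>iter_dd u [v, v] x - iter_dd u [v, v] y\<bar>
       = \<bar>\<Sum>b\<in>Basis. \<Sum>c\<in>Basis. (v \<bullet> b) * (v \<bullet> c) * (iter_dd u [b, c] x - iter_dd u [b, c] y)\<bar>"
    proof -
      have "x \<in> U" "y \<in> U" using xy K(2) by auto
      show ?thesis
        unfolding iter_dd2_expand[OF u \<open>x \<in> U\<close>, of v v] iter_dd2_expand[OF u \<open>y \<in> U\<close>, of v v]
          right_diff_distrib sum_subtractf by (rule refl)
    qed
    also have "\<dots> \<le> (\<Sum>b\<in>Basis. \<Sum>c\<in>Basis. \<bar>(v \<bullet> b) * (v \<bullet> c) * (iter_dd u [b, c] x - iter_dd u [b, c] y)\<bar>)"
      by (intro order_trans[OF sum_abs] sum_mono sum_abs)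
    also have "\<dots> \<le> (\<Sum>b\<in>(Basis::'a set). \<Sum>c\<in>(Basis::'a set). (norm v)\<^sup>2 * d)"
    proof (intro sum_mono)
      fix b c :: 'a assume bc: "b \<in> Basis" "c \<in> Basis"
      have "\<bar>v \<bullet> b\<bar> * \<bar>v \<bullet> c\<bar> \<le> norm v * norm v"
        by (rule mult_mono[OF Basis_le_norm[OF bc(1)] Basis_le_norm[OF bc(2)]]) simp_all
      then show "\<bar>(v \<bullet> b) * (v \<bullet> c) * (iter_dd u [b, c] x - iter_dd u [b, c] y)\<bar> \<le> (norm v)\<^sup>2 * d"
        using less_imp_le[OF r2[OF bc xy]] unfolding abs_mult power2_eq_square
        by (rule mult_mono) (simp_all del: iter_dd.simps)
    qed
    also have "\<dots> = \<eta> * (norm v)\<^sup>2" by (simp add: d_def)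
    finally show "\<bar>iter_dd u [v, v] x - iter_dd u [v, v] y\<bar> \<le> \<eta> * (norm v)\<^sup>2" .
  qed
qed

text \<open>A quarter of the Laplacian at 0 of the function sending a complex number z to
  \<open>u\<close> at x + z w, that is, its mixed derivative in z and its conjugate.\<close>

definition levi :: "(complex^'n \<Rightarrow> real) \<Rightarrow> complex^'n \<Rightarrow> complex^'n \<Rightarrow> real" where
  "levi u x w = (iter_dd u [w, w] x + iter_dd u [\<i> *s w, \<i> *s w] x) / 4"

definition hform :: "complex^'n^'n \<Rightarrow> complex^'n \<Rightarrow> real" where
  "hform H w = Re (\<Sum>j\<in>UNIV. \<Sum>k\<in>UNIV. H $ j $ k * w $ j * cnj (w $ k))"

lemma cvec_expand: "w = (\<Sum>j\<in>UNIV. Re (w $ j) *\<^sub>R axis j 1 + Im (w $ j) *\<^sub>R axis j \<i>)" for w :: "complex^'n"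
proof -
  have "(\<Sum>j\<in>UNIV. Re (w $ j) *\<^sub>R axis j 1 + Im (w $ j) *\<^sub>R axis j \<i>) $ i = (\<Sum>j\<in>UNIV. if j = i then w $ i else 0)" for i
    unfolding sum_component by (intro sum.cong refl) (auto simp: axis_def complex_eq_iff)
  then show ?thesis by (simp add: vec_eq_iff)
qed

text \<open>Both second derivatives are expanded in the real basis. Passing from \<open>w\<close> to
  \<open>\<i> *s w\<close> exchanges real and imaginary parts up to sign, and the sum of matching
  coefficients is an entry of \<open>cHess\<close>.\<close>

lemma levi_eq_hform:
  assumes u: "Cinf_on U u" and x: "x \<in> U"
  shows "levi u x w = hform (cHess u x) w"
proof -
  define B where "B = (\<lambda>v w. iter_dd u [v, w] x)"
  have lin: "linear (\<lambda>v. B v w)" "linear (B v)" for v w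
    using iter_dd2_linear_left[OF u x] iter_dd2_linear_right[OF u x] by (simp_all add: B_def del: iter_dd.simps)
  have exp: "B v v = (\<Sum>j\<in>UNIV. \<Sum>k\<in>UNIV.
      Re (v$j) * Re (v$k) * B (axis j 1) (axis k 1) + Re (v$j) * Im (v$k) * B (axis j 1) (axis k \<i>)
    + Im (v$j) * Re (v$k) * B (axis j \<i>) (axis k 1) + Im (v$j) * Im (v$k) * B (axis j \<i>) (axis k \<i>))" for v
  proof -
    \<comment> \<open>\<open>arg_cong\<close> expands one slot at a time; as a rewrite rule the
      expansion would loop, since \<open>v\<close> recurs on its right-hand side.\<close>
    have "B v v = B (\<Sum>j\<in>UNIV. Re (v $ j) *\<^sub>R axis j 1 + Im (v $ j) *\<^sub>R axis j \<i>) v"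
      by (rule arg_cong[OF cvec_expand[of v], of "\<lambda>z. B z v"])
    also have "\<dots> = (\<Sum>j\<in>UNIV. Re (v $ j) * B (axis j 1) v + Im (v $ j) * B (axis j \<i>) v)"
      by (simp add: linear_sum[OF lin(1)] linear_add[OF lin(1)] linear_cmul[OF lin(1)])
    also have "\<dots> = (\<Sum>j\<in>UNIV. Re (v $ j) * B (axis j 1) (\<Sum>k\<in>UNIV. Re (v $ k) *\<^sub>R axis k 1 + Im (v $ k) *\<^sub>R axis k \<i>)
        + Im (v $ j) * B (axis j \<i>) (\<Sum>k\<in>UNIV. Re (v $ k) *\<^sub>R axis k 1 + Im (v $ k) *\<^sub>R axis k \<i>))"
      by (rule arg_cong[OF cvec_expand[of v], of "\<lambda>z. \<Sum>j\<in>UNIV. Re (v $ j) * B (axis j 1) z + Im (v $ j) * B (axis j \<i>) z"])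
    also have "\<dots> = (\<Sum>j\<in>UNIV. Re (v $ j) * (\<Sum>k\<in>UNIV. Re (v $ k) * B (axis j 1) (axis k 1) + Im (v $ k) * B (axis j 1) (axis k \<i>))
        + Im (v $ j) * (\<Sum>k\<in>UNIV. Re (v $ k) * B (axis j \<i>) (axis k 1) + Im (v $ k) * B (axis j \<i>) (axis k \<i>)))"
      by (simp add: linear_sum[OF lin(2)] linear_add[OF lin(2)] linear_cmul[OF lin(2)])
    also have "\<dots> = (\<Sum>j\<in>UNIV. \<Sum>k\<in>UNIV.
      Re (v$j) * Re (v$k) * B (axis j 1) (axis k 1) + Re (v$j) * Im (v$k) * B (axis j 1) (axis k \<i>)
    + Im (v$j) * Re (v$k) * B (axis j \<i>) (axis k 1) + Im (v$j) * Im (v$k) * B (axis j \<i>) (axis k \<i>))"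
      by (simp add: sum_distrib_left sum.distrib algebra_simps)
    finally show ?thesis .
  qed
  have "levi u x w = (B w w + B (\<i> *s w) (\<i> *s w)) / 4"
    by (simp add: levi_def B_def)
  also have "\<dots> = (\<Sum>j\<in>UNIV. \<Sum>k\<in>UNIV. Re (cHess u x $ j $ k * w $ j * cnj (w $ k)))"
    unfolding exp[of w] exp[of "\<i> *s w"] sum.distrib[symmetric] sum_divide_distrib
    by (intro sum.cong refl) (simp add: cHess_def B_def field_simps del: iter_dd.simps)
  also have "\<dots> = hform (cHess u x) w"
    by (simp add: hform_def)
  finally show ?thesis .
qed

lemma cHess_hermitian:
  assumes "Cinf_on U u" "x \<in> U"
  shows "cHess u x $ k $ j = cnj (cHess u x $ j $ k)"
proof -
  note sym = iter_dd2_sym[OF assms]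
  show ?thesis
    unfolding cHess_def vec_lambda_beta sym[of "axis k 1" "axis j 1"] sym[of "axis k \<i>" "axis j \<i>"]
      sym[of "axis k 1" "axis j \<i>"] sym[of "axis k \<i>" "axis j 1"]
    by (simp add: complex_eq_iff diff_divide_distrib del: iter_dd.simps)
qed

text \<open>The quadratic part on a complex line splits into the real part of a holomorphic
  polynomial and the rotation invariant Levi term. The first averages out over circles and can be
  divided out in the maximum principle. The remainder is kept as a difference of second derivatives,
  ready for \<open>iter_dd2_uniform\<close>.\<close>

lemma complex_line_taylor:
  assumes u: "Cinf_on U u" and x: "x \<in> U"
  obtains h1 h2 where "\<And>\<zeta>. closed_segment x (x + \<zeta> *s b) \<subseteq> U \<Longrightarrow>
     \<exists>y\<in>closed_segment x (x + \<zeta> *s b). u (x + \<zeta> *s b) = u x + Re (h1 * \<zeta> + h2 * \<zeta>\<^sup>2) + (cmod \<zeta>)\<^sup>2 * levi u x b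
        + (iter_dd u [\<zeta> *s b, \<zeta> *s b] y - iter_dd u [\<zeta> *s b, \<zeta> *s b] x) / 2"
proof -
  define B where "B = (\<lambda>v w. iter_dd u [v, w] x)"
  define ib where "ib = \<i> *s b"
  \<comment> \<open>For the function of z given by \<open>u\<close> at x + z b, \<open>h1\<close> is
    twice the first and \<open>h2\<close> the second derivative in z at 0.\<close>
  define h1 where "h1 = Complex (dirderiv u b x) (- dirderiv u ib x)"
  define h2 where "h2 = Complex ((B b b - B ib ib) / 4) (- B b ib / 2)"
  have lin: "linear (\<lambda>v. B v w)" "linear (B v)" for v w
    using iter_dd2_linear_left[OF u x] iter_dd2_linear_right[OF u x] by (simp_all add: B_def del: iter_dd.simps)
  have lin1: "linear (\<lambda>v. dirderiv u v x)"
    using dirderiv_linear[OF Cinf_on_imp_C1_dir[OF u, of "[]"] x] by simp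
  have sym: "B ib b = B b ib" using iter_dd2_sym[OF u x] by (simp add: B_def del: iter_dd.simps)
  have z: "\<zeta> *s b = Re \<zeta> *\<^sub>R b + Im \<zeta> *\<^sub>R ib" for \<zeta>
    by (simp add: vec_eq_iff ib_def complex_eq_iff)
  have d1: "dirderiv u (\<zeta> *s b) x = Re (h1 * \<zeta>)" for \<zeta>
    by (simp add: z linear_add[OF lin1] linear_cmul[OF lin1] h1_def algebra_simps)
  have d2: "B (\<zeta> *s b) (\<zeta> *s b) / 2 = Re (h2 * \<zeta>\<^sup>2) + (cmod \<zeta>)\<^sup>2 * levi u x b" for \<zeta>
  proof -
    have e1: "B (\<zeta> *s b) (\<zeta> *s b) = (Re \<zeta>)\<^sup>2 * B b b + 2 * Re \<zeta> * Im \<zeta> * B b ib + (Im \<zeta>)\<^sup>2 * B ib ib"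
      unfolding z using sym
      by (simp add: linear_add[OF lin(1)] linear_cmul[OF lin(1)] linear_add[OF lin(2)] linear_cmul[OF lin(2)] power2_eq_square algebra_simps)
    have e2: "levi u x b = (B b b + B ib ib) / 4" by (simp add: levi_def B_def ib_def)
    have e3: "Re (h2 * \<zeta>\<^sup>2) = (B b b - B ib ib) / 4 * ((Re \<zeta>)\<^sup>2 - (Im \<zeta>)\<^sup>2) + B b ib * Re \<zeta> * Im \<zeta>"
      by (simp add: h2_def power2_eq_square)
    show ?thesis
      unfolding cmod_power2 e1 e2 e3 by (simp add: field_simps)
  qed
  show thesis
  proof (rule that)
    fix \<zeta> assume "closed_segment x (x + \<zeta> *s b) \<subseteq> U"
    from taylor2_segment[OF u this] obtain y where y: "y \<in> closed_segment x (x + \<zeta> *s b)"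
      "u (x + \<zeta> *s b) = u x + dirderiv u (\<zeta> *s b) x + iter_dd u [\<zeta> *s b, \<zeta> *s b] y / 2" by blast
    have "u (x + \<zeta> *s b) = u x + Re (h1 * \<zeta> + h2 * \<zeta>\<^sup>2) + (cmod \<zeta>)\<^sup>2 * levi u x b
        + (iter_dd u [\<zeta> *s b, \<zeta> *s b] y - iter_dd u [\<zeta> *s b, \<zeta> *s b] x) / 2"
      using d1[of \<zeta>] d2[of \<zeta>] y(2) unfolding B_def plus_complex.sel diff_divide_distrib by argo
    with y(1) show "\<exists>y\<in>closed_segment x (x + \<zeta> *s b). u (x + \<zeta> *s b) = u x + Re (h1 * \<zeta> + h2 * \<zeta>\<^sup>2) + (cmod \<zeta>)\<^sup>2 * levi u x b
        + (iter_dd u [\<zeta> *s b, \<zeta> *s b] y - iter_dd u [\<zeta> *s b, \<zeta> *s b] x) / 2" by blast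
  qed
qed

lemma norm_cvec_scale: "norm (\<zeta> *s b) = cmod \<zeta> * norm b" for b :: "complex^'n"
  by (simp add: norm_vec_def L2_set_def norm_mult power_mult_distrib sum_distrib_left[symmetric] real_sqrt_mult)

lemma trig_poly_has_integral_0:
  "((\<lambda>\<theta>. Re (\<alpha> * cis \<theta> + \<beta> * (cis \<theta>)\<^sup>2)) has_integral 0) {0..2*pi}"
proof -
  let ?F = "\<lambda>\<theta>. Re \<alpha> * sin \<theta> + Im \<alpha> * cos \<theta> + Re \<beta> * sin (2 * \<theta>) / 2 + Im \<beta> * cos (2 * \<theta>) / 2"
  have eq: "Re (\<alpha> * cis \<theta> + \<beta> * (cis \<theta>)\<^sup>2) = Re \<alpha> * cos \<theta> - Im \<alpha> * sin \<theta> + Re \<beta> * cos (2*\<theta>) - Im \<beta> * sin (2*\<theta>)" for \<theta>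
    by (simp add: Complex.DeMoivre)
  have "((\<lambda>\<theta>. Re (\<alpha> * cis \<theta> + \<beta> * (cis \<theta>)\<^sup>2)) has_integral ?F (2*pi) - ?F 0) {0..2*pi}"
    unfolding eq
    by (rule fundamental_theorem_of_calculus)
       (auto intro!: derivative_eq_intros simp: has_real_derivative_iff_has_vector_derivative[symmetric])
  moreover have "?F (2*pi) - ?F 0 = 0"
    using sin_npi[of 4] cos_2npi[of 2] by (simp add: mult.assoc[symmetric])
  ultimately show ?thesis by (simp only:)
qed

text \<open>With a negative Levi form, the mean of \<open>u\<close> over a small circle would fall
  below \<open>u x\<close>: the holomorphic part of the Taylor expansion averages to 0 and the Levi
  term dominates the remainder.\<close>

lemma psh_levi_nonneg:
  assumes u: "Cinf_on U u" and \<Omega>: "open \<Omega>" "\<Omega> \<subseteq> U" and p: "psh \<Omega> u" and x: "x \<in> \<Omega>"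
  shows "levi u x b \<ge> 0"
proof (rule ccontr)
  assume "\<not> levi u x b \<ge> 0"
  then have neg: "levi u x b < 0" by simp
  from \<Omega>(1) x obtain R where R: "R > 0" "cball x R \<subseteq> \<Omega>" by (meson open_contains_cball)
  \<comment> \<open>With this choice the Taylor remainder is at most half the absolute value of the
    Levi term; the added 1 keeps the denominator positive.\<close>
  define \<eta> where "\<eta> = - levi u x b / (1 + (norm b)\<^sup>2)"
  have nb: "1 + (norm b)\<^sup>2 > 0" by (simp add: add_pos_nonneg)
  have \<eta>: "\<eta> > 0" using neg nb by (simp add: \<eta>_def divide_neg_pos)
  obtain \<rho> where \<rho>: "\<rho> > 0" "\<And>y z v. y \<in> cball x R \<Longrightarrow> z \<in> cball x R \<Longrightarrow> dist y z < \<rho> \<Longrightarrow>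
     \<bar>iter_dd u [v, v] y - iter_dd u [v, v] z\<bar> \<le> \<eta> * (norm v)\<^sup>2"
    using iter_dd2_uniform[OF u compact_cball _ \<eta>, of x R] R(2) \<Omega>(2) by blast
  obtain h1 h2 where h: "\<And>\<zeta>. closed_segment x (x + \<zeta> *s b) \<subseteq> U \<Longrightarrow>
     \<exists>y\<in>closed_segment x (x + \<zeta> *s b). u (x + \<zeta> *s b) = u x + Re (h1 * \<zeta> + h2 * \<zeta>\<^sup>2) + (cmod \<zeta>)\<^sup>2 * levi u x b
        + (iter_dd u [\<zeta> *s b, \<zeta> *s b] y - iter_dd u [\<zeta> *s b, \<zeta> *s b] x) / 2"
    using complex_line_taylor[OF u, of x b] x \<Omega>(2) by blast
  define r where "r = min R \<rho> / (2 * (1 + norm b))"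
  have r: "r > 0" using R \<rho> by (simp add: r_def add_pos_nonneg)
  have rb: "r * norm b < min R \<rho>"
  proof -
    have "r * norm b \<le> r * (1 + norm b)" using r by simp
    also have "\<dots> = min R \<rho> / 2" using norm_ge_zero[of b] by (simp add: r_def nonzero_divide_eq_eq divide_eq_eq add_nonneg_eq_0_iff)
    also have "\<dots> < min R \<rho>" using R(1) \<rho>(1) by linarith
    finally show ?thesis .
  qed
  have inball: "x + \<zeta> *s (r *\<^sub>R b) \<in> cball x R" if "cmod \<zeta> \<le> 1" for \<zeta>
  proof -
    have "norm (\<zeta> *s (r *\<^sub>R b)) \<le> 1 * (r * norm b)"
      unfolding norm_cvec_scale using that r by (intro mult_mono) auto
    then show ?thesis using rb by (simp add: dist_norm)
  qed
  have bound: "u (x + cis \<theta> *s (r *\<^sub>R b)) \<le> (u x + r\<^sup>2 * levi u x b / 2) + Re (h1 * r * cis \<theta> + h2 * r\<^sup>2 * (cis \<theta>)\<^sup>2)" for \<theta>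
  proof -
    define \<zeta> where "\<zeta> = of_real r * cis \<theta>"
    have eq: "cis \<theta> *s (r *\<^sub>R b) = \<zeta> *s b" by (simp add: vec_eq_iff \<zeta>_def scaleR_conv_of_real[where 'a=complex])
    have cz: "cmod \<zeta> = r" using r by (simp add: \<zeta>_def norm_mult)
    have nz: "norm (\<zeta> *s b) = r * norm b" by (simp add: norm_cvec_scale cz)
    have "x + \<zeta> *s b \<in> cball x R" using inball[of "cis \<theta>"] eq by simp
    then have seg: "closed_segment x (x + \<zeta> *s b) \<subseteq> cball x R"
      using R(1) by (intro closed_segment_subset) auto
    then obtain y where y: "y\<in>closed_segment x (x + \<zeta> *s b)" 
      "u (x + \<zeta> *s b) = u x + Re (h1 * \<zeta> + h2 * \<zeta>\<^sup>2) + (cmod \<zeta>)\<^sup>2 * levi u x b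
        + (iter_dd u [\<zeta> *s b, \<zeta> *s b] y - iter_dd u [\<zeta> *s b, \<zeta> *s b] x) / 2"
      using h[of \<zeta>] R(2) \<Omega>(2) by blast
    have "dist y x \<le> norm (\<zeta> *s b)"
      using segment_bound(1)[OF y(1)] by (simp add: dist_norm)
    then have "dist y x < \<rho>" using nz rb by simp
    then have "\<bar>iter_dd u [\<zeta> *s b, \<zeta> *s b] y - iter_dd u [\<zeta> *s b, \<zeta> *s b] x\<bar> \<le> \<eta> * (r * norm b)\<^sup>2"
      using \<rho>(2)[of y x "\<zeta> *s b"] y(1) seg R(1) nz by (auto simp del: iter_dd.simps)
    also have "\<dots> \<le> r\<^sup>2 * (\<eta> * (1 + (norm b)\<^sup>2))"
      using \<eta> by (simp add: power_mult_distrib algebra_simps)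
    also have "\<dots> = - r\<^sup>2 * levi u x b" using nb by (simp add: \<eta>_def)
    finally have "iter_dd u [\<zeta> *s b, \<zeta> *s b] y - iter_dd u [\<zeta> *s b, \<zeta> *s b] x \<le> - r\<^sup>2 * levi u x b"
      by (rule abs_le_D1)
    from divide_right_mono[OF this, of 2] have "u (x + \<zeta> *s b) \<le> u x + Re (h1 * \<zeta> + h2 * \<zeta>\<^sup>2) + r\<^sup>2 * levi u x b + - r\<^sup>2 * levi u x b / 2"
      using y(2) unfolding cz by argo
    then show ?thesis unfolding eq by (simp add: \<zeta>_def power_mult_distrib algebra_simps)
  qed
  have "continuous_on U u" using u unfolding Cinf_on_def by (metis iter_dd.simps(1))
  then have ci: "continuous_on {0..2*pi} (\<lambda>\<theta>. u (x + cis \<theta> *s (r *\<^sub>R b)))"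
    by (rule continuous_on_compose2)
       (use inball R(2) \<Omega>(2) in \<open>auto intro!: continuous_intros simp: vector_scalar_mult_def subset_iff\<close>)
  have "u x \<le> 1 / (2 * pi) * integral {0..2*pi} (\<lambda>\<theta>. u (x + cis \<theta> *s (r *\<^sub>R b)))"
    using p inball R(2) unfolding psh_def by blast
  also have "\<dots> \<le> 1 / (2 * pi) * (2 * pi * (u x + r\<^sup>2 * levi u x b / 2))"
  proof (intro mult_left_mono)
    have "((\<lambda>\<theta>. u x + r\<^sup>2 * levi u x b / 2) has_integral (2 * pi - 0) *\<^sub>R (u x + r\<^sup>2 * levi u x b / 2)) {0..2*pi}"
      using has_integral_const_real[of "u x + r\<^sup>2 * levi u x b / 2" 0 "2*pi"] by simp
    from has_integral_add[OF this trig_poly_has_integral_0[of "h1 * r" "h2 * r\<^sup>2"]]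
    have "((\<lambda>\<theta>. (u x + r\<^sup>2 * levi u x b / 2) + Re (h1 * r * cis \<theta> + h2 * r\<^sup>2 * (cis \<theta>)\<^sup>2)) has_integral 
      2 * pi * (u x + r\<^sup>2 * levi u x b / 2)) {0..2*pi}"
      by (simp only: add_0_right diff_zero real_scaleR_def)
    from has_integral_le[OF integrable_integral[OF integrable_continuous_interval[OF ci]] this] bound
    show "integral {0..2*pi} (\<lambda>\<theta>. u (x + cis \<theta> *s (r *\<^sub>R b))) \<le> 2 * pi * (u x + r\<^sup>2 * levi u x b / 2)" by blast
  qed simp
  also have "\<dots> = u x + r\<^sup>2 * levi u x b / 2" by simp
  finally show False using neg r by (simp add: mult_pos_neg zero_le_mult_iff)
qed

subsection \<open>Polynomials vanishing on a finite set\<close>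

text \<open>Gaussian elimination: a nonzero pivot removes one equation and one unknown, and a zero
  row removes only an equation.\<close>

lemma underdetermined_system:
  fixes M :: "'b \<Rightarrow> 'a \<Rightarrow> 'c::field"
  assumes "finite R" "finite I" "card R < card I"
  shows "\<exists>c. (\<exists>i\<in>I. c i \<noteq> 0) \<and> (\<forall>r\<in>R. (\<Sum>i\<in>I. M r i * c i) = 0)"
  using assms
proof (induction R arbitrary: I M rule: finite_induct)
  case empty
  then obtain i where "i \<in> I" by fastforce
  then show ?case by (intro exI[of _ "\<lambda>_. 1"]) auto
next
  case (insert r R)
  show ?case
  proof (cases "\<forall>i\<in>I. M r i = 0")
    case True
    have "card R < card I" using insert by simp
    from insert.IH[OF insert.prems(1) this, of M] True show ?thesis by auto
  next
    case False
    then obtain p where p: "p \<in> I" "M r p \<noteq> 0" by blast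
    define J where "J = I - {p}"
    have J: "finite J" "card R < card J" using insert p by (auto simp: J_def)
    \<comment> \<open>These are the remaining rows with column \<open>p\<close> eliminated by means
      of row \<open>r\<close>; below, \<open>d\<close> gives the pivot unknown the value that row
      \<open>r\<close> dictates.\<close>
    define M' where "M' = (\<lambda>s i. M s i - M s p * M r i / M r p)"
    obtain c where c: "\<exists>i\<in>J. c i \<noteq> 0" "\<forall>s\<in>R. (\<Sum>i\<in>J. M' s i * c i) = 0"
      using insert.IH[OF J, of M'] by blast
    define d where "d = c(p := - (\<Sum>i\<in>J. M r i * c i) / M r p)"
    have sumd: "(\<Sum>i\<in>I. M s i * d i) = (\<Sum>i\<in>J. M s i * c i) - M s p * (\<Sum>i\<in>J. M r i * c i) / M r p" for s
    proof -
      have "(\<Sum>i\<in>I. M s i * d i) = M s p * d p + (\<Sum>i\<in>J. M s i * d i)"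
        using insert.prems(1) p(1) by (simp add: J_def sum.remove)
      also have "(\<Sum>i\<in>J. M s i * d i) = (\<Sum>i\<in>J. M s i * c i)"
        by (intro sum.cong) (auto simp: d_def J_def)
      finally show ?thesis by (simp add: d_def)
    qed
    have "(\<Sum>i\<in>I. M s i * d i) = 0" if "s \<in> R" for s
    proof -
      have "(\<Sum>i\<in>J. M' s i * c i) = (\<Sum>i\<in>J. M s i * c i) - M s p * (\<Sum>i\<in>J. M r i * c i) / M r p"
        by (simp add: M'_def left_diff_distrib sum_subtractf sum_distrib_left sum_divide_distrib mult.assoc)
      then show ?thesis using c(2) that sumd[of s] by simp
    qed
    moreover have "(\<Sum>i\<in>I. M r i * d i) = 0" using sumd[of r] p(2) by simp
    moreover have "\<exists>i\<in>I. d i \<noteq> 0" using c(1) by (auto simp: d_def J_def)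
    ultimately show ?thesis by (intro exI[of _ d]) auto
  qed
qed

text \<open>Bounding each exponent separately, not the total degree, gives exactly D^n monomials and
  keeps the degree along every coordinate line below \<open>D\<close>.\<close>

definition mpoly_eval :: "nat \<Rightarrow> (('n \<Rightarrow> nat) \<Rightarrow> complex) \<Rightarrow> complex^'n \<Rightarrow> complex^'n \<Rightarrow> complex" where
  "mpoly_eval D co c z = (\<Sum>\<alpha>\<in>(UNIV \<rightarrow>\<^sub>E {..<D}). co \<alpha> * (\<Prod>i\<in>UNIV. (z $ i - c $ i) ^ \<alpha> i))"

text \<open>Uniqueness of digits in base \<open>D\<close>: compare modulo \<open>D\<close>, cancel
  the lowest digit, divide by \<open>D\<close>.\<close>

lemma digits_inj:
  fixes \<alpha> \<beta> :: "nat \<Rightarrow> nat"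
  assumes "\<And>i. i < m \<Longrightarrow> \<alpha> i < D" "\<And>i. i < m \<Longrightarrow> \<beta> i < D"
    "(\<Sum>i<m. D ^ i * \<alpha> i) = (\<Sum>i<m. D ^ i * \<beta> i)" "i < m"
  shows "\<alpha> i = \<beta> i"
  using assms
proof (induction m arbitrary: \<alpha> \<beta> i)
  case (Suc m)
  have s: "(\<Sum>i<Suc m. D ^ i * g i) = g 0 + D * (\<Sum>i<m. D ^ i * g (Suc i))" for g :: "nat \<Rightarrow> nat"
    unfolding sum.lessThan_Suc_shift by (simp add: sum_distrib_left mult.assoc)
  have eq: "\<alpha> 0 + D * (\<Sum>i<m. D ^ i * \<alpha> (Suc i)) = \<beta> 0 + D * (\<Sum>i<m. D ^ i * \<beta> (Suc i))"
    using Suc.prems(3) unfolding s .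
  have lt: "\<alpha> 0 < D" "\<beta> 0 < D" using Suc.prems by auto
  have e0: "\<alpha> 0 = \<beta> 0" using arg_cong[OF eq, of "\<lambda>x. x mod D"] lt by simp
  then have e1: "(\<Sum>i<m. D ^ i * \<alpha> (Suc i)) = (\<Sum>i<m. D ^ i * \<beta> (Suc i))"
    using eq lt by auto
  show ?case
  proof (cases i)
    case 0 then show ?thesis using e0 by simp
  next
    case (Suc k)
    with Suc.IH[of "\<lambda>i. \<alpha> (Suc i)" "\<lambda>i. \<beta> (Suc i)" k] Suc.prems e1 show ?thesis by simp
  qed
qed simp

text \<open>Kronecker substitution: \<open>z\<^sub>i - c\<^sub>i = \<zeta> ^ D ^ i\<close> separates the monomials.\<close>
lemma mpoly_nonzero_near_centre:
  fixes c :: "complex^'n"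
  assumes "\<exists>\<alpha>\<in>UNIV \<rightarrow>\<^sub>E {..<D}. co \<alpha> \<noteq> 0" "r > 0"
  shows "\<exists>z. (\<forall>i. cmod (z $ i - c $ i) < r) \<and> mpoly_eval D co c z \<noteq> 0"
proof -
  let ?E = "UNIV \<rightarrow>\<^sub>E {..<D} :: ('n \<Rightarrow> nat) set"
  have finE: "finite ?E" by (intro finite_PiE) auto
  from assms(1) obtain \<alpha>0 where a0: "\<alpha>0 \<in> ?E" "co \<alpha>0 \<noteq> 0" by blast
  have D: "D > 0" using a0(1) PiE_mem[of \<alpha>0 UNIV "\<lambda>_. {..<D}" undefined] by (cases D) auto
  obtain e :: "nat \<Rightarrow> 'n" where e: "bij_betw e {..<CARD('n)} UNIV"
    using ex_bij_betw_nat_finite[of "UNIV :: 'n set"] by (auto simp: atLeast0LessThan)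
  define idx where "idx = inv_into {..<CARD('n)} e"
  have idx: "bij_betw idx UNIV {..<CARD('n)}" unfolding idx_def by (rule bij_betw_inv_into[OF e])
  have ei: "e (idx i) = i" for i
    using e unfolding idx_def bij_betw_def by (metis UNIV_I f_inv_into_f)
  have ie: "idx (e k) = k" if "k < CARD('n)" for k
    using e that unfolding idx_def bij_betw_def by (simp add: inv_into_f_f)
  define N where "N = (\<lambda>\<alpha>::'n \<Rightarrow> nat. \<Sum>i\<in>UNIV. D ^ idx i * \<alpha> i)"
  have N: "N \<alpha> = (\<Sum>k<CARD('n). D ^ k * \<alpha> (e k))" for \<alpha>
    unfolding N_def using sum.reindex_bij_betw[OF e, of "\<lambda>i. D ^ idx i * \<alpha> i"] ie by simp
  have inj: "inj_on N ?E"
  proof (rule inj_onI)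
    fix \<alpha> \<beta> assume ab: "\<alpha> \<in> ?E" "\<beta> \<in> ?E" "N \<alpha> = N \<beta>"
    have "\<alpha> (e k) = \<beta> (e k)" if "k < CARD('n)" for k
      using digits_inj[of "CARD('n)" "\<lambda>k. \<alpha> (e k)" D "\<lambda>k. \<beta> (e k)" k] ab that unfolding N by auto
    then show "\<alpha> = \<beta>" using ei idx unfolding bij_betw_def fun_eq_iff by (metis lessThan_iff rangeI)
  qed
  define p where "p = (\<Sum>\<alpha>\<in>?E. monom (co \<alpha>) (N \<alpha>))"
  \<comment> \<open>Since \<open>N\<close> is injective on the exponents, distinct monomials do not
    collide and only the term of \<open>\<alpha>0\<close> contributes.\<close>
  have "coeff p (N \<alpha>0) = (\<Sum>\<alpha>\<in>?E. if \<alpha> = \<alpha>0 then co \<alpha> else 0)"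
    unfolding p_def coeff_sum using inj a0(1) by (intro sum.cong) (auto simp: inj_on_def)
  also have "\<dots> = co \<alpha>0" using a0(1) finE by simp
  finally have "p \<noteq> 0" using a0(2) by auto
  then have "finite {\<zeta>. poly p \<zeta> = 0}" by (rule poly_roots_finite)
  \<comment> \<open>The cap at 1 ensures that the powers of \<open>\<zeta>\<close> used for the
    coordinates are no larger than \<open>\<zeta>\<close> itself.\<close>
  moreover have "infinite (ball (0::complex) (min r 1))"
    using assms(2) uncountable_ball[of "min r 1" "0::complex"] uncountable_infinite by auto
  ultimately have "\<not> ball (0::complex) (min r 1) \<subseteq> {\<zeta>. poly p \<zeta> = 0}"
    using finite_subset by blast
  then obtain \<zeta> where z: "cmod \<zeta> < min r 1" "poly p \<zeta> \<noteq> 0" by (auto simp: subset_eq)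
  define w :: "complex^'n" where "w = (\<chi> i. c $ i + \<zeta> ^ (D ^ idx i))"
  have "mpoly_eval D co c w = poly p \<zeta>"
    unfolding mpoly_eval_def p_def poly_sum
    by (intro sum.cong refl) (simp add: poly_monom w_def N_def power_mult power_sum)
  moreover have "cmod (w $ i - c $ i) < r" for i
  proof -
    have "cmod \<zeta> ^ (D ^ idx i) \<le> cmod \<zeta> ^ 1" 
      using z(1) D by (intro power_decreasing) auto
    then show ?thesis using z(1) by (simp add: w_def norm_power)
  qed
  ultimately show ?thesis using z(2) by metis
qed

text \<open>Each point imposes one linear condition on the D^n coefficients, so there are fewer
  conditions than unknowns.\<close>

lemma vanishing_mpoly_exists:
  fixes A :: "(complex^'n) set"
  assumes "finite A" "card A < D ^ CARD('n)"
  shows "\<exists>co. (\<exists>\<alpha>\<in>UNIV \<rightarrow>\<^sub>E {..<D}. co \<alpha> \<noteq> 0) \<and> (\<forall>a\<in>A. mpoly_eval D co c a = 0)"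
proof -
  let ?E = "UNIV \<rightarrow>\<^sub>E {..<D} :: ('n \<Rightarrow> nat) set"
  have fin: "finite ?E" by (intro finite_PiE) auto
  have "card ?E = D ^ CARD('n)" by (simp add: card_PiE)
  with underdetermined_system[OF assms(1) fin, of "\<lambda>a \<alpha>. \<Prod>i\<in>UNIV. (a $ i - c $ i) ^ \<alpha> i"] assms(2)
  show ?thesis unfolding mpoly_eval_def by (auto simp: mult.commute)
qed

lemma mpoly_complex_line:
  "\<exists>p. \<forall>\<zeta>. mpoly_eval D co c (x + \<zeta> *s b) = poly p \<zeta>"
proof -
  define p where "p = (\<Sum>\<alpha>\<in>(UNIV \<rightarrow>\<^sub>E {..<D}). [:co \<alpha>:] * (\<Prod>i\<in>UNIV. [:x $ i - c $ i, b $ i:] ^ \<alpha> i))"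
  have eq: "(x + \<zeta> *s b) $ i - c $ i = poly [:x $ i - c $ i, b $ i:] \<zeta>" for \<zeta> i
    by (simp add: algebra_simps)
  have "mpoly_eval D co c (x + \<zeta> *s b) = poly p \<zeta>" for \<zeta>
    unfolding mpoly_eval_def p_def poly_sum poly_mult poly_prod poly_power eq by simp
  then show ?thesis by blast
qed

text \<open>A real basis vector moves a single complex coordinate, so only the exponent of that
  variable counts for the degree.\<close>

lemma mpoly_coordinate_line:
  fixes x c :: "complex^'n"
  assumes b: "b \<in> Basis"
  shows "\<exists>p. degree p \<le> D \<and> (\<forall>t. mpoly_eval D co c (x + t *\<^sub>R b) = poly p (of_real t))"
proof -
  obtain i0 w where b: "b = axis i0 w" using b unfolding Basis_vec_def by blast
  define p where "p = (\<Sum>\<alpha>\<in>(UNIV \<rightarrow>\<^sub>E {..<D}). 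
     smult (co \<alpha> * (\<Prod>i\<in>UNIV-{i0}. (x $ i - c $ i) ^ \<alpha> i)) ([:x $ i0 - c $ i0, w:] ^ \<alpha> i0))"
  have "degree p \<le> D"
    unfolding p_def
  proof (intro degree_sum_le)
    fix \<alpha> :: "'n \<Rightarrow> nat" assume "\<alpha> \<in> UNIV \<rightarrow>\<^sub>E {..<D}"
    then have "\<alpha> i0 < D" by auto
    have "degree ([:x $ i0 - c $ i0, w:] ^ \<alpha> i0) \<le> degree [:x $ i0 - c $ i0, w:] * \<alpha> i0"
      by (rule degree_power_le)
    also have "\<dots> \<le> 1 * \<alpha> i0" by (intro mult_right_mono) auto
    finally have "degree ([:x $ i0 - c $ i0, w:] ^ \<alpha> i0) \<le> D" using \<open>\<alpha> i0 < D\<close> by linarith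
    then show "degree (smult (co \<alpha> * (\<Prod>i\<in>UNIV-{i0}. (x $ i - c $ i) ^ \<alpha> i)) ([:x $ i0 - c $ i0, w:] ^ \<alpha> i0)) \<le> D"
      by (rule order_trans[OF degree_smult_le])
  qed (simp add: finite_PiE)
  moreover have "mpoly_eval D co c (x + t *\<^sub>R b) = poly p (of_real t)" for t
    unfolding mpoly_eval_def p_def poly_sum
  proof (intro sum.cong refl)
    fix \<alpha> :: "'n \<Rightarrow> nat"
    have "(\<Prod>i\<in>UNIV. ((x + t *\<^sub>R b) $ i - c $ i) ^ \<alpha> i) = 
      ((x + t *\<^sub>R b) $ i0 - c $ i0) ^ \<alpha> i0 * (\<Prod>i\<in>UNIV-{i0}. ((x + t *\<^sub>R b) $ i - c $ i) ^ \<alpha> i)"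
      by (rule prod.remove) auto
    also have "(\<Prod>i\<in>UNIV-{i0}. ((x + t *\<^sub>R b) $ i - c $ i) ^ \<alpha> i) = (\<Prod>i\<in>UNIV-{i0}. (x $ i - c $ i) ^ \<alpha> i)"
      by (intro prod.cong) (auto simp: b axis_def)
    also have "(x + t *\<^sub>R b) $ i0 - c $ i0 = poly [:x $ i0 - c $ i0, w:] (of_real t)"
      by (simp add: b axis_def scaleR_conv_of_real[where 'a=complex])
    finally show "co \<alpha> * (\<Prod>i\<in>UNIV. ((x + t *\<^sub>R b) $ i - c $ i) ^ \<alpha> i) =
       poly (smult (co \<alpha> * (\<Prod>i\<in>UNIV-{i0}. (x $ i - c $ i) ^ \<alpha> i)) ([:x $ i0 - c $ i0, w:] ^ \<alpha> i0)) (of_real t)"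
      by (simp add: mult_ac)
  qed
  ultimately show ?thesis by blast
qed

lemma continuous_mpoly_eval: "continuous_on S (mpoly_eval D co c)"
  unfolding mpoly_eval_def by (intro continuous_intros)

subsection \<open>Volume of polynomial sublevel sets\<close>

text \<open>\<open>0 powr - e\<close> evaluates to 0, so the pole at 0 is put in by hand.\<close>

definition neg_powr :: "real \<Rightarrow> real \<Rightarrow> ennreal" where
  "neg_powr e y = (if y = 0 then \<infinity> else ennreal (y powr - e))"

lemma borel_measurable_neg_powr [measurable]: "neg_powr e \<in> borel_measurable borel"
  unfolding neg_powr_def by measurable

text \<open>The bound 4 is twice the integral of \<open>t powr (-1/2)\<close> over the unit
  interval.\<close>

lemma nn_integral_inv_sqrt_near:
  "(\<integral>\<^sup>+t. ennreal (\<bar>t - \<xi>\<bar> powr (-1/2)) * indicator {\<xi>-1..\<xi>+1} t \<partial>lborel) \<le> 4"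
proof -
  let ?f = "\<lambda>t::real. ennreal (\<bar>t\<bar> powr (-1/2)) * indicator {-1..1} t"
  let ?g = "\<lambda>t::real. ennreal (t powr (-1/2)) * indicator {0..1} t"
  have "((\<lambda>x. x powr (-1/2)) has_integral (1 powr (-1/2+1) / (-1/2+1))) {0..1::real}"
    by (rule has_integral_powr_from_0) auto
  then have "((\<lambda>x. x powr (-1/2)) has_integral 2) {0..1::real}" by simp
  from nn_integral_has_integral_lebesgue'[OF _ this] have g: "(\<integral>\<^sup>+t. ?g t \<partial>lborel) = 2" by simp
  have "(\<integral>\<^sup>+t. ?g t \<partial>lborel) = \<bar>-1::real\<bar> * (\<integral>\<^sup>+t. ?g (0 + (-1) * t) \<partial>lborel)"
    by (rule nn_integral_real_affine) auto
  then have g': "(\<integral>\<^sup>+t. ?g (- t) \<partial>lborel) = 2" using g by simp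
  have "(\<integral>\<^sup>+t. ennreal (\<bar>t - \<xi>\<bar> powr (-1/2)) * indicator {\<xi>-1..\<xi>+1} t \<partial>lborel)
      = \<bar>1::real\<bar> * (\<integral>\<^sup>+t. ennreal (\<bar>(\<xi> + 1 * t) - \<xi>\<bar> powr (-1/2)) * indicator {\<xi>-1..\<xi>+1} (\<xi> + 1 * t) \<partial>lborel)"
    by (rule nn_integral_real_affine) auto
  also have "\<dots> = (\<integral>\<^sup>+t. ?f t \<partial>lborel)"
    unfolding abs_one ennreal_1 mult_1 by (intro nn_integral_cong) (auto simp: indicator_def)
  also have "\<dots> \<le> (\<integral>\<^sup>+t. ?g t + ?g (- t) \<partial>lborel)"
    by (intro nn_integral_mono) (auto simp: indicator_def abs_if)
  also have "\<dots> = 2 + 2"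
    by (subst nn_integral_add) (measurable, simp only: g g')
  finally show ?thesis by simp
qed

text \<open>The point is uniformity in \<open>\<xi>\<close>: within distance 1 the preceding bound
  applies, and farther away the singular factor is at most 1. The integrand majorises the
  contribution of one root in the estimate below.\<close>

lemma nn_integral_inv_sqrt:
  assumes "d > 0"
  shows "(\<integral>\<^sup>+t. ennreal (1 + sqrt (2*d) * \<bar>t - \<xi>\<bar> powr (-1/2)) * indicator {c-d..c+d} t \<partial>lborel)
    \<le> ennreal (2*d + sqrt (2*d) * (4 + 2*d))"
proof -
  let ?I = "indicator {c-d..c+d} :: real \<Rightarrow> ennreal"
  let ?h = "\<lambda>t. ennreal (\<bar>t - \<xi>\<bar> powr (-1/2)) * indicator {\<xi>-1..\<xi>+1} t"
  have I: "(\<integral>\<^sup>+t. ?I t \<partial>lborel) = ennreal (2 * d)" using assms by simp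
  have le: "\<bar>t - \<xi>\<bar> powr (-1/2) \<le> 1" if "t \<notin> {\<xi>-1..\<xi>+1}" for t
  proof -
    have "\<bar>t - \<xi>\<bar> \<ge> 1" using that by auto
    then have "\<bar>t - \<xi>\<bar> powr (-1/2) \<le> \<bar>t - \<xi>\<bar> powr 0" by (intro powr_mono) auto
    then show ?thesis using \<open>\<bar>t - \<xi>\<bar> \<ge> 1\<close> by (auto split: if_splits)
  qed
  have "(\<integral>\<^sup>+t. ennreal (1 + sqrt (2*d) * \<bar>t - \<xi>\<bar> powr (-1/2)) * ?I t \<partial>lborel)
     \<le> (\<integral>\<^sup>+t. ?I t + ennreal (sqrt (2*d)) * (?h t + ?I t) \<partial>lborel)"
  proof (rule nn_integral_mono)
    fix t
    have "ennreal (\<bar>t - \<xi>\<bar> powr (-1/2)) * ?I t \<le> ?h t + ?I t"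
      using le[of t] by (auto simp: indicator_def intro: ennreal_leI)
    then have "ennreal (sqrt (2*d)) * (ennreal (\<bar>t - \<xi>\<bar> powr (-1/2)) * ?I t) \<le> ennreal (sqrt (2*d)) * (?h t + ?I t)"
      by (intro mult_left_mono) auto
    then show "ennreal (1 + sqrt (2*d) * \<bar>t - \<xi>\<bar> powr (-1/2)) * ?I t \<le> ?I t + ennreal (sqrt (2*d)) * (?h t + ?I t)"
      using assms by (simp add: ennreal_plus ennreal_mult'' distrib_right mult.assoc add_left_mono)
  qed
  also have "\<dots> = ennreal (2*d) + ennreal (sqrt (2*d)) * ((\<integral>\<^sup>+t. ?h t \<partial>lborel) + ennreal (2*d))"
    by (simp add: nn_integral_add nn_integral_cmult I)
  also have "\<dots> \<le> ennreal (2*d) + ennreal (sqrt (2*d)) * (4 + ennreal (2*d))"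
    by (intro add_mono mult_left_mono nn_integral_inv_sqrt_near) auto
  also have "\<dots> = ennreal (2*d + sqrt (2*d) * (4 + 2*d))"
  proof -
    have "4 + ennreal (2*d) = ennreal (4 + 2*d)" using assms by (simp add: ennreal_plus)
    then show ?thesis using assms by (simp add: ennreal_plus ennreal_mult'')
  qed
  finally show ?thesis .
qed

text \<open>Write \<open>|p(s)| / |p(t)|\<close> as a product over the roots and apply the arithmetic-geometric
  mean inequality; each factor is integrable to the power \<open>1/2\<close>.\<close>
lemma poly_neg_powr_interval:
  fixes p :: "complex poly"
  assumes p: "degree p \<le> D" and D: "D > 0" and d: "d > 0" and s: "s \<in> {c-d..c+d}"
  shows "(\<integral>\<^sup>+t. neg_powr (1 / (2 * real D)) (cmod (poly p (of_real t))) * indicator {c-d..c+d} t \<partial>lborel)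
     \<le> ennreal (2*d + sqrt (2*d) * (4 + 2*d)) * neg_powr (1 / (2 * real D)) (cmod (poly p (of_real s)))"
proof (cases "poly p (of_real s) = 0")
  case True
  \<comment> \<open>If \<open>s\<close> gives a zero of \<open>p\<close>, the right-hand side is a
    positive constant times infinity.\<close>
  have "2*d + sqrt (2*d) * (4 + 2*d) > 0" using d by (intro add_pos_pos mult_pos_pos) auto
  then show ?thesis using True by (simp add: neg_powr_def ennreal_mult_top)
next
  case False
  define e where "e = 1 / (2 * real D)"
  have e: "e > 0" using D by (simp add: e_def)
  obtain root where root: "smult (lead_coeff p) (\<Prod>i<degree p. [:-root i, 1:]) = p"
    by (rule complex_poly_decompose')
  have val: "cmod (poly p z) = cmod (lead_coeff p) * (\<Prod>i<degree p. cmod (z - root i))" for z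
    by (subst root[symmetric]) (simp add: poly_prod norm_mult prod_norm[symmetric])
  let ?g = "\<lambda>\<xi> t. 1 + sqrt (2*d) * \<bar>t - \<xi>\<bar> powr (-1/2)"
  let ?I = "indicator {c-d..c+d} :: real \<Rightarrow> ennreal"
  let ?P = "cmod (poly p (of_real s)) powr - e"
  have ptw: "neg_powr e (cmod (poly p (of_real t))) * ?I t \<le>
       ennreal ?P * (ennreal (1 / real D) * (\<Sum>i<D. ennreal (?g (Re (root i)) t) * ?I t))"
    if ne: "t \<notin> (\<lambda>i. Re (root i)) ` {..<D}" for t
  proof (cases "t \<in> {c-d..c+d}")
    case t: True
    \<comment> \<open>Padding with ones up to \<open>D\<close> factors lets the same exponent serve
      every polynomial of degree at most \<open>D\<close>.\<close>
    define x where "x i = (if i < degree p then (cmod (of_real s - root i) / cmod (of_real t - root i)) powr (1/2) else 1)" for i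
    have rnz: "cmod (of_real t - root i) > 0" if "i < degree p" for i
    proof -
      have "t \<noteq> Re (root i)" using ne p that by auto
      then have "of_real t - root i \<noteq> 0" by (metis Re_complex_of_real right_minus_eq)
      then show ?thesis by simp
    qed
    have pnz: "cmod (lead_coeff p) > 0" using False by auto
    have tpos: "cmod (poly p (of_real t)) > 0"
      unfolding val using pnz rnz by (intro mult_pos_pos prod_pos) auto
    have spos: "cmod (poly p (of_real s)) > 0" using False by simp
    have xg: "x i \<le> ?g (Re (root i)) t" if iD: "i < D" for i
    proof (cases "i < degree p")
      case i: True
      define a where "a = cmod (of_real t - root i)"
      have a: "a > 0" using rnz i by (simp add: a_def)
      have "cmod (of_real s - root i) \<le> a + 2 * d"
      proof -
        have "cmod (of_real s - root i) \<le> cmod (of_real t - root i) + cmod (of_real s - of_real t)"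
          by (metis add.commute diff_add_cancel norm_triangle_ineq add_diff_eq)
        also have "cmod (of_real s - of_real t) = \<bar>s - t\<bar>" by (metis norm_of_real of_real_diff)
        also have "\<bar>s - t\<bar> \<le> 2 * d" using s t by auto
        finally show ?thesis by (simp add: a_def)
      qed
      then have "x i \<le> ((a + 2 * d) / a) powr (1/2)"
        using i a by (simp add: x_def a_def[symmetric] powr_mono2 divide_right_mono)
      also have "\<dots> = sqrt (1 + 2 * d / a)" using a by (simp add: powr_half_sqrt add_divide_distrib d less_imp_le)
      also have "\<dots> \<le> sqrt 1 + sqrt (2 * d / a)" by (rule sqrt_add_le_add_sqrt) (use a d in auto)
      also have "\<dots> = 1 + sqrt (2*d) * a powr (-1/2)"
        using a by (simp add: real_sqrt_divide powr_minus_divide powr_half_sqrt)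
      finally have 1: "x i \<le> 1 + sqrt (2*d) * a powr (-1/2)" .
      have "t \<noteq> Re (root i)" using ne iD by auto
      \<comment> \<open>Replacing the distance to the root by the distance to its real part only
        enlarges the bound and leaves a real singularity to integrate.\<close>
      moreover have "\<bar>t - Re (root i)\<bar> \<le> a" unfolding a_def using abs_Re_le_cmod[of "of_real t - root i"] by simp
      ultimately have "a powr (-1/2) \<le> \<bar>t - Re (root i)\<bar> powr (-1/2)"
        by (intro powr_mono2') auto
      then have "sqrt (2*d) * a powr (-1/2) \<le> sqrt (2*d) * \<bar>t - Re (root i)\<bar> powr (-1/2)"
        using d by (intro mult_left_mono) auto
      then show ?thesis using 1 by linarith
    qed (use d in \<open>simp add: x_def\<close>)
    have x0: "x i \<ge> 0" for i by (simp add: x_def)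
    have "(\<Prod>i<D. x i) = (\<Prod>i<degree p. x i)"
      by (rule prod.mono_neutral_right) (use p in \<open>auto simp: x_def\<close>)
    also have "\<dots> = (\<Prod>i<degree p. cmod (of_real s - root i) / cmod (of_real t - root i)) powr (1/2)"
      by (simp add: x_def prod_powr_distrib)
    also have "(\<Prod>i<degree p. cmod (of_real s - root i) / cmod (of_real t - root i)) = cmod (poly p (of_real s)) / cmod (poly p (of_real t))"
      using pnz by (simp add: val prod_dividef)
    finally have "(\<Prod>i<D. x i) powr (1 / real D) = (cmod (poly p (of_real s)) / cmod (poly p (of_real t))) powr e"
      by (simp add: powr_powr e_def)
    moreover have "(\<Prod>i<D. x i) powr (1 / real D) \<le> (\<Sum>i<D. x i / real D)"
      using arith_geom_mean[of "{..<D}" x] D x0 by auto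
    moreover have "(\<Sum>i<D. x i / real D) \<le> 1 / real D * (\<Sum>i<D. ?g (Re (root i)) t)"
      unfolding sum_distrib_left using xg by (intro sum_mono) (simp add: divide_right_mono)
    ultimately have am: "(cmod (poly p (of_real s)) / cmod (poly p (of_real t))) powr e \<le> 1 / real D * (\<Sum>i<D. ?g (Re (root i)) t)"
      by linarith
    have "cmod (poly p (of_real t)) powr - e = ?P * (cmod (poly p (of_real s)) / cmod (poly p (of_real t))) powr e"
      using spos tpos by (simp add: powr_divide powr_minus field_simps)
    also have "\<dots> \<le> ?P * (1 / real D * (\<Sum>i<D. ?g (Re (root i)) t))"
      using am by (intro mult_left_mono) auto
    finally have "ennreal (cmod (poly p (of_real t)) powr - e) \<le> ennreal (?P * (1 / real D * (\<Sum>i<D. ?g (Re (root i)) t)))"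
      by (rule ennreal_leI)
    also have "\<dots> = ennreal ?P * (ennreal (1 / real D) * (\<Sum>i<D. ennreal (?g (Re (root i)) t)))"
    proof -
      define G where "G i = ?g (Re (root i)) t" for i
      have G: "G i \<ge> 0" for i using d by (simp add: G_def)
      then have "ennreal (?P * (1 / real D * (\<Sum>i<D. G i))) = ennreal ?P * (ennreal (1 / real D) * ennreal (\<Sum>i<D. G i))"
        by (simp only: ennreal_mult sum_nonneg powr_ge_zero zero_le_mult_iff zero_le_divide_1_iff of_nat_0_le_iff simp_thms)
      also have "ennreal (\<Sum>i<D. G i) = (\<Sum>i<D. ennreal (G i))" using G by (simp add: sum_ennreal)
      finally show ?thesis unfolding G_def .
    qed
    finally show ?thesis using t tpos by (simp add: neg_powr_def)
  qed simp
  have "AE t in lborel. t \<notin> (\<lambda>i. Re (root i)) ` {..<D}"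
    by (intro AE_I'[of "(\<lambda>i. Re (root i)) ` {..<D}"] finite_imp_null_set_lborel) auto
  then have "(\<integral>\<^sup>+t. neg_powr e (cmod (poly p (of_real t))) * ?I t \<partial>lborel)
    \<le> (\<integral>\<^sup>+t. ennreal ?P * (ennreal (1 / real D) * (\<Sum>i<D. ennreal (?g (Re (root i)) t) * ?I t)) \<partial>lborel)"
    by (intro nn_integral_mono_AE) (elim eventually_mono, rule ptw)
  also have "\<dots> = ennreal ?P * (ennreal (1 / real D) * (\<Sum>i<D. \<integral>\<^sup>+t. ennreal (?g (Re (root i)) t) * ?I t \<partial>lborel))"
    by (subst nn_integral_cmult, measurable, subst nn_integral_cmult, measurable, subst nn_integral_sum, measurable)
  also have "\<dots> \<le> ennreal ?P * (ennreal (1 / real D) * (\<Sum>i<D. ennreal (2*d + sqrt (2*d) * (4 + 2*d))))"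
    by (intro mult_left_mono sum_mono nn_integral_inv_sqrt d) auto
  also have "ennreal (1 / real D) * (\<Sum>i<D. ennreal (2*d + sqrt (2*d) * (4 + 2*d))) = ennreal (2*d + sqrt (2*d) * (4 + 2*d))"
  proof -
    have "2*d + sqrt (2*d) * (4 + 2*d) \<ge> 0" using d by (intro add_nonneg_nonneg mult_nonneg_nonneg) auto
    then have "(\<Sum>i<D. ennreal (2*d + sqrt (2*d) * (4 + 2*d))) = ennreal (real D * (2*d + sqrt (2*d) * (4 + 2*d)))"
      by (simp add: ennreal_mult ennreal_of_nat_eq_real_of_nat)
    then show ?thesis using D by (simp add: ennreal_mult'[symmetric])
  qed
  moreover have "neg_powr e (cmod (poly p (of_real s))) = ennreal ?P" using False by (simp add: neg_powr_def)
  ultimately show ?thesis unfolding e_def[symmetric] by (simp only: mult.commute)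
qed

lemma poly_neg_powr_box_aux:
  fixes F :: "'a::euclidean_space \<Rightarrow> complex"
  assumes F [measurable]: "F \<in> borel_measurable borel"
    and poly: "\<And>b x. b \<in> Basis \<Longrightarrow> \<exists>p. degree p \<le> D \<and> (\<forall>t. F (x + t *\<^sub>R b) = poly p (of_real t))"
    and D: "D > 0" and d: "d > 0" and s: "\<And>b. b \<in> Basis \<Longrightarrow> s b \<in> {c b-d..c b+d}"
    and J: "J \<subseteq> Basis"
  shows "(\<integral>\<^sup>+g. neg_powr (1 / (2 * real D)) (cmod (F (y + (\<Sum>b\<in>J. g b *\<^sub>R b)))) * (\<Prod>b\<in>J. indicator {c b-d..c b+d} (g b)) \<partial>(\<Pi>\<^sub>M b\<in>J. lborel))
     \<le> ennreal (2*d + sqrt (2*d) * (4 + 2*d)) ^ card J * neg_powr (1 / (2 * real D)) (cmod (F (y + (\<Sum>b\<in>J. s b *\<^sub>R b))))"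
proof -
  have "finite J" using J by (rule finite_subset) simp
  then show ?thesis using J
  proof (induction J arbitrary: y rule: finite_induct)
    case empty
    then show ?case by (simp add: nn_integral_count_space_finite PiM_empty)
  next
    case (insert b J)
    interpret product_sigma_finite "\<lambda>_. lborel :: real measure" by standard
    let ?K = "ennreal (2*d + sqrt (2*d) * (4 + 2*d))"
    let ?e = "1 / (2 * real D)"
    have b: "b \<in> Basis" using insert by simp
    let ?H = "\<lambda>g. neg_powr ?e (cmod (F (y + (\<Sum>b\<in>insert b J. g b *\<^sub>R b)))) * (\<Prod>b\<in>insert b J. indicator {c b-d..c b+d} (g b))"
    have upd: "?H (g(b := t)) = neg_powr ?e (cmod (F ((y + (\<Sum>b\<in>J. g b *\<^sub>R b)) + t *\<^sub>R b))) * indicator {c b-d..c b+d} t * (\<Prod>b\<in>J. indicator {c b-d..c b+d} (g b))" for g t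
    proof -
      have "(\<Sum>c\<in>J. (g(b := t)) c *\<^sub>R c) = (\<Sum>c\<in>J. g c *\<^sub>R c)"
        using insert.hyps by (intro sum.cong) auto
      moreover have "(\<Prod>a\<in>J. indicator {c a-d..c a+d} ((g(b := t)) a) :: ennreal) = (\<Prod>a\<in>J. indicator {c a-d..c a+d} (g a))"
        using insert.hyps by (intro prod.cong) auto
      ultimately show ?thesis
        unfolding sum.insert[OF insert.hyps] prod.insert[OF insert.hyps] fun_upd_same by (simp only: add_ac mult_ac)
    qed
    have "(\<integral>\<^sup>+g. neg_powr ?e (cmod (F (y + (\<Sum>b\<in>insert b J. g b *\<^sub>R b)))) * (\<Prod>b\<in>insert b J. indicator {c b-d..c b+d} (g b)) \<partial>(\<Pi>\<^sub>M b\<in>insert b J. lborel))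
      = (\<integral>\<^sup>+g. (\<integral>\<^sup>+t. neg_powr ?e (cmod (F ((y + (\<Sum>b\<in>J. g b *\<^sub>R b)) + t *\<^sub>R b))) * indicator {c b-d..c b+d} t * (\<Prod>b\<in>J. indicator {c b-d..c b+d} (g b)) \<partial>lborel) \<partial>(\<Pi>\<^sub>M b\<in>J. lborel))"
      by (subst product_nn_integral_insert[OF insert.hyps]) (measurable, simp only: upd)
    also have "\<dots> \<le> (\<integral>\<^sup>+g. ?K * (neg_powr ?e (cmod (F ((y + s b *\<^sub>R b) + (\<Sum>b\<in>J. g b *\<^sub>R b)))) * (\<Prod>b\<in>J. indicator {c b-d..c b+d} (g b))) \<partial>(\<Pi>\<^sub>M b\<in>J. lborel))"
    proof (rule nn_integral_mono)
      fix g :: "'a \<Rightarrow> real"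
      let ?x = "y + (\<Sum>b\<in>J. g b *\<^sub>R b)"
      obtain p where p: "degree p \<le> D" "\<And>t. F (?x + t *\<^sub>R b) = poly p (of_real t)"
        using poly[OF b] by blast
      have "(\<integral>\<^sup>+t. neg_powr ?e (cmod (F (?x + t *\<^sub>R b))) * indicator {c b-d..c b+d} t * (\<Prod>b\<in>J. indicator {c b-d..c b+d} (g b)) \<partial>lborel)
        = (\<integral>\<^sup>+t. neg_powr ?e (cmod (F (?x + t *\<^sub>R b))) * indicator {c b-d..c b+d} t \<partial>lborel) * (\<Prod>b\<in>J. indicator {c b-d..c b+d} (g b))"
        by (rule nn_integral_multc) measurable
      also have "\<dots> \<le> (?K * neg_powr ?e (cmod (F (?x + s b *\<^sub>R b)))) * (\<Prod>b\<in>J. indicator {c b-d..c b+d} (g b))"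
        unfolding p(2) by (intro mult_right_mono poly_neg_powr_interval p(1) D d s b) auto
      finally show "(\<integral>\<^sup>+t. neg_powr ?e (cmod (F (?x + t *\<^sub>R b))) * indicator {c b-d..c b+d} t * (\<Prod>b\<in>J. indicator {c b-d..c b+d} (g b)) \<partial>lborel)
        \<le> ?K * (neg_powr ?e (cmod (F ((y + s b *\<^sub>R b) + (\<Sum>b\<in>J. g b *\<^sub>R b)))) * (\<Prod>b\<in>J. indicator {c b-d..c b+d} (g b)))"
        by (simp add: add_ac mult_ac)
    qed
    also have "\<dots> = ?K * (\<integral>\<^sup>+g. neg_powr ?e (cmod (F ((y + s b *\<^sub>R b) + (\<Sum>b\<in>J. g b *\<^sub>R b)))) * (\<Prod>b\<in>J. indicator {c b-d..c b+d} (g b)) \<partial>(\<Pi>\<^sub>M b\<in>J. lborel))"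
      by (rule nn_integral_cmult) measurable
    also have "\<dots> \<le> ?K * (?K ^ card J * neg_powr ?e (cmod (F ((y + s b *\<^sub>R b) + (\<Sum>b\<in>J. s b *\<^sub>R b)))))"
      using insert by (intro mult_left_mono) auto
    finally show ?case using insert.hyps by (simp add: add_ac mult_ac)
  qed
qed

text \<open>Markov's inequality for the negative power of |F|, whose integral over the box is
  controlled by its value at the single point \<open>z\<close>.\<close>

lemma poly_sublevel_volume:
  fixes F :: "'a::euclidean_space \<Rightarrow> complex"
  assumes F [measurable]: "F \<in> borel_measurable borel"
    and poly: "\<And>b x. b \<in> Basis \<Longrightarrow> \<exists>p. degree p \<le> D \<and> (\<forall>t. F (x + t *\<^sub>R b) = poly p (of_real t))"
    and D: "D > 0" and d: "d > 0" and z: "\<And>b. b \<in> Basis \<Longrightarrow> \<bar>z \<bullet> b - c \<bullet> b\<bar> \<le> d" "F z \<noteq> 0"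
    and l: "\<theta> > 0"
  shows "emeasure lborel {x. (\<forall>b\<in>Basis. \<bar>x \<bullet> b - c \<bullet> b\<bar> \<le> d) \<and> cmod (F x) \<le> \<theta> * cmod (F z)}
     \<le> ennreal ((2*d + sqrt (2*d) * (4 + 2*d)) ^ DIM('a) * \<theta> powr (1 / (2 * real D)))"
proof -
  define e where "e = 1 / (2 * real D)"
  define K where "K = 2*d + sqrt (2*d) * (4 + 2*d)"
  have K: "K \<ge> 0" unfolding K_def using d by (intro add_nonneg_nonneg mult_nonneg_nonneg) auto
  let ?A = "{x. (\<forall>b\<in>Basis. \<bar>x \<bullet> b - c \<bullet> b\<bar> \<le> d) \<and> cmod (F x) \<le> \<theta> * cmod (F z)}"
  let ?q = "(\<theta> * cmod (F z)) powr - e"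
  have q: "?q > 0" using l z(2) by simp
  have A [measurable]: "?A \<in> sets borel" by measurable
  have fub: "(\<integral>\<^sup>+x. G x \<partial>lborel) = (\<integral>\<^sup>+g. G (\<Sum>b\<in>Basis. g b *\<^sub>R b) \<partial>(\<Pi>\<^sub>M b\<in>Basis. lborel))"
    if [measurable]: "G \<in> borel_measurable borel" for G :: "'a \<Rightarrow> ennreal"
    by (subst lborel_eq) (subst nn_integral_distr, simp_all)
  have "ennreal ?q * emeasure lborel ?A = (\<integral>\<^sup>+x. ennreal ?q * indicator ?A x \<partial>lborel)"
    by (simp add: nn_integral_cmult)
  also have "\<dots> \<le> (\<integral>\<^sup>+x. neg_powr e (cmod (F x)) * (\<Prod>b\<in>Basis. indicator {c \<bullet> b - d..c \<bullet> b + d} (x \<bullet> b)) \<partial>lborel)"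
  proof (rule nn_integral_mono)
    fix x
    show "ennreal ?q * indicator ?A x \<le> neg_powr e (cmod (F x)) * (\<Prod>b\<in>Basis. indicator {c \<bullet> b - d..c \<bullet> b + d} (x \<bullet> b))"
    proof (cases "x \<in> ?A")
      case True
      then have "(\<Prod>b\<in>Basis. indicator {c \<bullet> b - d..c \<bullet> b + d} (x \<bullet> b)) = (1::ennreal)"
        by (intro prod.neutral) (auto simp: indicator_def abs_le_iff algebra_simps)
      moreover have "ennreal ?q \<le> neg_powr e (cmod (F x))"
      proof (cases "F x = 0")
        case False
        then have "?q \<le> cmod (F x) powr - e" using True by (intro powr_mono2') (auto simp: e_def)
        then show ?thesis using False by (simp add: neg_powr_def ennreal_leI)
      qed (simp add: neg_powr_def)
      ultimately show ?thesis using True by simp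
    qed simp
  qed
  also have "\<dots> = (\<integral>\<^sup>+g. neg_powr e (cmod (F (0 + (\<Sum>b\<in>Basis. g b *\<^sub>R b)))) * (\<Prod>b\<in>Basis. indicator {c \<bullet> b - d..c \<bullet> b + d} (g b)) \<partial>(\<Pi>\<^sub>M b\<in>Basis. lborel))"
    by (subst fub) (auto intro!: nn_integral_cong simp: inner_sum_left_Basis)
  also have "\<dots> \<le> ennreal K ^ DIM('a) * neg_powr e (cmod (F (0 + (\<Sum>b\<in>Basis. (z \<bullet> b) *\<^sub>R b))))"
    unfolding K_def e_def
  proof (rule poly_neg_powr_box_aux[OF F poly D d _ order_refl])
    fix b :: 'a assume "b \<in> Basis"
    from z(1)[OF this] show "z \<bullet> b \<in> {c \<bullet> b - d..c \<bullet> b + d}" by (auto simp: abs_le_iff)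
  qed auto
  also have "\<dots> = ennreal (K ^ DIM('a) * cmod (F z) powr - e)"
    using K z(2) by (simp add: euclidean_representation neg_powr_def ennreal_power ennreal_mult)
  also have "\<dots> = ennreal ?q * ennreal (K ^ DIM('a) * \<theta> powr e)"
    using K l z(2) by (simp add: ennreal_mult[symmetric] powr_mult powr_minus)
  finally have "ennreal ?q * emeasure lborel ?A \<le> ennreal ?q * ennreal (K ^ DIM('a) * \<theta> powr e)" .
  then show ?thesis
    using q by (simp add: ennreal_mult_le_mult_iff K_def e_def)
qed

subsection \<open>Volume of Hermitian ellipsoids\<close>

lemma nn_integral_lborel_split:
  fixes G :: "'a::euclidean_space \<Rightarrow> ennreal"
  assumes [measurable]: "G \<in> borel_measurable borel" and b: "b \<in> Basis"
  shows "(\<integral>\<^sup>+x. G x \<partial>lborel) = (\<integral>\<^sup>+g. (\<integral>\<^sup>+t. G ((\<Sum>c\<in>Basis-{b}. g c *\<^sub>R c) + t *\<^sub>R b) \<partial>lborel) \<partial>(\<Pi>\<^sub>M b\<in>Basis-{b}. lborel))"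
proof -
  interpret product_sigma_finite "\<lambda>_. lborel :: real measure" by standard
  have ins: "insert b (Basis - {b}) = Basis" using b by auto
  have upd: "(\<Sum>c\<in>Basis. (g(b := t)) c *\<^sub>R c) = (\<Sum>c\<in>Basis-{b}. g c *\<^sub>R c) + t *\<^sub>R b" for g t
  proof -
    have "(\<Sum>c\<in>Basis. (g(b := t)) c *\<^sub>R c) = t *\<^sub>R b + (\<Sum>c\<in>Basis-{b}. (g(b := t)) c *\<^sub>R c)"
      using b by (subst sum.remove[of _ b]) auto
    also have "(\<Sum>c\<in>Basis-{b}. (g(b := t)) c *\<^sub>R c) = (\<Sum>c\<in>Basis-{b}. g c *\<^sub>R c)"
      by (intro sum.cong) auto
    finally show ?thesis by (simp add: add.commute)
  qed
  have "(\<integral>\<^sup>+x. G x \<partial>lborel) = (\<integral>\<^sup>+g. G (\<Sum>c\<in>Basis. g c *\<^sub>R c) \<partial>(\<Pi>\<^sub>M b\<in>Basis. lborel))"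
    by (subst lborel_eq) (subst nn_integral_distr, simp_all)
  also have "\<dots> = (\<integral>\<^sup>+g. G (\<Sum>c\<in>Basis. g c *\<^sub>R c) \<partial>(\<Pi>\<^sub>M b\<in>insert b (Basis-{b}). lborel))"
    unfolding ins ..
  also have "\<dots> = (\<integral>\<^sup>+g. (\<integral>\<^sup>+t. G (\<Sum>c\<in>Basis. (g(b := t)) c *\<^sub>R c) \<partial>lborel) \<partial>(\<Pi>\<^sub>M b\<in>Basis-{b}. lborel))"
    by (rule product_nn_integral_insert) (simp_all add: ins)
  finally show ?thesis unfolding upd .
qed

text \<open>On each line parallel to \<open>b\<close> the functional \<open>l\<close> is constant
  because \<open>l b = 0\<close>, so the shear acts there as a translation.\<close>

lemma nn_integral_lborel_shear:
  fixes G :: "'a::euclidean_space \<Rightarrow> ennreal"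
  assumes [measurable]: "G \<in> borel_measurable borel" and b: "b \<in> Basis"
    and l: "linear l" "l b = 0"
  shows "(\<integral>\<^sup>+x. G (x + l x *\<^sub>R b) \<partial>lborel) = (\<integral>\<^sup>+x. G x \<partial>lborel)"
proof -
  have [measurable]: "l \<in> borel_measurable borel"
    using l(1) by (intro borel_measurable_continuous_onI linear_continuous_on) (simp add: linear_conv_bounded_linear)
  have "(\<integral>\<^sup>+t. G (x + t *\<^sub>R b + l (x + t *\<^sub>R b) *\<^sub>R b) \<partial>lborel) = (\<integral>\<^sup>+t. G (x + t *\<^sub>R b) \<partial>lborel)" for x
  proof -
    have "(\<integral>\<^sup>+t. G (x + t *\<^sub>R b) \<partial>lborel) = \<bar>1::real\<bar> * (\<integral>\<^sup>+t. G (x + (l x + 1 * t) *\<^sub>R b) \<partial>lborel)"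
      by (rule nn_integral_real_affine) auto
    then show ?thesis
      using l by (simp add: linear_add linear_cmul scaleR_add_left add_ac)
  qed
  then show ?thesis
    by (simp add: nn_integral_lborel_split[OF _ b])
qed

section \<open>Hermitian forms and their sublevel sets\<close>

lemma sum_Basis_cvec: "(\<Sum>b\<in>(Basis :: (complex^'n) set). f b) = (\<Sum>i\<in>UNIV. f (axis i 1) + f (axis i \<i>))"
proof -
  have inj: "inj_on (\<lambda>(i, u). axis i u :: complex^'n) (UNIV \<times> Basis)"
    by (auto simp: inj_on_def axis_eq_axis Basis_complex_def)
  have B: "(Basis :: (complex^'n) set) = (\<lambda>(i, u). axis i u) ` (UNIV \<times> Basis)"
    by (auto simp: Basis_vec_def)
  have "(\<Sum>b\<in>(Basis :: (complex^'n) set). f b) = (\<Sum>(i, u)\<in>UNIV \<times> Basis. f (axis i u))"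
    unfolding B sum.reindex[OF inj] by (simp add: case_prod_unfold)
  then show ?thesis by (simp add: sum.cartesian_product[symmetric] Basis_complex_def)
qed

lemma prod_Basis_cvec: "(\<Prod>b\<in>(Basis :: (complex^'n) set). f b) = (\<Prod>i\<in>UNIV. f (axis i 1) * f (axis i \<i>))"
proof -
  have inj: "inj_on (\<lambda>(i, u). axis i u :: complex^'n) (UNIV \<times> Basis)"
    by (auto simp: inj_on_def axis_eq_axis Basis_complex_def)
  have B: "(Basis :: (complex^'n) set) = (\<lambda>(i, u). axis i u) ` (UNIV \<times> Basis)"
    by (auto simp: Basis_vec_def)
  have "(\<Prod>b\<in>(Basis :: (complex^'n) set). f b) = (\<Prod>(i, u)\<in>UNIV \<times> Basis. f (axis i u))"
    unfolding B prod.reindex[OF inj] by (simp add: case_prod_unfold)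
  then show ?thesis by (simp add: prod.cartesian_product[symmetric] Basis_complex_def)
qed

text \<open>\<open>hform\<close> takes a real part, so positivity alone does not express Hermitian
  symmetry; both conditions are stated.\<close>

definition hermitian_pd :: "complex^'n^'n \<Rightarrow> bool" where
  "hermitian_pd H \<longleftrightarrow> (\<forall>j k. H $ k $ j = cnj (H $ j $ k)) \<and> (\<forall>w. w \<noteq> 0 \<longrightarrow> hform H w > 0)"

lemma continuous_hform: "continuous_on S (hform H)"
  unfolding hform_def by (intro continuous_intros)

lemma borel_measurable_hform [measurable]: "hform H \<in> borel_measurable borel"
  by (rule borel_measurable_continuous_onI[OF continuous_hform])

lemma hform_axis: "hform H (axis j w) = Re (H $ j $ j) * (cmod w)\<^sup>2"
proof -
  have "(\<Sum>i\<in>UNIV. \<Sum>k\<in>UNIV. H $ i $ k * axis j w $ i * cnj (axis j w $ k)) =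
      (\<Sum>i\<in>UNIV. \<Sum>k\<in>UNIV. if k = j then (if i = j then H $ j $ j * w * cnj w else 0) else 0)"
    by (intro sum.cong refl) (auto simp: axis_def)
  also have "\<dots> = H $ j $ j * w * cnj w" by simp
  finally show ?thesis
    unfolding hform_def by (simp add: mult.assoc complex_norm_square[symmetric] del: of_real_power)
qed

lemma hform_scaleR: "hform H (r *\<^sub>R w) = r\<^sup>2 * hform H w"
  unfolding hform_def Re_sum sum_distrib_left
  by (intro sum.cong refl) (simp add: power2_eq_square algebra_simps)

text \<open>Since the first index of \<open>H\<close> is paired with \<open>w\<close> and the second
  with its conjugate, the congruence has the plain transpose on the left and the entrywise conjugate
  on the right.\<close>

lemma hform_congruence:
  "hform (transpose E ** H ** (\<chi> i k. cnj (E $ i $ k))) w = hform H (E *v w)"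
proof -
  have form: "hform H w = Re (\<Sum>j\<in>UNIV. w $ j * (H *v (\<chi> i. cnj (w $ i))) $ j)" for H :: "complex^'n^'n" and w
    unfolding hform_def matrix_vector_mult_def by (simp add: sum_distrib_left mult_ac)
  have conj: "(\<chi> i k. cnj (E $ i $ k)) *v (\<chi> i. cnj (w $ i)) = (\<chi> i. cnj ((E *v w) $ i))"
    by (simp add: matrix_vector_mult_def vec_eq_iff)
  have bil: "(\<Sum>j\<in>UNIV. w $ j * (transpose E *v v) $ j) = (\<Sum>a\<in>UNIV. (E *v w) $ a * v $ a)" for v
    unfolding matrix_vector_mult_def transpose_def
    by (simp add: sum_distrib_left sum_distrib_right mult_ac) (rule sum.swap)
  show ?thesis
    unfolding form matrix_vector_mul_assoc[symmetric] conj bil ..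
qed

text \<open>Only row \<open>j\<close> differs from the identity matrix, and it does so by a
  combination of the other rows.\<close>

lemma det_unit_shear:
  fixes c :: "'n::finite \<Rightarrow> complex"
  assumes "c j = 0"
  shows "det (\<chi> i k. of_bool (i = k) + (if i = j then c k else 0) :: complex^'n^'n) = 1"
proof -
  let ?x = "\<Sum>k\<in>UNIV-{j}. c k *s row k (mat 1 :: complex^'n^'n)"
  have "?x \<in> vec.span {row k (mat 1 :: complex^'n^'n) |k. k \<noteq> j}"
    by (intro vec.span_sum vec.span_scale vec.span_base) auto
  from det_row_span[OF this]
  have "det (\<chi> k. if k = j then row j (mat 1) + ?x else row k (mat 1) :: complex^'n^'n) = 1" by simp
  also have "(\<chi> k. if k = j then row j (mat 1) + ?x else row k (mat 1) :: complex^'n^'n)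
      = (\<chi> i k. of_bool (i = k) + (if i = j then c k else 0))"
  proof -
    have "(\<Sum>k\<in>UNIV-{j}. c k * of_bool (k = i)) = c i" for i
    proof (cases "i = j")
      case True then show ?thesis using assms by (auto intro!: sum.neutral)
    next
      case False
      then have "(\<Sum>k\<in>UNIV-{j}. c k * of_bool (k = i)) = (\<Sum>k\<in>UNIV-{j}. if k = i then c k else 0)"
        by (intro sum.cong) auto
      then show ?thesis using False by simp
    qed
    then show ?thesis by (simp add: vec_eq_iff row_def mat_def of_bool_def)
  qed
  finally show ?thesis .
qed

text \<open>A complex shear is the composition of two real shears, along the real and the imaginary
  direction of coordinate \<open>j\<close>. As \<open>c j = 0\<close>, the functional
  \<open>l\<close> ignores that coordinate, so both preserve volume.\<close>

lemma hform_shear_volume: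
  fixes c :: "'n::finite \<Rightarrow> complex"
  assumes c: "c j = 0"
  defines "E \<equiv> (\<chi> i k. of_bool (i = k) + (if i = j then c k else 0) :: complex^'n^'n)"
  shows "emeasure lborel {w. hform H (E *v w) < 1} = emeasure lborel {w. hform H w < 1}"
proof -
  define l where "l w = (\<Sum>k\<in>UNIV. c k * w $ k)" for w :: "complex^'n"
  have Ew: "E *v w = (w + Re (l w) *\<^sub>R axis j 1) + Im (l (w + Re (l w) *\<^sub>R axis j 1)) *\<^sub>R axis j \<i>" for w
  proof -
    have "l (w + Re (l w) *\<^sub>R axis j 1) = l w"
      using c unfolding l_def by (intro sum.cong) (auto simp: axis_def)
    moreover have "(E *v w) $ i = w $ i + (if i = j then l w else 0)" for i
    proof -
      have "(E *v w) $ i = (\<Sum>k\<in>UNIV. (if k = i then w $ k else 0) + (if i = j then c k * w $ k else 0))"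
        unfolding matrix_vector_mult_def E_def by (auto intro!: sum.cong simp: distrib_right)
      also have "\<dots> = w $ i + (\<Sum>k\<in>UNIV. (if i = j then c k * w $ k else 0))"
        by (simp add: sum.distrib)
      finally show ?thesis by (simp add: l_def)
    qed
    ultimately show ?thesis by (simp add: vec_eq_iff axis_def complex_eq_iff)
  qed
  have lin: "linear (\<lambda>w. Re (l w))" "linear (\<lambda>w. Im (l w))"
  proof -
    have la: "l (x + y) = l x + l y" for x y by (simp add: l_def distrib_left sum.distrib)
    have ls: "l (r *\<^sub>R x) = of_real r * l x" for r x
      by (simp add: l_def sum_distrib_left scaleR_conv_of_real[where 'a=complex] mult_ac)
    show "linear (\<lambda>w. Re (l w))" "linear (\<lambda>w. Im (l w))"
      by (auto intro!: linearI simp: la ls)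
  qed
  have l0: "l (axis j u) = 0" for u
    using c unfolding l_def by (intro sum.neutral) (auto simp: axis_def)
  have ax: "axis j 1 \<in> (Basis :: (complex^'n) set)" "axis j \<i> \<in> (Basis :: (complex^'n) set)"
    by (auto simp: Basis_complex_def)
  let ?G = "indicator {w. hform H w < 1} :: complex^'n \<Rightarrow> ennreal"
  let ?G2 = "\<lambda>w. ?G (w + Im (l w) *\<^sub>R axis j \<i>)"
  have [measurable]: "(\<lambda>w. Im (l w)) \<in> borel_measurable borel" "(\<lambda>w. Re (l w)) \<in> borel_measurable borel"
    using lin by (auto intro!: borel_measurable_continuous_onI linear_continuous_on simp: linear_conv_bounded_linear)
  have [measurable]: "{w. hform H w < 1} \<in> sets borel" by measurable
  have EE: "(\<lambda>w. E *v w) \<in> borel_measurable borel" 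
    unfolding matrix_vector_mult_def by (intro borel_measurable_continuous_onI continuous_intros)
  have "emeasure lborel {w. hform H (E *v w) < 1} = (\<integral>\<^sup>+w. ?G (E *v w) \<partial>lborel)"
  proof -
    have "{w. hform H (E *v w) < 1} \<in> sets borel" using EE by measurable
    moreover have "?G (E *v w) = indicator {w. hform H (E *v w) < 1} w" for w by (simp add: indicator_def)
    ultimately show ?thesis by (simp only: nn_integral_indicator sets_lborel)
  qed
  also have "\<dots> = (\<integral>\<^sup>+w. ?G2 (w + Re (l w) *\<^sub>R axis j 1) \<partial>lborel)" unfolding Ew ..
  also have "\<dots> = (\<integral>\<^sup>+w. ?G2 w \<partial>lborel)"
    using lin l0 ax by (intro nn_integral_lborel_shear) auto
  also have "\<dots> = (\<integral>\<^sup>+w. ?G w \<partial>lborel)"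
    using lin l0 ax by (intro nn_integral_lborel_shear) auto
  finally show ?thesis by simp
qed

text \<open>Scaling both real directions of coordinate \<open>i\<close> by the square root of
  \<open>h i\<close> carries the sublevel set onto the unit ball. Two real directions per coordinate
  make the Jacobian the determinant itself, not its square root.\<close>

lemma hform_diagonal_volume:
  fixes H :: "complex^'n^'n"
  assumes pd: "hermitian_pd H" and diag: "\<And>i k. k \<noteq> i \<Longrightarrow> H $ i $ k = 0"
  shows "det H = of_real (Re (det H)) \<and> Re (det H) > 0 \<and>
    ennreal (Re (det H)) * emeasure lborel {w. hform H w < 1} = emeasure lborel (ball (0 :: complex^'n) 1)"
proof -
  define h where "h i = Re (H $ i $ i)" for i
  have hpos: "h i > 0" for i
    using pd hform_axis[of H i 1] unfolding hermitian_pd_def h_def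
    by (metis axis_eq_0_iff mult.right_neutral norm_one one_power2 zero_neq_one)
  have him: "H $ i $ i = of_real (h i)" for i
    using pd unfolding hermitian_pd_def h_def by (metis Reals_cnj_iff of_real_Re)
  have "det H = (\<Prod>i\<in>UNIV. H $ i $ i)" by (rule det_diagonal) (use diag in auto)
  then have det: "det H = of_real (\<Prod>i\<in>UNIV. h i)" by (simp add: him)
  have hf: "hform H w = (\<Sum>i\<in>UNIV. h i * (cmod (w $ i))\<^sup>2)" for w
  proof -
    have "(\<Sum>i\<in>UNIV. \<Sum>k\<in>UNIV. H $ i $ k * w $ i * cnj (w $ k)) = (\<Sum>i\<in>UNIV. \<Sum>k\<in>UNIV. if k = i then H $ i $ i * w $ i * cnj (w $ i) else 0)"
      using diag by (intro sum.cong refl) auto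
    also have "\<dots> = (\<Sum>i\<in>UNIV. of_real (h i * (cmod (w $ i))\<^sup>2))"
      by (simp add: him mult.assoc complex_norm_square[symmetric] del: of_real_power)
    finally show ?thesis unfolding hform_def by simp
  qed
  define cc where "cc b = sqrt (hform H b)" for b
  define T where "T x = 0 + (\<Sum>b\<in>Basis. (cc b * (x \<bullet> b)) *\<^sub>R b)" for x :: "complex^'n"
  have ccax: "cc (axis i 1) = sqrt (h i)" "cc (axis i \<i>) = sqrt (h i)" for i
    by (simp_all add: cc_def hform_axis h_def)
  have prodc: "(\<Prod>b\<in>Basis. \<bar>cc b\<bar>) = (\<Prod>i\<in>UNIV. h i)"
    using hpos by (simp add: prod_Basis_cvec ccax less_imp_le)
  have "cc b \<noteq> 0" if "b \<in> Basis" for b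
  proof -
    have "b \<noteq> 0" using that by auto
    then show ?thesis using pd unfolding hermitian_pd_def cc_def by (metis less_irrefl real_sqrt_eq_zero_cancel_iff)
  qed
  then have lb: "lborel = density (distr lborel borel T) (\<lambda>_. ennreal (\<Prod>b\<in>Basis. \<bar>cc b\<bar>))"
    unfolding T_def[abs_def] by (rule lborel_affine_euclidean)
  have nT: "(norm (T x))\<^sup>2 = hform H x" for x
  proof -
    have "(norm (T x))\<^sup>2 = (\<Sum>b\<in>Basis. (T x \<bullet> b)\<^sup>2)"
      unfolding power2_norm_eq_inner by (subst euclidean_inner) (simp add: power2_eq_square)
    also have "\<dots> = (\<Sum>b\<in>Basis. (cc b * (x \<bullet> b))\<^sup>2)" by (simp add: T_def inner_sum_left_Basis)
    also have "\<dots> = hform H x"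
      unfolding sum_Basis_cvec ccax hf
      using hpos by (intro sum.cong refl) (simp add: inner_axis' inner_axis power_mult_distrib cmod_power2 less_imp_le algebra_simps)
    finally show ?thesis .
  qed
  have T [measurable]: "T \<in> borel_measurable borel" unfolding T_def by measurable
  have "T -` ball 0 1 = {w. hform H w < 1}"
  proof -
    have "norm (T x) < 1 \<longleftrightarrow> hform H x < 1" for x
      unfolding nT[symmetric] using abs_square_less_1[of "norm (T x)"] by simp
    then show ?thesis unfolding vimage_def mem_ball_0 by (simp only:)
  qed
  then have "emeasure (density (distr lborel borel T) (\<lambda>_. ennreal (\<Prod>b\<in>Basis. \<bar>cc b\<bar>))) (ball 0 1) =
     ennreal (\<Prod>i\<in>UNIV. h i) * emeasure lborel {w. hform H w < 1}"
    by (simp add: emeasure_density nn_integral_cmult_indicator emeasure_distr prodc)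
  with lb have "ennreal (\<Prod>i\<in>UNIV. h i) * emeasure lborel {w. hform H w < 1} = emeasure lborel (ball (0 :: complex^'n) 1)"
    by simp
  then show ?thesis using hpos unfolding det by (simp add: prod_pos del: of_real_prod)
qed

lemma hermitian_pd_diag_pos:
  fixes H :: "complex^'n^'n"
  assumes "hermitian_pd H"
  shows "Re (H $ j $ j) > 0" "H $ j $ j \<noteq> 0"
proof -
  have "hform H (axis j 1) > 0"
    using assms unfolding hermitian_pd_def by (metis axis_eq_0_iff zero_neq_one)
  then show "Re (H $ j $ j) > 0" by (simp add: hform_axis)
  then show "H $ j $ j \<noteq> 0" by auto
qed

lemma shear_congruence_entry:
  fixes H :: "complex^'n^'n" and c :: "'n \<Rightarrow> complex" and j :: 'n
  defines "E \<equiv> (\<chi> i k. of_bool (i = k) + (if i = j then c k else 0) :: complex^'n^'n)"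
  shows "(transpose E ** H ** (\<chi> i k. cnj (E $ i $ k))) $ i $ k
    = H $ i $ k + H $ i $ j * cnj (c k) + c i * (H $ j $ k + H $ j $ j * cnj (c k))"
proof -
  have right: "(\<Sum>l\<in>UNIV. M l * cnj (E $ l $ k)) = M k + M j * cnj (c k)" for M k
  proof -
    have "(\<Sum>l\<in>UNIV. M l * cnj (E $ l $ k)) = (\<Sum>l\<in>UNIV. (if l = k then M k else 0) + (if l = j then M j * cnj (c k) else 0))"
      by (intro sum.cong refl) (auto simp: E_def algebra_simps)
    then show ?thesis by (simp add: sum.distrib)
  qed
  have left: "(\<Sum>l\<in>UNIV. E $ l $ i * M l) = M i + c i * M j" for M i
  proof -
    have "(\<Sum>l\<in>UNIV. E $ l $ i * M l) = (\<Sum>l\<in>UNIV. (if l = i then M i else 0) + (if l = j then c i * M j else 0))"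
      by (intro sum.cong refl) (auto simp: E_def algebra_simps)
    then show ?thesis by (simp add: sum.distrib)
  qed
  have tr: "(transpose E ** H) $ i $ m = H $ i $ m + c i * H $ j $ m" for m
    unfolding matrix_matrix_mult_def transpose_def by (simp add: left)
  have "(transpose E ** H ** (\<chi> i k. cnj (E $ i $ k))) $ i $ k = (\<Sum>l\<in>UNIV. (transpose E ** H) $ i $ l * cnj (E $ l $ k))"
    by (simp add: matrix_matrix_mult_def)
  also have "\<dots> = (transpose E ** H) $ i $ k + (transpose E ** H) $ i $ j * cnj (c k)" by (rule right)
  finally show ?thesis unfolding tr by (simp add: algebra_simps)
qed

text \<open>Complete the square in one variable at a time; each step is a unimodular shear.\<close>
lemma hform_volume:
  fixes H :: "complex^'n^'n"
  assumes "hermitian_pd H"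
  shows "Re (det H) > 0 \<and>
    ennreal (Re (det H)) * emeasure lborel {w. hform H w < 1} = emeasure lborel (ball (0 :: complex^'n) 1)"
proof -
  \<comment> \<open>\<open>S\<close> holds the indices whose rows may still have off-diagonal
    entries; the form changes at each step, so it is generalised.\<close>
  have "finite S \<Longrightarrow> hermitian_pd H \<Longrightarrow> (\<And>i k. i \<notin> S \<Longrightarrow> k \<noteq> i \<Longrightarrow> H $ i $ k = 0) \<Longrightarrow> Re (det H) > 0 \<and>
    ennreal (Re (det H)) * emeasure lborel {w. hform H w < 1} = emeasure lborel (ball (0 :: complex^'n) 1)"
    for S :: "'n set" and H :: "complex^'n^'n"
  proof (induction S arbitrary: H rule: finite_induct)
    case empty
    with hform_diagonal_volume[of H] show ?case by simp
  next
    case (insert j S)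
    note pd = insert.prems(1)
    have herm: "H $ k $ i = cnj (H $ i $ k)" for i k
      using pd unfolding hermitian_pd_def by blast
    note jj = hermitian_pd_diag_pos[OF pd, of j]
    \<comment> \<open>This is the solution of \<open>H $ j $ k + H $ j $ j * cnj (c k) = 0\<close>,
      which clears row \<open>j\<close> off the diagonal.\<close>
    define c where "c k = (if k = j then 0 else - cnj (H $ j $ k / H $ j $ j))" for k
    have cj: "c j = 0" by (simp add: c_def)
    define E where "E = (\<chi> i k. of_bool (i = k) + (if i = j then c k else 0) :: complex^'n^'n)"
    define H' where "H' = transpose E ** H ** (\<chi> i k. cnj (E $ i $ k))"
    have entry: "H' $ i $ k = H $ i $ k + H $ i $ j * cnj (c k) + c i * (H $ j $ k + H $ j $ j * cnj (c k))" for i k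
      unfolding H'_def E_def by (rule shear_congruence_entry)
    have row: "H $ j $ k + H $ j $ j * cnj (c k) = 0" if "k \<noteq> j" for k
      using that jj by (simp add: c_def)
    have "det (\<chi> i k. cnj (E $ i $ k)) = 1"
    proof -
      have "(\<chi> i k. cnj (E $ i $ k)) = (\<chi> i k. of_bool (i = k) + (if i = j then cnj (c k) else 0))"
        by (simp add: vec_eq_iff E_def)
      then show ?thesis using det_unit_shear[of "\<lambda>k. cnj (c k)" j] cj by simp
    qed
    moreover have "det E = 1" unfolding E_def by (rule det_unit_shear[of c j, OF cj])
    ultimately have det: "det H' = det H" by (simp add: H'_def det_mul det_transpose)
    have form: "hform H' w = hform H (E *v w)" for w unfolding H'_def by (rule hform_congruence)
    have vol: "emeasure lborel {w. hform H' w < 1} = emeasure lborel {w. hform H w < 1}"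
      unfolding form E_def by (rule hform_shear_volume[of c j, OF cj])
    have Enz: "E *v w \<noteq> 0" if "w \<noteq> 0" for w
    proof
      assume z: "E *v w = 0"
      have comp: "(E *v w) $ i = w $ i + (if i = j then \<Sum>k\<in>UNIV. c k * w $ k else 0)" for i
      proof -
        have "(E *v w) $ i = (\<Sum>k\<in>UNIV. (if k = i then w $ k else 0) + (if i = j then c k * w $ k else 0))"
          unfolding matrix_vector_mult_def E_def by (auto intro!: sum.cong simp: distrib_right)
        then show ?thesis by (simp add: sum.distrib)
      qed
      have w0: "w $ i = 0" if "i \<noteq> j" for i using comp[of i] z that by simp
      have "(\<Sum>k\<in>UNIV. c k * w $ k) = 0" 
      proof (intro sum.neutral ballI)
        fix k show "c k * w $ k = 0" using w0[of k] cj by (cases "k = j") auto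
      qed
      then have "w $ j = 0" using comp[of j] z by simp
      with w0 have "w $ i = 0" for i by (cases "i = j") auto
      then have "w = 0" by (simp add: vec_eq_iff)
      then show False using that by simp
    qed
    have herm': "H' $ k $ i = cnj (H' $ i $ k)" for i k
      unfolding entry by (simp add: herm[symmetric] algebra_simps)
    have pd': "hermitian_pd H'"
      unfolding hermitian_pd_def form
    proof (intro conjI allI impI)
      fix w :: "complex^'n" assume "w \<noteq> 0"
      then show "hform H (E *v w) > 0" using pd Enz unfolding hermitian_pd_def by blast
    qed (rule herm')
    \<comment> \<open>Rows cleared earlier stay clear: for such \<open>i\<close> the entry of
      \<open>H\<close> at \<open>i\<close>, \<open>j\<close> is 0, by symmetry so is the one at
      \<open>j\<close>, \<open>i\<close>, and hence \<open>c i = 0\<close>.\<close>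
    have zero: "H' $ i $ k = 0" if i: "i \<notin> S" "k \<noteq> i" for i k
    proof (cases "i = j")
      case True
      then show ?thesis using row[of k] i cj by (simp add: entry)
    next
      case False
      with i insert.prems(2) have "H $ i $ m = 0" if "m \<noteq> i" for m using that by auto
      then have 1: "H $ i $ k = 0" "H $ i $ j = 0" using i False by auto
      then have "H $ j $ i = 0" using herm[of j i] by simp
      then have "c i = 0" by (simp add: c_def)
      then show ?thesis using 1 by (simp add: entry)
    qed
    show ?case using insert.IH[OF pd' zero] det vol by simp
  qed
  from this[of UNIV H] assms show ?thesis by simp
qed

lemma hform_ellipsoid_volume:
  fixes H :: "complex^'n^'n"
  assumes pd: "hermitian_pd H" and r: "r > 0"
  shows "ennreal (Re (det H)) * emeasure lborel {z. hform H (z - a) < r\<^sup>2} =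
     ennreal (r ^ DIM(complex^'n)) * emeasure lborel (ball (0 :: complex^'n) 1)"
proof -
  have [measurable]: "{z. hform H (z - a) < r\<^sup>2} \<in> sets borel" by measurable
  have "(lborel :: (complex^'n) measure) = density (distr lborel borel (\<lambda>x. a + r *\<^sub>R x)) (\<lambda>_. ennreal (\<bar>r\<bar> ^ DIM(complex^'n)))"
    using r by (intro lborel_affine) auto
  then have "emeasure lborel {z. hform H (z - a) < r\<^sup>2} = 
     emeasure (density (distr lborel borel (\<lambda>x. a + r *\<^sub>R x)) (\<lambda>_. ennreal (\<bar>r\<bar> ^ DIM(complex^'n)))) {z. hform H (z - a) < r\<^sup>2}"
    by simp
  also have "\<dots> = ennreal (r ^ DIM(complex^'n)) * emeasure lborel ((\<lambda>x. a + r *\<^sub>R x) -` {z. hform H (z - a) < r\<^sup>2})"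
    using r by (simp add: emeasure_density nn_integral_cmult_indicator emeasure_distr)
  also have "(\<lambda>x. a + r *\<^sub>R x) -` {z. hform H (z - a) < r\<^sup>2} = {w. hform H w < 1}"
    using r by (auto simp: hform_scaleR)
  finally have "ennreal (Re (det H)) * emeasure lborel {z. hform H (z - a) < r\<^sup>2} =
      ennreal (r ^ DIM(complex^'n)) * (ennreal (Re (det H)) * emeasure lborel {w. hform H w < 1})"
    by (simp only: mult.left_commute)
  then show ?thesis using hform_volume[OF pd] by simp
qed

subsection \<open>Covering by ellipsoids of the Levi form\<close>

text \<open>With \<open>\<kappa>\<close> absorbed in \<open>g\<^sub>1, g\<^sub>2\<close>: a function with a zero at distance \<open>1\<close> from the
  centre cannot have an almost maximal centre on the disc of radius \<open>5\<close>, because \<open>e \<le> 3 < 4\<close>.\<close>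
lemma poly_root_growth:
  fixes p :: "complex poly"
  assumes root: "poly p 1 = 0" and nz: "poly p 0 \<noteq> 0"
    and bound: "\<And>\<zeta>. cmod \<zeta> = 5 \<Longrightarrow> cmod (poly p \<zeta>) \<le> cmod (poly p 0) * exp (Re (g1 * \<zeta> + g2 * \<zeta>\<^sup>2) + 1)"
  shows False
proof -
  obtain q where q: "p = [:-1, 1:] * q" using root by (metis dvd_def poly_eq_0_iff_dvd)
  \<comment> \<open>The exponential cancels the growth allowed in \<open>bound\<close> without
    leaving the holomorphic functions. Dividing by z - 1 gains at least 4 on the circle and costs
    nothing at 0, where that factor has modulus 1.\<close>
  define G where "G \<zeta> = poly q \<zeta> * exp (- (g1 * \<zeta> + g2 * \<zeta>\<^sup>2))" for \<zeta>
  have "norm (G 0) \<le> cmod (poly p 0) * exp 1 / 4"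
  proof (rule maximum_modulus_frontier[of G "ball 0 5"])
    have "G holomorphic_on UNIV" unfolding G_def by (intro holomorphic_intros)
    then show "G holomorphic_on interior (ball 0 5)" "continuous_on (closure (ball 0 5)) G"
      by (auto intro: holomorphic_on_subset holomorphic_on_imp_continuous_on continuous_on_subset)
    fix z assume "z \<in> frontier (ball (0::complex) 5)"
    then have z: "cmod z = 5" by simp
    have "4 \<le> cmod (z - 1)" using norm_triangle_ineq2[of z 1] z by simp
    then have "4 * cmod (poly q z) \<le> cmod (z - 1) * cmod (poly q z)" by (rule mult_right_mono) simp
    also have "\<dots> = cmod (poly p z)" by (simp add: q norm_mult[symmetric] algebra_simps)
    also have "\<dots> \<le> cmod (poly p 0) * exp (Re (g1 * z + g2 * z\<^sup>2) + 1)" by (rule bound[OF z])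
    finally have "4 * cmod (poly q z) * exp (- Re (g1 * z + g2 * z\<^sup>2)) \<le>
        cmod (poly p 0) * exp (Re (g1 * z + g2 * z\<^sup>2) + 1) * exp (- Re (g1 * z + g2 * z\<^sup>2))"
      by (rule mult_right_mono) simp
    also have "\<dots> = cmod (poly p 0) * exp 1" by (simp add: mult.assoc exp_add[symmetric])
    finally have "4 * (cmod (poly q z) * exp (- Re (g1 * z + g2 * z\<^sup>2))) \<le> cmod (poly p 0) * exp 1"
      by (simp only: mult.assoc)
    moreover have "norm (G z) = cmod (poly q z) * exp (- Re (g1 * z + g2 * z\<^sup>2))"
      by (simp add: G_def norm_mult)
    ultimately show "norm (G z) \<le> cmod (poly p 0) * exp 1 / 4" by linarith
  qed auto
  moreover have "norm (G 0) = cmod (poly p 0)" by (simp add: G_def q norm_mult)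
  moreover have "exp 1 / 4 < (1::real)" using exp_le by simp
  ultimately show False using nz
    by (smt (verit) mult_less_cancel_left1 times_divide_eq_right zero_less_norm_iff mult_le_cancel_left1 norm_ge_zero)
qed

section \<open>Separated sets and perturbations of the Hessian\<close>

lemma parallelogram_imp_add_le:
  fixes q :: "'a::real_normed_vector \<Rightarrow> real"
  assumes par: "\<And>v w. q (v + w) + q (v - w) = 2 * q v + 2 * q w" and nn: "\<And>v. q v \<ge> 0"
  shows "q (v + w) \<le> 2 * q v + 2 * q w"
  using par[of v w] nn[of "v - w"] by linarith

text \<open>Pigeonhole: a ball of radius \<open>d/2\<close> from a finite cover contains at most one
  point of the set.\<close>

lemma finite_separated_bounded:
  fixes S :: "'a::euclidean_space set"
  assumes S: "bounded S" and d: "d > 0"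
  shows "\<exists>N. \<forall>A. A \<subseteq> S \<and> (\<forall>a\<in>A. \<forall>b\<in>A. a \<noteq> b \<longrightarrow> dist a b \<ge> d) \<longrightarrow> finite A \<and> card A \<le> N"
proof -
  have "compact (closure S)" using S by (simp add: compact_eq_bounded_closed bounded_closure)
  then obtain T where T: "finite T" "closure S \<subseteq> (\<Union>t\<in>T. ball t (d/2))"
    using compactE_image[of "closure S" "closure S" "\<lambda>t. ball t (d/2)"] d
    by (metis UN_I centre_in_ball half_gt_zero open_ball subsetI)
  show ?thesis
  proof (intro exI[of _ "card T"] allI impI)
    fix A assume A: "A \<subseteq> S \<and> (\<forall>a\<in>A. \<forall>b\<in>A. a \<noteq> b \<longrightarrow> dist a b \<ge> d)"
    have "\<forall>a\<in>A. \<exists>t\<in>T. a \<in> ball t (d/2)" using A T(2) closure_subset by fast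
    then obtain h where h: "\<And>a. a \<in> A \<Longrightarrow> h a \<in> T" "\<And>a. a \<in> A \<Longrightarrow> a \<in> ball (h a) (d/2)" by metis
    have "inj_on h A"
    proof (rule inj_onI, rule ccontr)
      fix a b assume ab: "a \<in> A" "b \<in> A" "h a = h b" "a \<noteq> b"
      have "dist a b \<le> dist (h a) a + dist (h a) b" by (metis dist_commute dist_triangle)
      also have "\<dots> < d" using h(2)[OF ab(1)] h(2)[OF ab(2)] ab(3) by simp
      finally show False using A ab by force
    qed
    moreover have "h ` A \<subseteq> T" using h by auto
    ultimately show "finite A \<and> card A \<le> card T"
      using T(1) by (metis card_inj_on_le finite_imageD finite_subset)
  qed
qed

text \<open>\<open>R\<close> will compare points in a form that varies with the base point, so it is
  not a metric condition. Its Euclidean consequence bounds the cardinalities, and a separated set of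
  largest cardinality is maximal.\<close>

lemma maximal_separated_set:
  fixes S :: "'a::euclidean_space set" and R :: "'a \<Rightarrow> 'a \<Rightarrow> bool"
  assumes S: "bounded S" and d: "d > 0"
    and sym: "\<And>a b. R a b \<Longrightarrow> R b a" and sep: "\<And>a b. a \<in> S \<Longrightarrow> b \<in> S \<Longrightarrow> R a b \<Longrightarrow> dist a b \<ge> d"
  shows "\<exists>A\<subseteq>S. finite A \<and> (\<forall>a\<in>A. \<forall>b\<in>A. a \<noteq> b \<longrightarrow> R a b) \<and> (\<forall>x\<in>S. \<exists>a\<in>A. x = a \<or> \<not> R a x)"
proof -
  define P where "P A \<longleftrightarrow> A \<subseteq> S \<and> (\<forall>a\<in>A. \<forall>b\<in>A. a \<noteq> b \<longrightarrow> R a b)" for A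
  obtain N where N: "\<And>A. A \<subseteq> S \<and> (\<forall>a\<in>A. \<forall>b\<in>A. a \<noteq> b \<longrightarrow> dist a b \<ge> d) \<Longrightarrow> finite A \<and> card A \<le> N"
    using finite_separated_bounded[OF S d] by blast
  have PN: "finite A \<and> card A \<le> N" if "P A" for A
  proof (rule N)
    show "A \<subseteq> S \<and> (\<forall>a\<in>A. \<forall>b\<in>A. a \<noteq> b \<longrightarrow> dist a b \<ge> d)"
      using that sep unfolding P_def by blast
  qed
  have P0: "P {}" by (simp add: P_def)
  have "\<forall>B. P B \<longrightarrow> card B < Suc N" using PN by (simp add: less_Suc_eq_le)
  from ex_has_greatest_nat[OF P0 this]
  obtain A where A: "P A" "\<And>B. P B \<Longrightarrow> card B \<le> card A" by auto
  have "\<exists>a\<in>A. x = a \<or> \<not> R a x" if x: "x \<in> S" for x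
  proof (rule ccontr)
    assume "\<not> (\<exists>a\<in>A. x = a \<or> \<not> R a x)"
    then have R: "\<And>a. a \<in> A \<Longrightarrow> x \<noteq> a \<and> R a x" by blast
    have AR: "A \<subseteq> S" "\<And>a b. a \<in> A \<Longrightarrow> b \<in> A \<Longrightarrow> a \<noteq> b \<Longrightarrow> R a b"
      using A(1) unfolding P_def by blast+
    have "R a b" if "a \<in> insert x A" "b \<in> insert x A" "a \<noteq> b" for a b
      using that R sym AR(2) by (metis insert_iff)
    then have "P (insert x A)" using AR(1) x unfolding P_def by (intro conjI insert_subsetI ballI impI)
    then have "card (insert x A) \<le> card A" by (rule A(2))
    moreover have "x \<notin> A" using R by blast
    ultimately show False using PN[OF A(1)] by simp
  qed
  then show ?thesis using A(1) PN[OF A(1)] unfolding P_def by blast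
qed

lemma levi_plus_form:
  assumes "Cinf_on U u" "x \<in> U"
  shows "hform (cHess u x + mat (of_real \<epsilon>)) w = levi u x w + \<epsilon> * (norm w)\<^sup>2"
proof -
  have "hform (cHess u x + mat (of_real \<epsilon>)) w = hform (cHess u x) w +
     Re (\<Sum>j\<in>UNIV. \<Sum>k\<in>UNIV. (if k = j then of_real (\<epsilon> * (cmod (w $ j))\<^sup>2) else 0))"
    unfolding hform_def sum.distrib[symmetric] plus_complex.sel(1)[symmetric]
    by (intro arg_cong[of _ _ Re] sum.cong refl)
       (auto simp: mat_def distrib_right mult.assoc complex_norm_square[symmetric] simp del: of_real_power)
  also have "\<dots> = levi u x w + \<epsilon> * (norm w)\<^sup>2"
    unfolding levi_eq_hform[OF assms] norm_vec_def L2_set_def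
    by (simp add: sum_nonneg sum_distrib_left)
  finally show ?thesis .
qed

lemma levi_parallelogram:
  assumes u: "Cinf_on U u" "x \<in> U"
  shows "levi u x (v + w) + levi u x (v - w) = 2 * levi u x v + 2 * levi u x w"
proof -
  note l = iter_dd2_linear_left[OF u] and r = iter_dd2_linear_right[OF u]
  show ?thesis
    unfolding levi_def vector_add_ldistrib vector_ssub_ldistrib linear_add[OF l] linear_diff[OF l] linear_add[OF r] linear_diff[OF r]
    by argo
qed

lemma levi_diff_bound:
  assumes "\<And>v. \<bar>iter_dd u [v, v] x - iter_dd u [v, v] y\<bar> \<le> \<eta> * (norm v)\<^sup>2"
  shows "\<bar>levi u x w - levi u y w\<bar> \<le> \<eta> * (norm w)\<^sup>2"
proof -
  have "norm (\<i> *s w) = norm w" by (simp add: norm_cvec_scale)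
  then show ?thesis
    using assms[of w] assms[of "\<i> *s w"] zero_le_power2[of "norm w"] order_trans[OF abs_ge_zero assms[of w]]
    unfolding levi_def by (simp only: abs_le_iff) argo
qed

lemma iter_dd2_bounded:
  fixes u :: "'a::euclidean_space \<Rightarrow> real"
  assumes u: "Cinf_on U u" and K: "compact K" "K \<subseteq> U"
  shows "\<exists>\<Lambda>>0. \<forall>x\<in>K. \<forall>v. \<bar>iter_dd u [v, v] x\<bar> \<le> \<Lambda> * (norm v)\<^sup>2"
proof -
  have "bounded (\<Union>(b, c)\<in>Basis \<times> Basis. iter_dd u [b, c] ` K)"
  proof (intro bounded_UN ballI, simp, clarify)
    fix b c :: 'a
    have "continuous_on K (iter_dd u [b, c])"
      using u K(2) continuous_on_subset unfolding Cinf_on_def by blast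
    then show "bounded (iter_dd u [b, c] ` K)"
      using K(1) compact_continuous_image compact_imp_bounded by blast
  qed
  then obtain M where M: "M > 0" "\<And>y. y \<in> (\<Union>(b, c)\<in>Basis \<times> Basis. iter_dd u [b, c] ` K) \<Longrightarrow> norm y \<le> M"
    unfolding bounded_pos by blast
  have M2: "\<bar>iter_dd u [b, c] x\<bar> \<le> M" if "b \<in> Basis" "c \<in> Basis" "x \<in> K" for b c x
    using M(2)[of "iter_dd u [b, c] x"] that unfolding real_norm_def by blast
  define \<Lambda> where "\<Lambda> = real DIM('a) * real DIM('a) * M"
  have "\<bar>iter_dd u [v, v] x\<bar> \<le> \<Lambda> * (norm v)\<^sup>2" if x: "x \<in> K" for x v
  proof -
    have xU: "x \<in> U" using x K(2) by auto
    have "\<bar>iter_dd u [v, v] x\<bar> \<le> (\<Sum>b\<in>Basis. \<Sum>c\<in>Basis. \<bar>(v \<bullet> b) * (v \<bullet> c) * iter_dd u [b, c] x\<bar>)"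
      unfolding iter_dd2_expand[OF u xU, of v v]
      by (intro order_trans[OF sum_abs] sum_mono sum_abs)
    also have "\<dots> \<le> (\<Sum>b\<in>(Basis::'a set). \<Sum>c\<in>(Basis::'a set). (norm v)\<^sup>2 * M)"
    proof (intro sum_mono)
      fix b c :: 'a assume bc: "b \<in> Basis" "c \<in> Basis"
      have "\<bar>v \<bullet> b\<bar> * \<bar>v \<bullet> c\<bar> \<le> norm v * norm v"
        by (rule mult_mono[OF Basis_le_norm[OF bc(1)] Basis_le_norm[OF bc(2)]]) simp_all
      then show "\<bar>(v \<bullet> b) * (v \<bullet> c) * iter_dd u [b, c] x\<bar> \<le> (norm v)\<^sup>2 * M"
        using M2[OF bc x] unfolding abs_mult power2_eq_square
        by (rule mult_mono) (simp_all del: iter_dd.simps)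
    qed
    also have "\<dots> = \<Lambda> * (norm v)\<^sup>2" by (simp add: \<Lambda>_def)
    finally show ?thesis .
  qed
  moreover have "\<Lambda> > 0" using M(1) by (simp add: \<Lambda>_def)
  ultimately show ?thesis by blast
qed

lemma continuous_cHess_entry:
  assumes u: "Cinf_on U u" and K: "K \<subseteq> U"
  shows "continuous_on K (\<lambda>z. cHess u z $ j $ k)"
proof -
  have c: "continuous_on K (iter_dd u vs)" for vs
    using u K continuous_on_subset unfolding Cinf_on_def by blast
  show ?thesis
    unfolding cHess_def vec_lambda_beta by (intro continuous_intros c) simp_all
qed

text \<open>One number is both the perturbation and the radius: uniform continuity of the perturbed
  determinant on the product of the unit interval and \<open>K\<close> compares the pair
  (\<open>\<delta>\<close>, \<open>a\<close>) with (0, \<open>z\<close>).\<close>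

lemma det_cHess_uniform:
  fixes u :: "complex^'n \<Rightarrow> real"
  assumes u: "Cinf_on U u" and K: "compact K" "K \<subseteq> U" and t: "\<tau> > 0"
  shows "\<exists>\<delta>>0. \<forall>a\<in>K. \<forall>z\<in>K. dist a z < \<delta> \<longrightarrow>
     \<bar>Re (det (cHess u a + mat (of_real \<delta>))) - Re (det (cHess u z))\<bar> < \<tau>"
proof -
  define \<Psi> where "\<Psi> = (\<lambda>p. Re (det (cHess u (snd p) + mat (of_real (fst p)))) :: real)"
  have cH: "continuous_on ({0..1::real} \<times> K) (\<lambda>p. cHess u (snd p) $ i $ k)" for i k
    by (rule continuous_on_compose2[OF continuous_cHess_entry[OF u K(2)]]) (auto intro!: continuous_intros)
  have cm: "continuous_on S (\<lambda>p. (mat (of_real (fst p)) :: complex^'n^'n) $ i $ k)" for S :: "(real \<times> (complex^'n)) set" and i k :: 'n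
    unfolding mat_def vec_lambda_beta by (cases "i = k") (auto intro!: continuous_intros)
  have "continuous_on ({0..1} \<times> K) \<Psi>"
    unfolding \<Psi>_def det_def vector_add_component by (intro continuous_intros cH cm)
  moreover have "compact ({0..1::real} \<times> K)" by (intro compact_Times K(1)) simp
  ultimately have "uniformly_continuous_on ({0..1} \<times> K) \<Psi>"
    by (rule compact_uniformly_continuous)
  from this[unfolded uniformly_continuous_on_def, rule_format, OF t]
  obtain d where d: "d > 0" "\<And>p q. p \<in> {0..1} \<times> K \<Longrightarrow> q \<in> {0..1} \<times> K \<Longrightarrow> dist q p < d \<Longrightarrow> dist (\<Psi> q) (\<Psi> p) < \<tau>"
    by blast
  define \<delta> where "\<delta> = min (d / 2) 1"
  have \<delta>: "\<delta> > 0" "\<delta> \<le> 1" "\<delta> \<le> d / 2" using d by (auto simp: \<delta>_def)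
  have "\<bar>Re (det (cHess u a + mat (of_real \<delta>))) - Re (det (cHess u z))\<bar> < \<tau>"
    if "a \<in> K" "z \<in> K" "dist a z < \<delta>" for a z
  proof -
    have "dist (\<delta>, a) (0, z) \<le> dist \<delta> 0 + dist a z"
      unfolding dist_Pair_Pair by (rule sqrt_sum_squares_le_sum) auto
    also have "\<dots> < d" using that(3) \<delta> by simp
    finally have "dist (\<Psi> (\<delta>, a)) (\<Psi> (0, z)) < \<tau>" using that \<delta> by (intro d(2)) auto
    moreover have "mat (complex_of_real 0) = (0 :: complex^'n^'n)" by (simp add: mat_def vec_eq_iff)
    ultimately show ?thesis by (simp add: \<Psi>_def dist_real_def)
  qed
  with \<delta>(1) show ?thesis by blast
qed

lemma levi_minus:
  assumes u: "Cinf_on U u" "x \<in> U"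
  shows "levi u x (- w) = levi u x w"
proof -
  note l = iter_dd2_linear_left[OF u] and r = iter_dd2_linear_right[OF u]
  have "\<i> *s (- w) = - (\<i> *s w)" by (simp add: vec_eq_iff)
  then show ?thesis unfolding levi_def by (simp only: linear_neg[OF l] linear_neg[OF r] minus_minus)
qed

lemma levi_zero:
  fixes u :: "complex^'n \<Rightarrow> real"
  assumes u: "Cinf_on U u" "x \<in> U"
  shows "levi u x 0 = 0"
proof -
  have "\<i> *s 0 = (0 :: complex^'n)" by (simp add: vec_eq_iff)
  then show ?thesis using linear_0[OF iter_dd2_linear_left[OF u]] unfolding levi_def by (simp del: iter_dd.simps)
qed

text \<open>A Vitali argument with ellipsoids of the perturbed Levi form, all of the same
  \<open>r\<close>. The volume of an ellipsoid times the determinant at its centre does not depend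
  on the centre, so disjointness turns mass into a bound for \<open>card A\<close>. The scale
  \<open>\<rho> \<epsilon>\<close> is a parameter because the closeness wanted later depends on the
  perturbation produced here.\<close>

lemma levi_cover:
  fixes u :: "complex^'n \<Rightarrow> real"
  assumes u: "Cinf_on U u" and K: "compact K" "K \<subseteq> U"
    and S: "compact S" "S \<subseteq> W" and W: "open W" "W \<subseteq> K"
    and nn: "\<And>x w. x \<in> W \<Longrightarrow> levi u x w \<ge> 0" and t: "\<tau> > 0" and \<rho>: "\<And>\<epsilon>. \<epsilon> > 0 \<Longrightarrow> \<rho> \<epsilon> > 0"
  shows "\<exists>\<epsilon>>0. \<exists>r>0. \<exists>A\<subseteq>S. finite A \<and>
     (\<forall>x\<in>S. \<exists>a\<in>A. dist x a < \<rho> \<epsilon> \<and> levi u x (a - x) + \<epsilon> * (norm (a - x))\<^sup>2 < 2 * r\<^sup>2) \<and>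
     of_nat (card A) * (ennreal ((r\<^sup>2 / 7) ^ CARD('n)) * emeasure lborel (ball (0 :: complex^'n) 1))
       \<le> (\<integral>\<^sup>+z. ennreal (indicator W z * (Re (det (cHess u z)) + \<tau>)) \<partial>lborel)"
proof -
  obtain \<epsilon> where \<epsilon>: "\<epsilon> > 0" and detu: "\<And>a z. a \<in> K \<Longrightarrow> z \<in> K \<Longrightarrow> dist a z < \<epsilon> \<Longrightarrow>
     \<bar>Re (det (cHess u a + mat (of_real \<epsilon>))) - Re (det (cHess u z))\<bar> < \<tau>"
    using det_cHess_uniform[OF u K t] by blast
  define q where "q x w = levi u x w + \<epsilon> * (norm w)\<^sup>2" for x w
  obtain \<rho>1 where \<rho>1: "\<rho>1 > 0" "\<And>x y v. x \<in> K \<Longrightarrow> y \<in> K \<Longrightarrow> dist x y < \<rho>1 \<Longrightarrow>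
     \<bar>iter_dd u [v, v] x - iter_dd u [v, v] y\<bar> \<le> \<epsilon> * (norm v)\<^sup>2"
    using iter_dd2_uniform[OF u K \<epsilon>] by blast
  have WU: "x \<in> U" if "x \<in> W" for x using that W(2) K(2) by auto
  \<comment> \<open>The oscillation of the Levi form costs one further \<open>\<epsilon>\<close>
    term, which \<open>q y w\<close> dominates because the Levi form at \<open>y\<close> is
    nonnegative.\<close>
  have compare: "q x w \<le> 2 * q y w" if "x \<in> W" "y \<in> W" "dist x y < \<rho>1" for x y w
  proof -
    have "\<bar>levi u x w - levi u y w\<bar> \<le> \<epsilon> * (norm w)\<^sup>2"
      using that W(2) by (intro levi_diff_bound \<rho>1(2)) auto
    then show ?thesis using nn[OF that(2), of w] unfolding q_def by (simp only: abs_le_iff) argo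
  qed
  have q_low: "\<epsilon> * (norm w)\<^sup>2 \<le> q x w" if "x \<in> W" for x w
    using nn[OF that, of w] by (simp add: q_def)
  have q_neg: "q x (a - b) = q x (b - a)" if "x \<in> W" for x a b
    using levi_minus[OF u WU[OF that], of "a - b"] by (simp add: q_def norm_minus_commute)
  have q_add: "q x (v + w) \<le> 2 * q x v + 2 * q x w" if "x \<in> W" for x v w
  proof (rule parallelogram_imp_add_le)
    show "q x v \<ge> 0" for v using q_low[OF that, of v] \<epsilon> by (smt (verit) mult_nonneg_nonneg zero_le_power2)
    show "q x (v + w) + q x (v - w) = 2 * q x v + 2 * q x w" for v w
    proof -
      have "(norm (v + w))\<^sup>2 + (norm (v - w))\<^sup>2 = 2 * (norm v)\<^sup>2 + 2 * (norm w)\<^sup>2"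
        by (simp add: power2_norm_eq_inner inner_simps inner_commute)
      from arg_cong[OF this, of "\<lambda>t. \<epsilon> * t"] levi_parallelogram[OF u WU[OF that], of v w]
      show ?thesis unfolding q_def distrib_left by argo
    qed
  qed
  obtain e0 where e0: "e0 > 0" "(\<Union>x\<in>S. ball x e0) \<subseteq> W"
    using compact_subset_open_imp_ball_epsilon_subset[OF S(1) W(1) S(2)] by blast
  \<comment> \<open>The four bounds give, in turn, the closeness that is asked for, comparability of
    the forms, closeness of the determinants, and containment in \<open>W\<close>.\<close>
  define \<mu> where "\<mu> = min (min (\<rho> \<epsilon>) \<rho>1) (min \<epsilon> e0)"
  have \<mu>: "\<mu> > 0" "\<mu> \<le> \<rho> \<epsilon>" "\<mu> \<le> \<rho>1" "\<mu> \<le> \<epsilon>" "\<mu> \<le> e0"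
    using \<rho>[OF \<epsilon>] \<rho>1(1) \<epsilon> e0(1) by (auto simp: \<mu>_def)
  \<comment> \<open>Chosen so that \<open>q x w < 2 * r\<^sup>2\<close> forces
    \<open>norm w < \<mu> / 2\<close>: the term with \<open>\<epsilon>\<close> makes the form at
    least \<open>\<epsilon>\<close> times the Euclidean one.\<close>
  define r where "r = sqrt \<epsilon> * \<mu> / 4"
  have r: "r > 0" using \<epsilon> \<mu> by (simp add: r_def)
  have r2: "r\<^sup>2 = \<epsilon> * \<mu>\<^sup>2 / 16" using \<epsilon> by (simp add: r_def power_mult_distrib power_divide)
  have small: "norm w < \<mu> / 2" if "x \<in> W" "q x w < 2 * r\<^sup>2" for x w
  proof -
    have "\<epsilon> * (norm w)\<^sup>2 < \<epsilon> * (\<mu>\<^sup>2 / 8)" using q_low[OF that(1), of w] that(2) r2 by linarith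
    then have "(norm w)\<^sup>2 < \<mu>\<^sup>2 / 8" using \<epsilon> by simp
    also have "\<dots> \<le> (\<mu> / 2)\<^sup>2" by (simp add: power_divide)
    finally show ?thesis by (rule power_less_imp_less_base) (use \<mu> in simp)
  qed
  \<comment> \<open>The condition is imposed from both base points to make the relation
    symmetric.\<close>
  define R where "R a b \<longleftrightarrow> q a (b - a) \<ge> r\<^sup>2 \<and> q b (a - b) \<ge> r\<^sup>2" for a b
  obtain \<Lambda> where L: "\<Lambda> > 0" "\<And>x v. x \<in> K \<Longrightarrow> \<bar>iter_dd u [v, v] x\<bar> \<le> \<Lambda> * (norm v)\<^sup>2"
    using iter_dd2_bounded[OF u K] by blast
  have q_up: "q x w \<le> (\<Lambda> + \<epsilon>) * (norm w)\<^sup>2" if "x \<in> K" for x w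
  proof -
    have "iter_dd u [w, w] x \<le> \<Lambda> * (norm w)\<^sup>2" "iter_dd u [\<i> *s w, \<i> *s w] x \<le> \<Lambda> * (norm w)\<^sup>2"
      using L(2)[OF that, of w] L(2)[OF that, of "\<i> *s w"] unfolding norm_cvec_scale abs_le_iff norm_ii mult_1 by blast+
    moreover have "0 \<le> \<Lambda> * (norm w)\<^sup>2" using L(1) by simp
    ultimately show ?thesis unfolding q_def levi_def distrib_right by argo
  qed
  \<comment> \<open>This separation degenerates as \<open>r\<close> shrinks; it only secures the
    existence of a finite maximal set, and no constant depends on it.\<close>
  define d where "d = r / sqrt (\<Lambda> + \<epsilon>)"
  have d: "d > 0" using r L(1) \<epsilon> by (simp add: d_def)
  have sep: "dist a b \<ge> d" if "a \<in> S" "R a b" for a b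
  proof -
    have "a \<in> K" using that S(2) W(2) by auto
    then have "r\<^sup>2 \<le> (\<Lambda> + \<epsilon>) * (norm (b - a))\<^sup>2"
      using q_up[of a "b - a"] that(2) unfolding R_def by linarith
    then have "r\<^sup>2 / (\<Lambda> + \<epsilon>) \<le> (norm (b - a))\<^sup>2" using L(1) \<epsilon> by (simp add: field_simps)
    moreover have "d\<^sup>2 = r\<^sup>2 / (\<Lambda> + \<epsilon>)" using L(1) \<epsilon> by (simp add: d_def power_divide)
    ultimately have "d\<^sup>2 \<le> (norm (b - a))\<^sup>2" by simp
    then have "d \<le> norm (b - a)" by (rule power2_le_imp_le) simp
    then show ?thesis by (simp add: dist_norm norm_minus_commute)
  qed
  have "\<exists>A\<subseteq>S. finite A \<and> (\<forall>a\<in>A. \<forall>b\<in>A. a \<noteq> b \<longrightarrow> R a b) \<and> (\<forall>x\<in>S. \<exists>a\<in>A. x = a \<or> \<not> R a x)"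
    by (rule maximal_separated_set[OF compact_imp_bounded[OF S(1)] d])
       (auto simp: R_def intro: sep[unfolded R_def])
  then obtain A where A: "A \<subseteq> S" "finite A" "\<And>a b. a \<in> A \<Longrightarrow> b \<in> A \<Longrightarrow> a \<noteq> b \<Longrightarrow> R a b"
    "\<And>x. x \<in> S \<Longrightarrow> \<exists>a\<in>A. x = a \<or> \<not> R a x" by blast
  \<comment> \<open>By maximality \<open>x\<close> is close to some \<open>a\<close> in the form at
    \<open>a\<close> or at \<open>x\<close>; passing from \<open>a\<close> to \<open>x\<close> costs
    the factor 2.\<close>
  have cover: "\<exists>a\<in>A. dist x a < \<rho> \<epsilon> \<and> q x (a - x) < 2 * r\<^sup>2" if x: "x \<in> S" for x
  proof -
    obtain a where a: "a \<in> A" "x = a \<or> \<not> R a x" using A(4)[OF x] by blast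
    have xW: "x \<in> W" and aW: "a \<in> W" using x a A(1) S(2) by auto
    have "q x (a - x) < 2 * r\<^sup>2"
    proof (cases "x = a")
      case True
      then show ?thesis using levi_zero[OF u WU[OF xW]] r by (simp add: q_def)
    next
      case False
      then consider "q a (x - a) < r\<^sup>2" | "q x (a - x) < r\<^sup>2" using a(2) unfolding R_def by linarith
      then show ?thesis
      proof cases
        case 1
        then have "q a (x - a) < 2 * r\<^sup>2" using zero_le_power2[of r] by linarith
        then have "norm (x - a) < \<mu> / 2" by (rule small[OF aW])
        then have "dist x a < \<rho>1" using \<mu> by (simp add: dist_norm)
        from compare[OF xW aW this, of "a - x"] q_neg[OF aW, of a x] 1 show ?thesis by linarith
      next
        case 2
        then show ?thesis using r by (smt (verit) zero_less_power)
      qed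
    qed
    moreover have "dist x a < \<rho> \<epsilon>"
      using small[OF xW calculation] \<mu> by (simp add: dist_norm norm_minus_commute)
    ultimately show ?thesis using a(1) by blast
  qed
  define H where "H a = cHess u a + mat (of_real \<epsilon>)" for a
  have Hform: "hform (H a) w = q a w" if "a \<in> W" for a w
    unfolding H_def q_def by (rule levi_plus_form[OF u WU[OF that]])
  have pd: "hermitian_pd (H a)" if "a \<in> W" for a
    unfolding hermitian_pd_def Hform[OF that]
  proof (intro conjI allI impI)
    fix j k show "H a $ k $ j = cnj (H a $ j $ k)"
      unfolding H_def vector_add_component complex_cnj_add cHess_hermitian[OF u WU[OF that], of k j]
      by (simp add: mat_def)
    fix w :: "complex^'n" assume "w \<noteq> 0"
    then have "\<epsilon> * (norm w)\<^sup>2 > 0" using \<epsilon> by simp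
    then show "q a w > 0" using q_low[OF that, of w] by linarith
  qed
  \<comment> \<open>The 7 gives disjointness: the parallelogram inequality costs 2 and the change of
    base point another 2, and 2/7 + 4/7 < 1.\<close>
  define E where "E a = {z. hform (H a) (z - a) < (r / sqrt 7)\<^sup>2}" for a
  have [measurable]: "E a \<in> sets borel" for a unfolding E_def by measurable
  have Eq: "q a (z - a) < r\<^sup>2 / 7" if "a \<in> W" "z \<in> E a" for a z
    using that Hform[OF that(1)] by (simp add: E_def power_divide)
  have Esmall: "norm (z - a) < \<mu> / 2" if "a \<in> W" "z \<in> E a" for a z
    using small[OF that(1), of "z - a"] Eq[OF that] zero_le_power2[of r] by linarith
  have EW: "E a \<subseteq> W" if "a \<in> A" for a
  proof
    fix z assume "z \<in> E a"
    then have "norm (z - a) < \<mu> / 2" using Esmall that A(1) S(2) by blast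
    then have "z \<in> ball a e0" using \<mu> by (simp add: dist_norm norm_minus_commute)
    then show "z \<in> W" using e0(2) that A(1) by blast
  qed
  have disj: "disjoint_family_on E A"
    unfolding disjoint_family_on_def
  proof (intro ballI impI, rule ccontr)
    fix a b assume ab: "a \<in> A" "b \<in> A" "a \<noteq> b" "E a \<inter> E b \<noteq> {}"
    then obtain z where z: "z \<in> E a" "z \<in> E b" by blast
    have W': "a \<in> W" "b \<in> W" using ab A(1) S(2) by auto
    have "dist a b \<le> norm (z - a) + norm (z - b)"
      by (metis dist_norm dist_triangle2 dist_commute)
    then have "dist a b < \<rho>1" using Esmall[OF W'(1) z(1)] Esmall[OF W'(2) z(2)] \<mu> by linarith
    from compare[OF W' this, of "b - z"] q_neg[OF W'(2), of b z] Eq[OF W'(2) z(2)]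
    have "q a (b - z) < 2 * (r\<^sup>2 / 7)" by linarith
    moreover have "q a (b - a) \<le> 2 * q a (z - a) + 2 * q a (b - z)"
      using q_add[OF W'(1), of "z - a" "b - z"] by simp
    moreover have "q a (b - a) \<ge> r\<^sup>2" using A(3)[OF ab(1-3)] by (simp add: R_def)
    ultimately show False using Eq[OF W'(1) z(1)] zero_le_power2[of r] by linarith
  qed
  \<comment> \<open>On each ellipsoid the perturbed determinant at the centre exceeds the
    determinant at \<open>z\<close> by less than \<open>\<tau>\<close>, so \<open>g\<close>
    dominates it.\<close>
  define g where "g z = Re (det (cHess u z)) + \<tau>" for z
  define F where "F z = ennreal (indicator W z * g z)" for z
  have [measurable]: "W \<in> sets borel" using W(1) by simp
  have "continuous_on W g"
    unfolding g_def det_def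
    by (intro continuous_intros continuous_cHess_entry[OF u]) (use W(2) K(2) in auto)
  then have "(\<lambda>z. indicator W z *\<^sub>R g z) \<in> borel_measurable borel"
    by (intro borel_measurable_continuous_on_indicator) auto
  then have F [measurable]: "F \<in> borel_measurable borel" unfolding F_def[abs_def] by simp
  have each: "ennreal ((r\<^sup>2 / 7) ^ CARD('n)) * emeasure lborel (ball (0 :: complex^'n) 1) \<le> emeasure (density lborel F) (E a)"
    if a: "a \<in> A" for a
  proof -
    have aW: "a \<in> W" using a A(1) S(2) by auto
    have "(r / sqrt 7) ^ DIM(complex^'n) = (r\<^sup>2 / 7) ^ CARD('n)"
    proof -
      have "(r / sqrt 7) ^ DIM(complex^'n) = ((r / sqrt 7)\<^sup>2) ^ CARD('n)"
        by (simp add: power_mult[symmetric] mult.commute)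
      then show ?thesis by (simp add: power_divide)
    qed
    then have "ennreal ((r\<^sup>2 / 7) ^ CARD('n)) * emeasure lborel (ball (0 :: complex^'n) 1) = ennreal (Re (det (H a))) * emeasure lborel (E a)"
      using hform_ellipsoid_volume[OF pd[OF aW], of "r / sqrt 7" a] r by (simp add: E_def)
    also have "\<dots> = (\<integral>\<^sup>+z. ennreal (Re (det (H a))) * indicator (E a) z \<partial>lborel)"
      by (simp add: nn_integral_cmult_indicator)
    also have "\<dots> \<le> (\<integral>\<^sup>+z. F z * indicator (E a) z \<partial>lborel)"
    proof (rule nn_integral_mono)
      fix z
      show "ennreal (Re (det (H a))) * indicator (E a) z \<le> F z * indicator (E a) z"
      proof (cases "z \<in> E a")
        case True
        then have zW: "z \<in> W" using EW[OF a] by auto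
        have "dist a z < \<epsilon>" using Esmall[OF aW True] \<mu> by (simp add: dist_norm norm_minus_commute)
        then have "Re (det (H a)) \<le> g z"
          using detu[of a z] aW zW W(2) unfolding H_def g_def by fastforce
        then show ?thesis using True zW by (simp add: F_def ennreal_leI)
      qed simp
    qed
    also have "\<dots> = emeasure (density lborel F) (E a)" by (simp add: emeasure_density)
    finally show ?thesis .
  qed
  have "of_nat (card A) * (ennreal ((r\<^sup>2 / 7) ^ CARD('n)) * emeasure lborel (ball (0 :: complex^'n) 1))
      = (\<Sum>a\<in>A. ennreal ((r\<^sup>2 / 7) ^ CARD('n)) * emeasure lborel (ball (0 :: complex^'n) 1))" by simp
  also have "\<dots> \<le> (\<Sum>a\<in>A. emeasure (density lborel F) (E a))" by (intro sum_mono each)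
  also have "\<dots> = emeasure (density lborel F) (\<Union>a\<in>A. E a)"
    using A(2) disj by (intro sum_emeasure) auto
  also have "\<dots> \<le> emeasure (density lborel F) UNIV" by (intro emeasure_mono) auto
  also have "\<dots> = (\<integral>\<^sup>+z. F z \<partial>lborel)" by (simp add: emeasure_density)
  finally have "of_nat (card A) * (ennreal ((r\<^sup>2 / 7) ^ CARD('n)) * emeasure lborel (ball (0 :: complex^'n) 1))
       \<le> (\<integral>\<^sup>+z. ennreal (indicator W z * (Re (det (cHess u z)) + \<tau>)) \<partial>lborel)"
    unfolding F_def g_def .
  with \<epsilon> r A(1,2) cover show ?thesis unfolding q_def by blast
qed

subsection \<open>Decay of the sublevel sets\<close>

text \<open>The constant of \<open>poly_neg_powr_interval\<close> for an interval of half-length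
  \<open>d\<close>; one factor arises per real coordinate.\<close>

definition box_const :: "real \<Rightarrow> real" where
  "box_const d = 2 * d + sqrt (2 * d) * (4 + 2 * d)"

text \<open>Two levels are used because the compact set to be covered must lie inside an open set
  where the mass is counted. The constant is 1400 = 2 * 50 * 14: the 2 from the exponent
  \<open>1 / (2 * real D)\<close>, the 50 from \<open>\<kappa>\<close>, and the 14 from
  \<open>real D * r\<^sup>2 \<le> 14 * Y\<close> below.\<close>

lemma sublevel_decay:
  fixes u :: "complex^'n \<Rightarrow> real"
  assumes u: "Cinf_on U u" "closure \<Omega> \<subseteq> U" and \<Omega>: "open \<Omega>" "bounded \<Omega>" and psh: "psh \<Omega> u"
    and bd: "\<And>z. z \<in> frontier \<Omega> \<Longrightarrow> u z \<ge> - s0" and s: "s0 < s'" "s' < s" and t: "t > 0" and \<tau>: "\<tau> > 0"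
    and d: "d > 0" "diameter \<Omega> \<le> d"
    and I: "(\<integral>\<^sup>+z. ennreal (indicator {z\<in>\<Omega>. u z < - s'} z * (Re (det (cHess u z)) + \<tau>)) \<partial>lborel) \<le> ennreal I" "I > 0"
  shows "emeasure lborel {z\<in>\<Omega>. u z < - s - t}
     \<le> ennreal (box_const d ^ DIM(complex^'n) *
         exp (- t / (1400 * root CARD('n) (I / measure lborel (ball (0 :: complex^'n) 1)))))"
proof -
  let ?n = "CARD('n)"
  define \<omega> where "\<omega> = measure lborel (ball (0 :: complex^'n) 1)"
  have \<omega>: "\<omega> > 0" "emeasure lborel (ball (0 :: complex^'n) 1) = ennreal \<omega>"
  proof -
    have fin: "emeasure lborel (ball (0 :: complex^'n) 1) < \<infinity>"
      by (rule emeasure_bounded_finite) simp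
    then show "emeasure lborel (ball (0 :: complex^'n) 1) = ennreal \<omega>"
      unfolding \<omega>_def by (simp add: emeasure_eq_ennreal_measure)
    show "\<omega> > 0" unfolding \<omega>_def by (rule content_ball_pos) simp
  qed
  have cu: "continuous_on X u" if "X \<subseteq> U" for X
    using u(1) that continuous_on_subset unfolding Cinf_on_def by (metis iter_dd.simps(1))
  have \<Omega>U: "\<Omega> \<subseteq> U" using u(2) closure_subset by blast
  define K where "K = closure \<Omega>"
  have K: "compact K" "K \<subseteq> U" "\<Omega> \<subseteq> K" using \<Omega>(2) u(2) closure_subset by (auto simp: K_def compact_eq_bounded_closed bounded_closure)
  define S where "S = {z\<in>K. u z \<le> - s}"
  define W where "W = {z\<in>\<Omega>. u z < - s'}"
  have S: "compact S"
  proof -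
    have "closed (K \<inter> u -` {..- s})"
      using K(2) by (intro continuous_closed_preimage cu compact_imp_closed[OF K(1)]) auto
    moreover have "S = K \<inter> (K \<inter> u -` {..- s})" by (auto simp: S_def)
    ultimately show ?thesis using compact_Int_closed[OF K(1)] by metis
  qed
  have W: "open W"
  proof -
    have "open (\<Omega> \<inter> u -` {..< - s'})"
      using \<Omega>(1) \<Omega>U by (intro continuous_open_preimage cu) auto
    moreover have "W = \<Omega> \<inter> u -` {..< - s'}" by (auto simp: W_def)
    ultimately show ?thesis by simp
  qed
  have S\<Omega>: "S \<subseteq> \<Omega>"
  proof
    fix z assume z: "z \<in> S"
    show "z \<in> \<Omega>"
    proof (rule ccontr)
      assume "z \<notin> \<Omega>"
      then have "z \<in> frontier \<Omega>" using z \<Omega>(1) by (simp add: S_def K_def frontier_def interior_open)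
      then show False using bd[of z] z s by (simp add: S_def)
    qed
  qed
  have SW: "S \<subseteq> W" using S\<Omega> s by (auto simp: S_def W_def)
  have WK: "W \<subseteq> K" using K(3) by (auto simp: W_def)
  obtain \<delta> where \<delta>: "\<delta> > 0" "(\<Union>x\<in>S. ball x \<delta>) \<subseteq> \<Omega>"
    using compact_subset_open_imp_ball_epsilon_subset[OF S \<Omega>(1) S\<Omega>] by blast
  have "\<forall>\<epsilon>. \<exists>\<rho>. \<epsilon> > 0 \<longrightarrow> \<rho> > 0 \<and> (\<forall>x\<in>K. \<forall>y\<in>K. \<forall>v. dist x y < \<rho> \<longrightarrow>
      \<bar>iter_dd u [v, v] x - iter_dd u [v, v] y\<bar> \<le> \<epsilon> * (norm v)\<^sup>2)"
    using iter_dd2_uniform[OF u(1) K(1,2)] by blast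
  then obtain \<rho>1 where \<rho>1: "\<forall>\<epsilon>. \<epsilon> > 0 \<longrightarrow> \<rho>1 \<epsilon> > 0 \<and> (\<forall>x\<in>K. \<forall>y\<in>K. \<forall>v. dist x y < \<rho>1 \<epsilon> \<longrightarrow>
      \<bar>iter_dd u [v, v] x - iter_dd u [v, v] y\<bar> \<le> \<epsilon> * (norm v)\<^sup>2)"
    by (elim choice[THEN exE]) 
  \<comment> \<open>The division by 5 keeps the whole disc of radius 5 on the line through
    \<open>x\<close> and its centre inside \<open>\<Omega>\<close> and within the Taylor
    range.\<close>
  define \<rho> where "\<rho> \<epsilon> = min (\<rho>1 \<epsilon>) \<delta> / 5" for \<epsilon>
  have \<rho>: "\<rho> \<epsilon> > 0" if "\<epsilon> > 0" for \<epsilon> using \<rho>1 that \<delta>(1) by (simp add: \<rho>_def)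
  have nn: "levi u x w \<ge> 0" if "x \<in> W" for x w
    using that by (intro psh_levi_nonneg[OF u(1) \<Omega>(1) \<Omega>U psh]) (simp add: W_def)
  have "\<exists>\<epsilon>>0. \<exists>r>0. \<exists>A\<subseteq>S. finite A \<and>
     (\<forall>x\<in>S. \<exists>a\<in>A. dist x a < \<rho> \<epsilon> \<and> levi u x (a - x) + \<epsilon> * (norm (a - x))\<^sup>2 < 2 * r\<^sup>2) \<and>
     of_nat (card A) * (ennreal ((r\<^sup>2 / 7) ^ CARD('n)) * emeasure lborel (ball (0 :: complex^'n) 1))
       \<le> (\<integral>\<^sup>+z. ennreal (indicator W z * (Re (det (cHess u z)) + \<tau>)) \<partial>lborel)"
    by (rule levi_cover[OF u(1) K(1,2) S SW W WK]) (fact nn \<tau> \<rho> | rule nn \<rho>, assumption)+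
  then obtain \<epsilon> r A where \<epsilon>: "\<epsilon> > 0" and r: "r > 0" and A: "A \<subseteq> S" "finite A" and
    cover: "\<forall>x\<in>S. \<exists>a\<in>A. dist x a < \<rho> \<epsilon> \<and> levi u x (a - x) + \<epsilon> * (norm (a - x))\<^sup>2 < 2 * r\<^sup>2" and
    mass: "of_nat (card A) * (ennreal ((r\<^sup>2 / 7) ^ CARD('n)) * emeasure lborel (ball (0 :: complex^'n) 1))
       \<le> (\<integral>\<^sup>+z. ennreal (indicator W z * (Re (det (cHess u z)) + \<tau>)) \<partial>lborel)"
    by (elim exE conjE) (rule that; assumption)
  show ?thesis
  proof (cases "S = {}")
    case True
    then have "{z\<in>\<Omega>. u z < - s - t} = {}" using K(3) t by (force simp: S_def)
    then show ?thesis by (simp only: emeasure_empty zero_le)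
  next
    case False
    then obtain c0 where c0: "c0 \<in> \<Omega>" using S\<Omega> by blast
    have "A \<noteq> {}" using False cover by blast
    define N where "N = card A"
    have N: "N \<ge> 1" using \<open>A \<noteq> {}\<close> A(2) by (simp add: N_def Suc_leI card_gt_0_iff)
    define y where "y = root ?n (real N)"
    have y1: "y \<ge> 1" using N unfolding y_def by (intro real_root_ge_1_iff[THEN iffD2]) auto
    have yn: "y ^ ?n = real N" unfolding y_def by (simp add: real_root_pow_pos2)
    \<comment> \<open>Just above \<open>y\<close>, so that D^n exceeds \<open>N\<close>, yet at most
      \<open>2 * y\<close> because \<open>y\<close> is at least 1.\<close>
    define D where "D = Suc (nat \<lfloor>y\<rfloor>)"
    have D: "y < real D" "real D \<le> 2 * y" using y1 by (auto simp: D_def) linarith+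
    have "real N < real D ^ ?n" unfolding yn[symmetric] using D(1) y1 by (intro power_strict_mono) auto
    then have ND: "card A < D ^ ?n" unfolding N_def by (metis of_nat_less_iff of_nat_power)
    have D0: "D > 0" by (simp add: D_def)
    obtain co where co: "\<exists>\<alpha>\<in>UNIV \<rightarrow>\<^sub>E {..<D}. co \<alpha> \<noteq> 0" "\<And>a. a \<in> A \<Longrightarrow> mpoly_eval D co c0 a = 0"
      using vanishing_mpoly_exists[OF A(2) ND, of c0] by blast
    define P where "P = mpoly_eval D co c0"
    \<comment> \<open>A box around one point of \<open>\<Omega>\<close> with half-side
      \<open>d\<close> contains the closure, so all volume constants depend on
      \<open>\<Omega>\<close> only through \<open>d\<close>.\<close>
    define B where "B = {x. \<forall>b\<in>Basis. \<bar>x \<bullet> b - c0 \<bullet> b\<bar> \<le> d}"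
    have "B = cbox (\<Sum>b\<in>Basis. (c0 \<bullet> b - d) *\<^sub>R b) (\<Sum>b\<in>Basis. (c0 \<bullet> b + d) *\<^sub>R b)"
      unfolding B_def cbox_def by (intro Collect_cong ball_cong refl) (simp add: inner_sum_left_Basis abs_le_iff, arith)
    then have B: "compact B" by (simp add: compact_cbox)
    have KB: "K \<subseteq> B"
    proof
      fix x assume "x \<in> K"
      have "dist x c0 \<le> diameter K"
        using \<open>x \<in> K\<close> c0 K by (intro diameter_bounded_bound compact_imp_bounded) auto
      also have "\<dots> \<le> d" using d(2) diameter_closure[OF \<Omega>(2)] by (simp add: K_def)
      finally show "x \<in> B"
        unfolding B_def by (auto simp: inner_diff_left[symmetric] dist_norm intro: order_trans[OF Basis_le_norm])
    qed
    have Pcont: "continuous_on X P" for X unfolding P_def by (rule continuous_mpoly_eval)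
    have "B \<noteq> {}" using KB K(3) c0 by auto
    then obtain z0 where z0: "z0 \<in> B" "\<And>z. z \<in> B \<Longrightarrow> cmod (P z) \<le> cmod (P z0)"
      using continuous_attains_sup[OF B, of "\<lambda>z. cmod (P z)"] Pcont by (metis continuous_on_norm)
    have "P z0 \<noteq> 0"
    proof -
      obtain z where z: "\<And>i. cmod (z $ i - c0 $ i) < d" "P z \<noteq> 0"
        using mpoly_nonzero_near_centre[OF co(1) d(1), of c0] unfolding P_def by blast
      have "z \<in> B" unfolding B_def
      proof (intro CollectI ballI)
        fix b :: "complex^'n" assume "b \<in> Basis"
        then obtain i w where b: "b = axis i w" "w \<in> Basis" unfolding Basis_vec_def by blast
        have "\<bar>(z - c0) \<bullet> b\<bar> = \<bar>(z $ i - c0 $ i) \<bullet> w\<bar>" by (simp add: b(1) inner_axis)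
        also have "\<dots> \<le> cmod (z $ i - c0 $ i)" by (rule Basis_le_norm[OF b(2)])
        finally show "\<bar>z \<bullet> b - c0 \<bullet> b\<bar> \<le> d" using z(1)[of i] by (simp add: inner_diff_left)
      qed
      from z0(2)[OF this] z(2) show ?thesis by auto
    qed
    define \<kappa> where "\<kappa> = 1 / (50 * r\<^sup>2)"
    have \<kappa>: "\<kappa> > 0" using r by (simp add: \<kappa>_def)
    \<comment> \<open>Maximising \<open>\<Phi>\<close> amounts to minimising \<open>u\<close> - 50
      r^2 log |P|, in a form that makes sense at the zeros of \<open>P\<close>.\<close>
    define \<Phi> where "\<Phi> z = cmod (P z) * exp (- \<kappa> * u z)" for z
    have "continuous_on K \<Phi>" unfolding \<Phi>_def by (intro continuous_intros Pcont cu K(2))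
    moreover have "K \<noteq> {}" using c0 K(3) by auto
    ultimately obtain x0 where x0: "x0 \<in> K" "\<And>z. z \<in> K \<Longrightarrow> \<Phi> z \<le> \<Phi> x0"
      using continuous_attains_sup[OF K(1)] by blast
    \<comment> \<open>Where \<open>u\<close> is above \<open>- s\<close> the bound is immediate from
      the choice of \<open>z0\<close>; a larger maximum would therefore lie in \<open>S\<close>,
      which is ruled out.\<close>
    have key: "\<Phi> x0 \<le> cmod (P z0) * exp (\<kappa> * s)"
    proof (rule ccontr)
      assume neg: "\<not> \<Phi> x0 \<le> cmod (P z0) * exp (\<kappa> * s)"
      have nz: "P x0 \<noteq> 0" using neg by (auto simp: \<Phi>_def)
      have "u x0 \<le> - s"
      proof (rule ccontr)
        assume "\<not> u x0 \<le> - s"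
        then have "\<kappa> * (- u x0) \<le> \<kappa> * s" using \<kappa> by (intro mult_left_mono) auto
        then have "\<Phi> x0 \<le> cmod (P z0) * exp (\<kappa> * s)"
          unfolding \<Phi>_def using z0(2)[of x0] x0(1) KB by (intro mult_mono) auto
        then show False using neg by simp
      qed
      then have xS: "x0 \<in> S" using x0(1) by (simp add: S_def)
      have xU: "x0 \<in> U" using x0(1) K(2) by auto
      obtain a where a: "a \<in> A" "dist x0 a < \<rho> \<epsilon>" "levi u x0 (a - x0) + \<epsilon> * (norm (a - x0))\<^sup>2 < 2 * r\<^sup>2"
        using bspec[OF cover xS] by blast
      \<comment> \<open>The line is parametrised so that the centre \<open>a\<close>, a zero of
        \<open>P\<close>, has parameter 1.\<close>
      define b where "b = a - x0"
      have nb: "5 * norm b < \<rho>1 \<epsilon>" "5 * norm b < \<delta>"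
        using a(2) by (auto simp: b_def dist_norm norm_minus_commute \<rho>_def)
      obtain p where p: "\<And>\<zeta>. P (x0 + \<zeta> *s b) = poly p \<zeta>"
        using mpoly_complex_line[of D co c0 x0 b] unfolding P_def by blast
      have p1: "poly p 1 = 0" using p[of 1] co(2)[OF a(1)] by (simp add: b_def P_def)
      have p0: "poly p 0 = P x0" using p[of 0] by (simp add: vec_eq_iff)
      obtain h1 h2 where h: "\<And>\<zeta>. closed_segment x0 (x0 + \<zeta> *s b) \<subseteq> U \<Longrightarrow>
         \<exists>y\<in>closed_segment x0 (x0 + \<zeta> *s b). u (x0 + \<zeta> *s b) = u x0 + Re (h1 * \<zeta> + h2 * \<zeta>\<^sup>2) + (cmod \<zeta>)\<^sup>2 * levi u x0 b
            + (iter_dd u [\<zeta> *s b, \<zeta> *s b] y - iter_dd u [\<zeta> *s b, \<zeta> *s b] x0) / 2"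
        using complex_line_taylor[OF u(1) xU, of b] by blast
      show False
      proof (rule poly_root_growth[OF p1, of "\<kappa> * h1" "\<kappa> * h2"])
        show "poly p 0 \<noteq> 0" using nz p0 by simp
        fix \<zeta> assume z: "cmod \<zeta> = 5"
        have nz: "norm (\<zeta> *s b) = 5 * norm b" by (simp add: norm_cvec_scale z)
        have "closed_segment x0 (x0 + \<zeta> *s b) \<subseteq> ball x0 \<delta>"
          using nz nb \<delta>(1) by (intro closed_segment_subset) (auto simp: dist_norm)
        then have seg: "closed_segment x0 (x0 + \<zeta> *s b) \<subseteq> \<Omega>" using \<delta>(2) xS by blast
        then obtain y where y: "y\<in>closed_segment x0 (x0 + \<zeta> *s b)"
          "u (x0 + \<zeta> *s b) = u x0 + Re (h1 * \<zeta> + h2 * \<zeta>\<^sup>2) + (cmod \<zeta>)\<^sup>2 * levi u x0 b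
            + (iter_dd u [\<zeta> *s b, \<zeta> *s b] y - iter_dd u [\<zeta> *s b, \<zeta> *s b] x0) / 2"
          using h[of \<zeta>] \<Omega>U by blast
        have "dist y x0 \<le> norm (\<zeta> *s b)" using segment_bound(1)[OF y(1)] by (simp add: dist_norm)
        then have "dist y x0 < \<rho>1 \<epsilon>" using nz nb(1) by simp
        moreover have "y \<in> K" using y(1) seg K(3) by blast
        ultimately have dd: "\<bar>iter_dd u [\<zeta> *s b, \<zeta> *s b] y - iter_dd u [\<zeta> *s b, \<zeta> *s b] x0\<bar> \<le> \<epsilon> * (norm (\<zeta> *s b))\<^sup>2"
          using \<rho>1 \<epsilon> x0(1) by blast
        have n2: "(norm (\<zeta> *s b))\<^sup>2 = 25 * (norm b)\<^sup>2"
          unfolding nz by (simp add: power_mult_distrib)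
        have "iter_dd u [\<zeta> *s b, \<zeta> *s b] y - iter_dd u [\<zeta> *s b, \<zeta> *s b] x0 \<le> \<epsilon> * (25 * (norm b)\<^sup>2)"
          using abs_le_D1[OF dd] unfolding n2 .
        moreover have "0 \<le> \<epsilon> * (norm b)\<^sup>2" using \<epsilon> by simp
        moreover have "levi u x0 b + \<epsilon> * (norm b)\<^sup>2 < 2 * r\<^sup>2" using a(3) by (simp add: b_def)
        \<comment> \<open>On the circle of radius 5 the Levi term and half the second-derivative
          error add up to at most 25 times the form in \<open>a(3)\<close>, which is below
          \<open>2 * r\<^sup>2\<close>.\<close>
        ultimately have ub: "u (x0 + \<zeta> *s b) - u x0 \<le> Re (h1 * \<zeta> + h2 * \<zeta>\<^sup>2) + 50 * r\<^sup>2"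
          using y(2) unfolding z by (simp del: iter_dd.simps plus_complex.sel) argo
        have "x0 + \<zeta> *s b \<in> K" using seg K(3) by auto
        from x0(2)[OF this]
        have "cmod (P (x0 + \<zeta> *s b)) * exp (- \<kappa> * u (x0 + \<zeta> *s b)) * exp (\<kappa> * u (x0 + \<zeta> *s b))
           \<le> cmod (P x0) * exp (- \<kappa> * u x0) * exp (\<kappa> * u (x0 + \<zeta> *s b))"
          unfolding \<Phi>_def by (rule mult_right_mono) simp
        then have "cmod (P (x0 + \<zeta> *s b)) \<le> cmod (P x0) * exp (\<kappa> * (u (x0 + \<zeta> *s b) - u x0))"
          by (simp only: mult.assoc exp_add[symmetric] minus_mult_left[symmetric] add.left_inverse exp_zero mult_1_right right_diff_distrib uminus_add_conv_diff)
        also have "\<dots> \<le> cmod (P x0) * exp (\<kappa> * (Re (h1 * \<zeta> + h2 * \<zeta>\<^sup>2) + 50 * r\<^sup>2))"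
          using ub \<kappa> by (intro mult_left_mono) auto
        also have "\<kappa> * (Re (h1 * \<zeta> + h2 * \<zeta>\<^sup>2) + 50 * r\<^sup>2) = Re (\<kappa> * h1 * \<zeta> + \<kappa> * h2 * \<zeta>\<^sup>2) + 1"
        proof -
          have "\<kappa> * (50 * r\<^sup>2) = 1" using r by (simp add: \<kappa>_def)
          moreover have "Re (\<kappa> * h1 * \<zeta> + \<kappa> * h2 * \<zeta>\<^sup>2) = \<kappa> * Re (h1 * \<zeta> + h2 * \<zeta>\<^sup>2)"
            by (simp add: mult.assoc distrib_left del: times_complex.sel) (simp add: algebra_simps)
          ultimately show ?thesis by (simp only: distrib_left)
        qed
        finally show "cmod (poly p \<zeta>) \<le> cmod (poly p 0) * exp (Re (\<kappa> * h1 * \<zeta> + \<kappa> * h2 * \<zeta>\<^sup>2) + 1)"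
          unfolding p0 p[of \<zeta>] .
      qed
    qed
    have sub: "{z\<in>\<Omega>. u z < - s - t} \<subseteq> {x. (\<forall>b\<in>Basis. \<bar>x \<bullet> b - c0 \<bullet> b\<bar> \<le> d) \<and> cmod (P x) \<le> exp (- \<kappa> * t) * cmod (P z0)}"
    proof
      fix z assume "z \<in> {z\<in>\<Omega>. u z < - s - t}"
      then have z: "z \<in> K" "u z < - s - t" using K(3) by auto
      have "cmod (P z) * exp (- \<kappa> * u z) * exp (\<kappa> * u z) \<le> cmod (P z0) * exp (\<kappa> * s) * exp (\<kappa> * u z)"
        using order_trans[OF x0(2)[OF z(1)] key] unfolding \<Phi>_def by (rule mult_right_mono) simp
      then have "cmod (P z) \<le> cmod (P z0) * exp (\<kappa> * (s + u z))"
        by (simp only: mult.assoc exp_add[symmetric] minus_mult_left[symmetric] add.left_inverse exp_zero mult_1_right distrib_left)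
      also have "\<dots> \<le> cmod (P z0) * exp (\<kappa> * (- t))"
      proof -
        have "\<kappa> * (s + u z) \<le> \<kappa> * (- t)" using z(2) \<kappa> by (intro mult_left_mono) auto
        then show ?thesis by (intro mult_left_mono) (simp_all only: exp_le_cancel_iff norm_ge_zero)
      qed
      finally have "cmod (P z) \<le> exp (- \<kappa> * t) * cmod (P z0)" by (simp add: mult.commute)
      then show "z \<in> {x. (\<forall>b\<in>Basis. \<bar>x \<bullet> b - c0 \<bullet> b\<bar> \<le> d) \<and> cmod (P x) \<le> exp (- \<kappa> * t) * cmod (P z0)}"
        using z(1) KB by (auto simp: B_def)
    qed
    have Pm: "P \<in> borel_measurable borel" by (rule borel_measurable_continuous_onI[OF Pcont])
    have "emeasure lborel {z\<in>\<Omega>. u z < - s - t} \<le>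
       emeasure lborel {x. (\<forall>b\<in>Basis. \<bar>x \<bullet> b - c0 \<bullet> b\<bar> \<le> d) \<and> cmod (P x) \<le> exp (- \<kappa> * t) * cmod (P z0)}"
      using Pm by (intro emeasure_mono sub) measurable
    also have "\<dots> \<le> ennreal ((2*d + sqrt (2*d) * (4 + 2*d)) ^ DIM(complex^'n) * exp (- \<kappa> * t) powr (1 / (2 * real D)))"
    proof (rule poly_sublevel_volume[OF Pm _ D0 d(1)])
      show "\<exists>p. degree p \<le> D \<and> (\<forall>t. P (x + t *\<^sub>R b) = poly p (of_real t))" if "b \<in> Basis" for b x
        unfolding P_def by (rule mpoly_coordinate_line[OF that])
      show "\<bar>z0 \<bullet> b - c0 \<bullet> b\<bar> \<le> d" if "b \<in> Basis" for b using z0(1) that by (simp add: B_def)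
    qed (use \<open>P z0 \<noteq> 0\<close> in auto)
    also have "\<dots> \<le> ennreal (box_const d ^ DIM(complex^'n) * exp (- t / (1400 * root ?n (I / \<omega>))))"
    proof (intro ennreal_leI)
      define Y where "Y = root ?n (I / \<omega>)"
      have "ennreal (real N * ((r\<^sup>2 / 7) ^ ?n * \<omega>)) \<le> ennreal I"
        using order_trans[OF mass I(1)[folded W_def]] \<omega>
        by (simp add: N_def ennreal_mult[symmetric] ennreal_of_nat_eq_real_of_nat)
      then have "real N * ((r\<^sup>2 / 7) ^ ?n * \<omega>) \<le> I" using I(2) by simp
      then have "(y * (r\<^sup>2 / 7)) ^ ?n * \<omega> \<le> I"
        by (simp only: power_mult_distrib yn mult.assoc)
      then have "(y * (r\<^sup>2 / 7)) ^ ?n \<le> I / \<omega>"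
        by (simp only: pos_le_divide_eq[OF \<omega>(1)])
      then have "root ?n ((y * (r\<^sup>2 / 7)) ^ ?n) \<le> Y" unfolding Y_def by (intro real_root_le_mono) auto
      then have "y * (r\<^sup>2 / 7) \<le> Y" using y1 by (simp add: real_root_power_cancel)
      moreover have "real D * r\<^sup>2 \<le> 2 * y * r\<^sup>2" using D(2) by (intro mult_right_mono) auto
      \<comment> \<open>Here \<open>r\<close> disappears: the upper bound for \<open>card A\<close>
        and the choice of \<open>D\<close> only control the product of the degree and
        \<open>r\<^sup>2\<close>.\<close>
      ultimately have DY: "real D * r\<^sup>2 \<le> 14 * Y" by simp
      have Dr: "real D * r\<^sup>2 > 0" using D0 r by simp
      have "exp (- \<kappa> * t) powr (1 / (2 * real D)) = exp (- (t / (100 * (real D * r\<^sup>2))))"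
        using r D0 by (simp add: powr_def \<kappa>_def field_simps)
      also have "\<dots> \<le> exp (- (t / (100 * (14 * Y))))"
      proof -
        have "t / (100 * (14 * Y)) \<le> t / (100 * (real D * r\<^sup>2))"
        proof (rule frac_le)
          show "0 < 100 * (real D * r\<^sup>2)" using Dr by (rule mult_pos_pos[rotated]) simp
          show "100 * (real D * r\<^sup>2) \<le> 100 * (14 * Y)" using DY by (rule mult_left_mono) simp
        qed (use t in simp_all)
        then show ?thesis by simp
      qed
      finally have "exp (- \<kappa> * t) powr (1 / (2 * real D)) \<le> exp (- t / (1400 * Y))" by simp
      then show "(2*d + sqrt (2*d) * (4 + 2*d)) ^ DIM(complex^'n) * exp (- \<kappa> * t) powr (1 / (2 * real D))
         \<le> box_const d ^ DIM(complex^'n) * exp (- t / (1400 * root ?n (I / \<omega>)))"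
        unfolding box_const_def Y_def using d(1)
        by (intro mult_left_mono zero_le_power add_nonneg_nonneg mult_nonneg_nonneg) auto
    qed
    finally show ?thesis unfolding \<omega>_def .
  qed
qed

subsection \<open>De Giorgi iteration and the final estimate\<close>

text \<open>Increments T, T/2, T/4, ... raise the level by less than \<open>2 * T\<close> in all.
  The superlinear power \<open>\<beta>\<close> beats the growth of \<open>(Q / t) powr k\<close> as
  the increments shrink, so \<open>a\<close> decays geometrically along the levels.\<close>

lemma de_giorgi_iteration:
  fixes a :: "real \<Rightarrow> real"
  assumes anti: "\<And>x y. x \<le> y \<Longrightarrow> a y \<le> a x" and nn: "\<And>x. a x \<ge> 0" and V: "\<And>x. a x \<le> V" "V > 0"
    and k: "k > 0" and \<beta>: "\<beta> > 1" and Q: "Q \<ge> 0"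
    and step: "\<And>x t. x > s0 \<Longrightarrow> t > 0 \<Longrightarrow> a (x + t) \<le> (Q / t) powr k * a x powr \<beta>"
    and T: "T > 0" "T \<ge> Q * V powr ((\<beta> - 1) / k) * 2 powr (1 / (\<beta> - 1))" and x1: "x1 > s0"
  shows "a (x1 + 2 * T) = 0"
proof -
  \<comment> \<open>The rate that reproduces itself: it solves
    \<open>k - \<mu> * \<beta> = - \<mu>\<close>.\<close>
  define \<mu> where "\<mu> = k / (\<beta> - 1)"
  have \<mu>: "\<mu> > 0" using k \<beta> by (simp add: \<mu>_def)
  define x where "x j = x1 + T * (2 - 2 * (1/2) ^ j)" for j :: nat
  have xs: "x (Suc j) = x j + T * (1/2) ^ j" for j by (simp add: x_def algebra_simps)
  have xlo: "x j > s0" for j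
  proof -
    have "(1/2::real) ^ j \<le> 1" by (rule power_le_one) auto
    then have "T * (2 - 2 * (1/2) ^ j) \<ge> 0" using T(1) by (intro mult_nonneg_nonneg) auto
    then show ?thesis using x1 by (simp add: x_def)
  qed
  have xhi: "x j \<le> x1 + 2 * T" for j using T(1) by (simp add: x_def algebra_simps)
  \<comment> \<open>The lower bound on \<open>T\<close> is exactly what makes the constant in one
    step at most the geometric ratio.\<close>
  have QT: "(Q / T) powr k * V powr (\<beta> - 1) \<le> 2 powr - \<mu>"
  proof -
    define c where "c = V powr ((\<beta> - 1) / k) * 2 powr (1 / (\<beta> - 1))"
    have c: "c > 0" using V(2) by (simp add: c_def)
    have ck: "c powr k = V powr (\<beta> - 1) * 2 powr \<mu>"
      using k V(2) by (simp add: c_def powr_mult powr_powr \<mu>_def)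
    have "Q * c \<le> T" using T(2) by (simp add: c_def mult.assoc)
    then have "Q / T \<le> 1 / c" using T(1) c by (simp add: field_simps)
    then have "(Q / T) powr k \<le> (1 / c) powr k" using Q T(1) k by (intro powr_mono2) auto
    also have "\<dots> = 1 / (V powr (\<beta> - 1) * 2 powr \<mu>)" using c ck by (simp add: powr_divide)
    finally have "(Q / T) powr k * V powr (\<beta> - 1) \<le> 1 / (V powr (\<beta> - 1) * 2 powr \<mu>) * V powr (\<beta> - 1)"
      by (rule mult_right_mono) simp
    then show ?thesis using V(2) by (simp add: powr_minus_divide)
  qed
  have bound: "a (x j) \<le> V * 2 powr (- \<mu> * real j)" for j
  proof (induction j)
    case 0
    then show ?case using V(1)[of "x 0"] by simp
  next
    case (Suc j)
    have tj: "T * (1/2) ^ j > 0" using T(1) by simp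
    have "a (x (Suc j)) \<le> (Q / (T * (1/2) ^ j)) powr k * a (x j) powr \<beta>"
      unfolding xs by (rule step[OF xlo tj])
    also have "\<dots> \<le> (Q / (T * (1/2) ^ j)) powr k * (V * 2 powr (- \<mu> * real j)) powr \<beta>"
      using Suc nn \<beta> by (intro mult_left_mono powr_mono2) auto
    also have "Q / (T * (1/2) ^ j) = Q / T * 2 powr real j"
      by (simp add: powr_realpow power_one_over)
    also have "(Q / T * 2 powr real j) powr k * (V * 2 powr (- \<mu> * real j)) powr \<beta> =
        ((Q / T) powr k * V powr (\<beta> - 1)) * (V * (2 powr (real j * k) * 2 powr (- \<mu> * real j * \<beta>)))"
    proof -
      have "V powr \<beta> = V powr (\<beta> - 1) * V" using V(2) by (simp add: powr_diff)
      moreover have "(Q / T * 2 powr real j) powr k = (Q / T) powr k * (2 powr real j) powr k"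
        by (rule powr_mult)
      moreover have "(V * 2 powr (- \<mu> * real j)) powr \<beta> = V powr \<beta> * (2 powr (- \<mu> * real j)) powr \<beta>"
        by (rule powr_mult)
      ultimately show ?thesis by (simp only: powr_powr mult_ac)
    qed
    also have "2 powr (real j * k) * 2 powr (- \<mu> * real j * \<beta>) = (2::real) powr (- \<mu> * real j)"
    proof -
      have "k - \<mu> * \<beta> = - \<mu>" using \<beta> by (simp add: \<mu>_def field_simps)
      then have "real j * k + - \<mu> * real j * \<beta> = - \<mu> * real j"
        using arg_cong[of "k - \<mu> * \<beta>" "- \<mu>" "\<lambda>t. real j * t"] by (simp add: algebra_simps)
      then show ?thesis by (simp only: powr_add[symmetric])
    qed
    also have "((Q / T) powr k * V powr (\<beta> - 1)) * (V * 2 powr (- \<mu> * real j)) \<le> 2 powr - \<mu> * (V * 2 powr (- \<mu> * real j))"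
      using QT V(2) by (intro mult_right_mono) auto
    also have "\<dots> = V * 2 powr (- \<mu> * real (Suc j))"
      by (simp add: powr_add[symmetric] algebra_simps)
    finally show ?case .
  qed
  have "(\<lambda>j. V * (2 powr - \<mu>) ^ j) \<longlonglongrightarrow> V * 0"
    using \<mu> by (intro tendsto_mult_left LIMSEQ_realpow_zero) (auto simp: powr_less_one)
  moreover have "a (x1 + 2 * T) \<le> V * (2 powr - \<mu>) ^ j" for j
  proof -
    have "a (x1 + 2 * T) \<le> a (x j)" by (rule anti[OF xhi])
    also have "\<dots> \<le> V * 2 powr (- \<mu> * real j)" by (rule bound)
    also have "2 powr (- \<mu> * real j) = (2 powr - \<mu>) ^ j"
      by (simp add: powr_realpow[symmetric] powr_powr)
    finally show ?thesis .
  qed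
  ultimately have "a (x1 + 2 * T) \<le> V * 0"
    by (intro tendsto_lowerbound[of _ _ sequentially]) auto
  then show ?thesis using nn[of "x1 + 2 * T"] by simp
qed

text \<open>Hoelder's inequality from pointwise Young. Positive upper bounds \<open>A\<close>,
  \<open>B\<close> take the place of the norms, so nothing is divided by zero.\<close>

lemma nn_integral_Young_bound:
  fixes h :: "'a::euclidean_space \<Rightarrow> real"
  assumes [measurable]: "h \<in> borel_measurable borel" "W \<in> sets borel"
    and pq: "p > 1" "q > 1" "1/p + 1/q = 1" and AB: "A > 0" "B > 0"
    and hA: "(\<integral>\<^sup>+x. ennreal (\<bar>h x\<bar> powr p) \<partial>lborel) \<le> ennreal (A powr p)"
    and WB: "emeasure lborel W \<le> ennreal (B powr q)"
  shows "(\<integral>\<^sup>+x. ennreal (indicator W x * h x) \<partial>lborel) \<le> ennreal (A * B)"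
proof -
  \<comment> \<open>With these weights the two integrated terms are \<open>A * B / p\<close> and
    \<open>A * B / q\<close>, which add up to \<open>A * B\<close>.\<close>
  define c1 where "c1 = A * B / (p * A powr p)"
  define c2 where "c2 = A * B / (q * B powr q)"
  have c: "c1 \<ge> 0" "c2 \<ge> 0" using AB pq by (simp_all add: c1_def c2_def)
  have ptw: "indicator W x * h x \<le> c1 * \<bar>h x\<bar> powr p + c2 * indicator W x" for x
  proof (cases "x \<in> W")
    case True
    have "(\<bar>h x\<bar> / A) * (1 / B) \<le> (\<bar>h x\<bar> / A) powr p / p + (1 / B) powr q / q"
      using pq AB by (intro Youngs_inequality) auto
    then have "A * B * ((\<bar>h x\<bar> / A) * (1 / B)) \<le> A * B * ((\<bar>h x\<bar> / A) powr p / p + (1 / B) powr q / q)"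
      using AB by (intro mult_left_mono) auto
    then have "\<bar>h x\<bar> \<le> c1 * \<bar>h x\<bar> powr p + c2"
      using AB pq by (simp add: c1_def c2_def powr_divide distrib_left mult_ac)
    then show ?thesis using True by simp
  qed (use c in simp)
  have "(\<integral>\<^sup>+x. ennreal (indicator W x * h x) \<partial>lborel)
     \<le> (\<integral>\<^sup>+x. ennreal c1 * ennreal (\<bar>h x\<bar> powr p) + ennreal c2 * indicator W x \<partial>lborel)"
  proof (rule nn_integral_mono)
    fix x
    have "ennreal (indicator W x * h x) \<le> ennreal (c1 * \<bar>h x\<bar> powr p + c2 * indicator W x)"
      using ptw by (rule ennreal_leI)
    also have "\<dots> = ennreal c1 * ennreal (\<bar>h x\<bar> powr p) + ennreal c2 * indicator W x"
      using c by (simp add: ennreal_plus ennreal_mult indicator_def)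
    finally show "ennreal (indicator W x * h x) \<le> ennreal c1 * ennreal (\<bar>h x\<bar> powr p) + ennreal c2 * indicator W x" .
  qed
  also have "\<dots> = ennreal c1 * (\<integral>\<^sup>+x. ennreal (\<bar>h x\<bar> powr p) \<partial>lborel) + ennreal c2 * emeasure lborel W"
    by (subst nn_integral_add, measurable) (simp add: nn_integral_cmult nn_integral_cmult_indicator)
  also have "\<dots> \<le> ennreal c1 * ennreal (A powr p) + ennreal c2 * ennreal (B powr q)"
    by (intro add_mono mult_left_mono hA WB) auto
  also have "\<dots> = ennreal (c1 * A powr p + c2 * B powr q)"
    using c by (simp add: ennreal_plus ennreal_mult)
  also have "c1 * A powr p + c2 * B powr q = A * B"
  proof -
    have "c1 * A powr p = A * B * (1 / p)" "c2 * B powr q = A * B * (1 / q)"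
      using AB by (simp_all add: c1_def c2_def)
    then have "c1 * A powr p + c2 * B powr q = A * B * (1 / p + 1 / q)" by (simp only: distrib_left)
    then show ?thesis unfolding pq(3) by simp
  qed
  finally show ?thesis .
qed

section \<open>From exponential decay to the inequality of the iteration\<close>

lemma exp_neg_le_powr:
  fixes k y :: real
  assumes "k > 0" "y > 0"
  shows "exp (- y) \<le> (k / y) powr k"
proof -
  have "y / k \<le> exp (y / k)" using exp_ge_add_one_self[of "y / k"] by linarith
  then have "(y / k) powr k \<le> exp (y / k) powr k" using assms by (intro powr_mono2) auto
  also have "\<dots> = exp y" using assms by (simp add: powr_def)
  finally have "1 / exp y \<le> 1 / (y / k) powr k" using assms by (intro divide_left_mono) auto
  then show ?thesis using assms by (simp add: exp_minus powr_divide inverse_eq_divide)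
qed

text \<open>Replaces \<open>f\<close>, known only up to null sets of the completed measure, by a
  Borel function on which the estimates over \<open>lborel\<close> can operate.\<close>

lemma nn_integral_MA_density:
  fixes u f :: "complex^'n \<Rightarrow> real"
  assumes \<Omega>: "open \<Omega>"
    and int: "integrable (lebesgue_on \<Omega>) (\<lambda>x. \<bar>f x\<bar> powr p)"
    and ae: "AE x in lebesgue_on \<Omega>. g x = f x"
    and m [measurable]: "(\<lambda>x. indicator \<Omega> x * g x) \<in> borel_measurable borel"
  shows "(\<integral>\<^sup>+x. ennreal (\<bar>indicator \<Omega> x * g x\<bar> powr p) \<partial>lborel) = ennreal (\<integral>x. \<bar>f x\<bar> powr p \<partial>lebesgue_on \<Omega>)"
proof -
  have sets: "\<Omega> \<in> sets lebesgue" using \<Omega> by auto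
  have "(\<integral>\<^sup>+x. ennreal (\<bar>indicator \<Omega> x * g x\<bar> powr p) \<partial>lborel) = (\<integral>\<^sup>+x. ennreal (\<bar>indicator \<Omega> x * g x\<bar> powr p) \<partial>lebesgue)"
    by (rule nn_integral_completion[symmetric]) measurable
  also have "\<dots> = (\<integral>\<^sup>+x. ennreal (\<bar>g x\<bar> powr p) * indicator \<Omega> x \<partial>lebesgue)"
    by (intro nn_integral_cong) (auto simp: indicator_def)
  also have "\<dots> = (\<integral>\<^sup>+x. ennreal (\<bar>g x\<bar> powr p) \<partial>lebesgue_on \<Omega>)"
    using sets by (subst nn_integral_restrict_space) auto
  also have "\<dots> = (\<integral>\<^sup>+x. ennreal (\<bar>f x\<bar> powr p) \<partial>lebesgue_on \<Omega>)"
    using ae by (intro nn_integral_cong_AE) (auto elim: eventually_mono)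
  also have "\<dots> = ennreal (\<integral>x. \<bar>f x\<bar> powr p \<partial>lebesgue_on \<Omega>)"
    by (rule nn_integral_eq_integral[OF int]) auto
  finally show ?thesis .
qed

lemma AE_lebesgue_on_imp_lborel:
  fixes \<Omega> :: "'a::euclidean_space set"
  assumes "open \<Omega>" "AE x in lebesgue_on \<Omega>. P x"
  shows "AE x in lborel. x \<in> \<Omega> \<longrightarrow> P x"
proof -
  have "\<Omega> \<in> sets lebesgue" using assms(1) by auto
  then have "AE x in lebesgue. x \<in> \<Omega> \<longrightarrow> P x"
    using assms(2) by (subst (asm) AE_restrict_space_iff) auto
  then show ?thesis by (simp add: AE_completion_iff)
qed

text \<open>Lets the density dominate the determinant of the complex Hessian wherever it is
  nonnegative.\<close>

lemma one_le_MA_factor: "(1::real) \<le> 4 ^ n * fact n"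
proof -
  have "(1::real) * 1 \<le> 4 ^ n * fact n" by (intro mult_mono) auto
  then show ?thesis by simp
qed

text \<open>The bound of \<open>sublevel_decay\<close> after trading the exponential for a
  \<open>k\<close>-th power: 2800 is 2 * 1400, and the box factor is moved inside that power, hence
  its exponent with denominator \<open>k\<close>.\<close>

definition decay_const :: "'n::finite itself \<Rightarrow> real \<Rightarrow> real \<Rightarrow> real" where
  "decay_const TYPE('n) k d = 2800 * k * box_const d powr (real DIM(complex^'n) / k)
     * root CARD('n) (1 / measure lborel (ball (0 :: complex^'n) 1))"

lemma box_const_pos: "d > 0 \<Longrightarrow> box_const d > 0"
  unfolding box_const_def by (intro add_pos_pos mult_pos_pos) auto

text \<open>Hoelder bounds the mass of a sublevel set by \<open>Lp_norm_on p \<Omega> f\<close>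
  times its volume to the power \<open>1/q\<close>; \<open>sublevel_decay\<close> turns that mass
  into volume decay. The result has the shape that \<open>de_giorgi_iteration\<close> asks
  for.\<close>

lemma sublevel_step:
  fixes u f :: "complex^'n \<Rightarrow> real"
  assumes u: "Cinf_on U u" "closure \<Omega> \<subseteq> U" and \<Omega>: "open \<Omega>" "bounded \<Omega>" and psh: "psh \<Omega> u"
    and bd: "\<And>z. z \<in> frontier \<Omega> \<Longrightarrow> u z \<ge> - s0" and \<sigma>: "s0 < \<sigma>" and t: "t > 0"
    and d: "d > 0" "diameter \<Omega> \<le> d"
    and pq: "p > 1" "q > 1" "1/p + 1/q = 1" and k: "k > 0"
    and f0: "\<forall>x\<in>\<Omega>. f x \<ge> 0" and int: "integrable (lebesgue_on \<Omega>) (\<lambda>x. \<bar>f x\<bar> powr p)"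
    and ae: "AE x in lebesgue_on \<Omega>. MA_density u x = f x"
  defines "a \<equiv> \<lambda>\<sigma>. measure lborel {z\<in>\<Omega>. u z < - \<sigma>}"
  shows "a (\<sigma> + t) \<le> (decay_const TYPE('n) k d * root CARD('n) (Lp_norm_on p \<Omega> f) / t) powr k
     * a \<sigma> powr (k / (real CARD('n) * q))"
proof -
  let ?n = "CARD('n)" and ?N = "DIM(complex^'n)"
  define L where "L = Lp_norm_on p \<Omega> f"
  define Fp where "Fp = (\<integral>x. \<bar>f x\<bar> powr p \<partial>lebesgue_on \<Omega>)"
  define \<omega> where "\<omega> = measure lborel (ball (0 :: complex^'n) 1)"
  have \<omega>: "\<omega> > 0" unfolding \<omega>_def by (rule content_ball_pos) simp
  have Fp: "Fp \<ge> 0" unfolding Fp_def by (rule Bochner_Integration.integral_nonneg) simp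
  have L: "L \<ge> 0" "L powr p = Fp"
    using pq Fp by (simp_all add: L_def Lp_norm_on_def Fp_def[symmetric] powr_powr)
  have \<Omega>U: "\<Omega> \<subseteq> U" using u(2) closure_subset by blast
  have cu: "continuous_on X u" if "X \<subseteq> U" for X
    using u(1) that continuous_on_subset unfolding Cinf_on_def by (metis iter_dd.simps(1))
  have op: "open {z\<in>\<Omega>. u z < - \<sigma>}" for \<sigma>
  proof -
    have "open (\<Omega> \<inter> u -` {..< - \<sigma>})"
      using \<Omega>(1) \<Omega>U by (intro continuous_open_preimage cu) auto
    moreover have "{z\<in>\<Omega>. u z < - \<sigma>} = \<Omega> \<inter> u -` {..< - \<sigma>}" by auto
    ultimately show ?thesis by simp
  qed
  have fin: "emeasure lborel X < \<infinity>" if "X \<subseteq> \<Omega>" for X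
    using bounded_subset[OF \<Omega>(2) that] by (rule emeasure_bounded_finite)
  have em: "emeasure lborel {z\<in>\<Omega>. u z < - \<sigma>} = ennreal (a \<sigma>)" for \<sigma>
    unfolding a_def using fin[of "{z\<in>\<Omega>. u z < - \<sigma>}"] by (intro emeasure_eq_ennreal_measure) auto
  define V where "V = measure lborel \<Omega>"
  have V: "emeasure lborel \<Omega> = ennreal V" "V \<ge> 0"
    unfolding V_def using fin[of \<Omega>] by (auto intro!: emeasure_eq_ennreal_measure)
  have a0: "a \<sigma> \<ge> 0" for \<sigma> by (simp add: a_def)
  define h where "h x = indicator \<Omega> x * MA_density u x" for x
  have "continuous_on \<Omega> (MA_density u)"
    unfolding MA_density_def det_def
    by (intro continuous_intros continuous_cHess_entry[OF u(1) \<Omega>U])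
  then have "(\<lambda>x. indicator \<Omega> x *\<^sub>R MA_density u x) \<in> borel_measurable borel"
    using \<Omega>(1) by (intro borel_measurable_continuous_on_indicator) auto
  then have hm [measurable]: "h \<in> borel_measurable borel" unfolding h_def[abs_def] by simp
  have hFp: "(\<integral>\<^sup>+x. ennreal (\<bar>h x\<bar> powr p) \<partial>lborel) = ennreal Fp"
    using nn_integral_MA_density[OF \<Omega>(1) int ae hm[unfolded h_def[abs_def]]] unfolding h_def Fp_def .
  have aepos: "AE x in lborel. x \<in> \<Omega> \<longrightarrow> MA_density u x \<ge> 0"
    using AE_lebesgue_on_imp_lborel[OF \<Omega>(1) ae] f0 by (auto elim!: eventually_mono)
  let ?c = "4 ^ ?n * fact ?n :: real"
  let ?W = "{z\<in>\<Omega>. u z < - \<sigma>}"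
  \<comment> \<open>The number \<open>\<eta>\<close> keeps \<open>A\<close> and \<open>B\<close>
    positive even if the norm or the sublevel volume vanishes, and it is also the determinant error
    \<open>\<tau>\<close> of the covering. It is removed by a limit.\<close>
  have bound: "a (\<sigma> + t) \<le> box_const d ^ ?N * (2800 * k * root ?n (((L + \<eta>) * (a \<sigma> powr (1/q) + \<eta>) + \<eta> * V) / \<omega>) / t) powr k"
    if \<eta>: "\<eta> > 0" for \<eta>
  proof -
    define A where "A = L + \<eta>"
    define B where "B = a \<sigma> powr (1/q) + \<eta>"
    have A: "A > 0" "Fp \<le> A powr p"
      using L \<eta> pq unfolding A_def L(2)[symmetric] by (auto intro!: powr_mono2)
    have B: "B > 0" "a \<sigma> \<le> B powr q"
    proof -
      show "B > 0" using \<eta> by (simp add: B_def add_nonneg_pos)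
      have "a \<sigma> = (a \<sigma> powr (1/q)) powr q" using pq a0[of \<sigma>] by (simp add: powr_powr)
      also have "\<dots> \<le> B powr q" using pq \<eta> unfolding B_def by (intro powr_mono2) auto
      finally show "a \<sigma> \<le> B powr q" .
    qed
    define I where "I = A * B + \<eta> * V"
    have I: "I > 0" using A B \<eta> V by (simp add: I_def add_pos_nonneg)
    have wm: "?W \<in> sets borel" using op by simp
    have "(\<integral>\<^sup>+z. ennreal (indicator ?W z * (Re (det (cHess u z)) + \<eta>)) \<partial>lborel)
       \<le> (\<integral>\<^sup>+z. ennreal (indicator ?W z * h z) + ennreal \<eta> * indicator \<Omega> z \<partial>lborel)"
    proof (rule nn_integral_mono_AE)
      show "AE z in lborel. ennreal (indicator ?W z * (Re (det (cHess u z)) + \<eta>)) \<le> ennreal (indicator ?W z * h z) + ennreal \<eta> * indicator \<Omega> z"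
        using aepos
      proof eventually_elim
        case (elim z)
        show ?case
        proof (cases "z \<in> ?W")
          case True
          then have z: "z \<in> \<Omega>" by simp
          then have M: "MA_density u z \<ge> 0" using elim by simp
          have "Re (det (cHess u z)) \<le> MA_density u z"
          proof -
            have "Re (det (cHess u z)) \<ge> 0" using M one_le_MA_factor[of ?n] unfolding MA_density_def
              by (simp add: zero_le_mult_iff)
            then show ?thesis using mult_right_mono[OF one_le_MA_factor[of ?n]] unfolding MA_density_def by simp
          qed
          then have "ennreal (Re (det (cHess u z)) + \<eta>) \<le> ennreal (MA_density u z + \<eta>)" by (intro ennreal_leI) simp
          also have "\<dots> = ennreal (MA_density u z) + ennreal \<eta>" using M \<eta> by (intro ennreal_plus) auto
          finally show ?thesis using True z by (simp add: h_def)
        qed simp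
      qed
    qed
    also have "\<dots> = (\<integral>\<^sup>+z. ennreal (indicator ?W z * h z) \<partial>lborel) + ennreal \<eta> * emeasure lborel \<Omega>"
      using \<Omega>(1) wm by (subst nn_integral_add) (auto simp: nn_integral_cmult_indicator)
    also have "\<dots> \<le> ennreal (A * B) + ennreal \<eta> * ennreal V"
    proof (intro add_mono)
      show "(\<integral>\<^sup>+z. ennreal (indicator ?W z * h z) \<partial>lborel) \<le> ennreal (A * B)"
        by (rule nn_integral_Young_bound[OF hm wm pq A(1) B(1)])
           (use A(2) B(2) hFp em in \<open>auto intro: ennreal_leI\<close>)
    qed (simp add: V(1))
    also have "\<dots> = ennreal I" using A B \<eta> V by (simp add: I_def ennreal_plus ennreal_mult)
    finally have Ib: "(\<integral>\<^sup>+z. ennreal (indicator ?W z * (Re (det (cHess u z)) + \<eta>)) \<partial>lborel) \<le> ennreal I" .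
    \<comment> \<open>Half of \<open>t\<close> separates the two levels of
      \<open>sublevel_decay\<close>, the other half drives the decay.\<close>
    have e: "- (\<sigma> + t/2) - t/2 = - (\<sigma> + t)" by simp
    have "ennreal (a (\<sigma> + t)) = emeasure lborel {z\<in>\<Omega>. u z < - (\<sigma> + t/2) - t/2}"
      unfolding e by (rule em[symmetric])
    also have "\<dots> \<le> ennreal (box_const d ^ ?N * exp (- (t/2) / (1400 * root ?n (I / \<omega>))))"
      unfolding \<omega>_def
      by (rule sublevel_decay[OF u \<Omega> psh bd \<sigma> _ _ \<eta> d Ib I]) (use t in auto)
    finally have "a (\<sigma> + t) \<le> box_const d ^ ?N * exp (- (t/2) / (1400 * root ?n (I / \<omega>)))"
      using box_const_pos[OF d(1)] by (subst (asm) ennreal_le_iff) auto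
    also have "\<dots> \<le> box_const d ^ ?N * (2800 * k * root ?n (I / \<omega>) / t) powr k"
    proof (intro mult_left_mono)
      have R: "root ?n (I / \<omega>) > 0" using I \<omega> by simp
      \<comment> \<open>The exponential is given up for a power, with \<open>k\<close> free: this
        freedom is what makes every admissible \<open>\<delta>\<close> reachable.\<close>
      have "exp (- (t / (2800 * root ?n (I / \<omega>)))) \<le> (k / (t / (2800 * root ?n (I / \<omega>)))) powr k"
        using k t R by (intro exp_neg_le_powr) auto
      then show "exp (- (t/2) / (1400 * root ?n (I / \<omega>))) \<le> (2800 * k * root ?n (I / \<omega>) / t) powr k"
        by (simp add: mult_ac)
    qed (use box_const_pos[OF d(1)] in simp)
    finally show ?thesis unfolding I_def A_def B_def .
  qed
  have lim: "((\<lambda>\<eta>. box_const d ^ ?N * (2800 * k * root ?n (((L + \<eta>) * (a \<sigma> powr (1/q) + \<eta>) + \<eta> * V) / \<omega>) / t) powr k)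
      \<longlongrightarrow> box_const d ^ ?N * (2800 * k * root ?n (((L + 0) * (a \<sigma> powr (1/q) + 0) + 0 * V) / \<omega>) / t) powr k) (at_right 0)"
  \<comment> \<open>The base may tend to 0, so continuity of \<open>powr\<close> is used in its form
    for a positive exponent and eventually nonnegative base.\<close>
  proof (intro tendsto_mult_left tendsto_powr')
    show "((\<lambda>\<eta>. 2800 * k * root ?n (((L + \<eta>) * (a \<sigma> powr (1/q) + \<eta>) + \<eta> * V) / \<omega>) / t)
       \<longlongrightarrow> 2800 * k * root ?n (((L + 0) * (a \<sigma> powr (1/q) + 0) + 0 * V) / \<omega>) / t) (at_right 0)"
      using t \<omega> by (intro tendsto_intros) auto
    have "eventually (\<lambda>\<eta>::real. \<eta> > 0) (at_right 0)" by (rule eventually_at_right_less)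
    then have "\<forall>\<^sub>F \<eta> in at_right 0. 0 \<le> 2800 * k * root ?n (((L + \<eta>) * (a \<sigma> powr (1/q) + \<eta>) + \<eta> * V) / \<omega>) / t"
    proof eventually_elim
      case (elim \<eta>)
      have "0 \<le> ((L + \<eta>) * (a \<sigma> powr (1/q) + \<eta>) + \<eta> * V) / \<omega>"
        using elim L(1) V(2) \<omega> by (intro divide_nonneg_pos add_nonneg_nonneg mult_nonneg_nonneg) auto
      then show ?case using k t by simp
    qed
    then show "2800 * k * root ?n (((L + 0) * (a \<sigma> powr (1/q) + 0) + 0 * V) / \<omega>) / t \<noteq> 0 \<or>
      0 < k \<and> (\<forall>\<^sub>F \<eta> in at_right 0. 0 \<le> 2800 * k * root ?n (((L + \<eta>) * (a \<sigma> powr (1/q) + \<eta>) + \<eta> * V) / \<omega>) / t)"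
      using k by blast
  qed simp
  have "a (\<sigma> + t) \<le> box_const d ^ ?N * (2800 * k * root ?n (((L + 0) * (a \<sigma> powr (1/q) + 0) + 0 * V) / \<omega>) / t) powr k"
  proof (rule tendsto_lowerbound[OF lim])
    show "\<forall>\<^sub>F \<eta> in at_right 0. a (\<sigma> + t) \<le> box_const d ^ ?N * (2800 * k * root ?n (((L + \<eta>) * (a \<sigma> powr (1/q) + \<eta>) + \<eta> * V) / \<omega>) / t) powr k"
      by (rule eventually_mono[OF eventually_at_right_less]) (rule bound)
  qed simp
  also have "\<dots> = box_const d ^ ?N * (2800 * k * root ?n ((1 / \<omega>) * (L * a \<sigma> powr (1/q))) / t) powr k"
    by simp
  also have "\<dots> = (decay_const TYPE('n) k d * root ?n L / t) powr k * a \<sigma> powr (k / (real ?n * q))"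
  proof -
    have r: "root ?n ((1 / \<omega>) * (L * a \<sigma> powr (1/q))) = root ?n (1 / \<omega>) * root ?n L * a \<sigma> powr (1 / (real ?n * q))"
    proof -
      have "root ?n (a \<sigma> powr (1/q)) = a \<sigma> powr (1 / (real ?n * q))"
        by (cases "a \<sigma> = 0") (use a0[of \<sigma>] in \<open>simp_all add: root_powr_inverse powr_powr mult.commute\<close>)
      then show ?thesis by (simp only: real_root_mult mult.assoc)
    qed
    have b: "box_const d ^ ?N = (box_const d powr (real ?N / k)) powr k"
      using box_const_pos[OF d(1)] k by (simp add: powr_powr powr_realpow[symmetric])
    have "2800 * k * (root ?n (1 / \<omega>) * root ?n L * a \<sigma> powr (1 / (real ?n * q))) / t
       = (2800 * k * root ?n (1 / \<omega>) * root ?n L / t) * a \<sigma> powr (1 / (real ?n * q))"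
      by simp
    then have "box_const d ^ ?N * (2800 * k * root ?n ((1 / \<omega>) * (L * a \<sigma> powr (1/q))) / t) powr k
      = (box_const d powr (real ?N / k) * ((2800 * k * root ?n (1 / \<omega>) * root ?n L / t) * a \<sigma> powr (1 / (real ?n * q)))) powr k"
      unfolding r b by (simp only: powr_mult)
    also have "\<dots> = ((decay_const TYPE('n) k d * root ?n L / t) * a \<sigma> powr (1 / (real ?n * q))) powr k"
      by (intro arg_cong[of _ _ "\<lambda>x. x powr k"]) (simp add: decay_const_def \<omega>_def)
    also have "\<dots> = (decay_const TYPE('n) k d * root ?n L / t) powr k * (a \<sigma> powr (1 / (real ?n * q))) powr k"
      by (rule powr_mult)
    finally show ?thesis by (simp add: powr_powr)
  qed
  finally show ?thesis unfolding L_def .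
qed

text \<open>The iteration makes an open sublevel set null, and an open null set is empty. The value
  of \<open>k\<close> is such that \<open>\<beta> - 1 = k * \<delta>\<close>, so the power
  \<open>(\<beta> - 1) / k\<close> of the volume in the iteration is
  \<open>\<delta>\<close>.\<close>

lemma interior_lower_bound:
  fixes u f :: "complex^'n \<Rightarrow> real"
  assumes u: "Cinf_on U u" "closure \<Omega> \<subseteq> U" and \<Omega>: "open \<Omega>" "bounded \<Omega>" "\<Omega> \<noteq> {}" and psh: "psh \<Omega> u"
    and bd: "\<And>z. z \<in> frontier \<Omega> \<Longrightarrow> u z \<ge> - s0"
    and d: "d > 0" "diameter \<Omega> \<le> d"
    and pq: "p > 1" "q > 1" "1/p + 1/q = 1"
    and \<delta>: "0 < \<delta>" "\<delta> < 1 / (real CARD('n) * q)" and k: "k = 1 / (1 / (real CARD('n) * q) - \<delta>)"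
    and f0: "\<forall>x\<in>\<Omega>. f x \<ge> 0" and int: "integrable (lebesgue_on \<Omega>) (\<lambda>x. \<bar>f x\<bar> powr p)"
    and ae: "AE x in lebesgue_on \<Omega>. MA_density u x = f x"
    and z: "z \<in> \<Omega>"
  shows "u z \<ge> - s0 - 2 * (decay_const TYPE('n) k d * root CARD('n) (Lp_norm_on p \<Omega> f)
     * measure lborel \<Omega> powr \<delta> * 2 powr (1 / (k * \<delta>)))"
proof -
  define a where "a \<sigma> = measure lborel {z\<in>\<Omega>. u z < - \<sigma>}" for \<sigma>
  define V where "V = measure lborel \<Omega>"
  define Q where "Q = decay_const TYPE('n) k d * root CARD('n) (Lp_norm_on p \<Omega> f)"
  define T0 where "T0 = Q * V powr \<delta> * 2 powr (1 / (k * \<delta>))"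
  have kpos: "k > 0" unfolding k using \<delta>(2) by simp
  define \<beta> where "\<beta> = k / (real CARD('n) * q)"
  have \<beta>: "\<beta> - 1 = k * \<delta>"
  proof -
    have "1 / (real CARD('n) * q) - \<delta> > 0" using \<delta>(2) by simp
    then have "k * (1 / (real CARD('n) * q) - \<delta>) = 1" by (simp add: k)
    then show ?thesis by (simp add: \<beta>_def right_diff_distrib)
  qed
  have \<beta>1: "\<beta> > 1" using \<beta> mult_pos_pos[OF kpos \<delta>(1)] by linarith
  have \<Omega>U: "\<Omega> \<subseteq> U" using u(2) closure_subset by blast
  have cu: "continuous_on \<Omega> u"
    using u(1) \<Omega>U continuous_on_subset unfolding Cinf_on_def by (metis iter_dd.simps(1))
  have op: "open {z\<in>\<Omega>. u z < - \<sigma>}" for \<sigma>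
  proof -
    have "open (\<Omega> \<inter> u -` {..< - \<sigma>})"
      using \<Omega>(1) by (intro continuous_open_preimage cu) auto
    moreover have "{z\<in>\<Omega>. u z < - \<sigma>} = \<Omega> \<inter> u -` {..< - \<sigma>}" by auto
    ultimately show ?thesis by simp
  qed
  have fin: "X \<in> fmeasurable lborel" if "X \<subseteq> \<Omega>" "open X" for X
    using that bounded_subset[OF \<Omega>(2) that(1)] emeasure_bounded_finite by (intro fmeasurableI) auto
  have anti: "a y \<le> a x" if "x \<le> y" for x y
    unfolding a_def using that op[of x] op[of y] by (intro measure_mono_fmeasurable fin) auto
  have aV: "a x \<le> V" for x
    unfolding a_def V_def using op[of x] \<Omega>(1) by (intro measure_mono_fmeasurable fin) auto
  have Vpos: "V > 0"
  proof -
    have "\<not> negligible \<Omega>" using open_not_negligible[OF \<Omega>(1,3)] .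
    then have "V \<noteq> 0" using \<Omega>(1) fin[of \<Omega>] unfolding V_def
      by (metis negligible_iff_measure0 lmeasurable_open \<Omega>(2) measure_completion sets_lborel borel_open)
    then show ?thesis by (simp add: V_def less_le)
  qed
  have Q: "Q \<ge> 0"
    unfolding Q_def decay_const_def Lp_norm_on_def using kpos by (intro mult_nonneg_nonneg real_root_ge_zero) auto
  \<comment> \<open>Strict slack is needed in both the level and the height: the iteration starts
    above \<open>s0\<close> and requires \<open>T > 0\<close>, while \<open>T0\<close> can be
    0.\<close>
  have low: "u z \<ge> - (x1 + 2 * T)" if "x1 > s0" "T > 0" "T \<ge> T0" for x1 T
  proof (rule ccontr)
    assume "\<not> u z \<ge> - (x1 + 2 * T)"
    then have ne: "{z\<in>\<Omega>. u z < - (x1 + 2 * T)} \<noteq> {}" using z by auto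
    have "a (x1 + 2 * T) = 0"
    proof (rule de_giorgi_iteration[of a V k \<beta> Q s0 T x1])
      show "a (x + t) \<le> (Q / t) powr k * a x powr \<beta>" if "x > s0" "t > 0" for x t
        unfolding a_def Q_def \<beta>_def
        by (rule sublevel_step[OF u \<Omega>(1,2) psh bd that d pq kpos f0 int ae])
      show "T \<ge> Q * V powr ((\<beta> - 1) / k) * 2 powr (1 / (\<beta> - 1))"
        using that(3) kpos by (simp add: T0_def \<beta>)
    qed (use anti aV Vpos kpos \<beta>1 Q that in \<open>auto simp: a_def\<close>)
    then have "negligible {z\<in>\<Omega>. u z < - (x1 + 2 * T)}"
      using op[of "x1 + 2 * T"] bounded_subset[OF \<Omega>(2)] unfolding a_def
      by (subst negligible_iff_measure0) (auto intro!: lmeasurable_open)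
    then show False using open_not_negligible[OF op ne] by simp
  qed
  have "- s0 - 2 * T0 \<le> u z + e" if e: "e > 0" for e
  proof -
    have "T0 \<ge> 0" using Q by (simp add: T0_def)
    \<comment> \<open>The slack totals \<open>e\<close>: one third from the level and twice one
      third from the height.\<close>
    then have "u z \<ge> - ((s0 + e / 3) + 2 * (T0 + e / 3))" using e by (intro low) auto
    then show ?thesis by simp
  qed
  then have "- s0 - 2 * T0 \<le> u z" by (rule field_le_epsilon)
  then show ?thesis unfolding T0_def Q_def V_def by simp
qed

text \<open>The infimum of \<open>u\<close> lies between that of \<open>\<phi>\<close> minus the
  error term and that of \<open>\<phi>\<close> itself; the absolute values then follow by
  arithmetic.\<close>

theorem theorem1p2:
  fixes p \<delta> :: real
  assumes "p > 1"
    and "0 < \<delta>" and "\<delta> < 1 / (real CARD('n) * (p / (p - 1)))"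
  shows "\<exists>C :: real \<Rightarrow> real. (\<forall>d. C d > 0) \<and>
    (\<forall>(\<Omega> :: (complex^'n) set) (u :: complex^'n \<Rightarrow> real) (\<phi> :: complex^'n \<Rightarrow> real) (f :: complex^'n \<Rightarrow> real).
       bdd_strictly_pseudoconvex \<Omega> \<and>
       Cinf_on_set (frontier \<Omega>) \<phi> \<and>
       (\<forall>x\<in>\<Omega>. f x \<ge> 0) \<and>
       f \<in> borel_measurable (lebesgue_on \<Omega>) \<and>
       integrable (lebesgue_on \<Omega>) (\<lambda>x. \<bar>f x\<bar> powr p) \<and>
       (\<exists>U. closure \<Omega> \<subseteq> U \<and> Cinf_on U u) \<and>
       psh \<Omega> u \<and>
       (AE x in lebesgue_on \<Omega>. MA_density u x = f x) \<and>
       (\<forall>z\<in>frontier \<Omega>. u z = \<phi> z)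
       \<longrightarrow> \<bar>Inf (u ` \<Omega>)\<bar> \<le> \<bar>Inf (\<phi> ` frontier \<Omega>)\<bar>
             + C (diameter \<Omega>) * Lp_norm_on p \<Omega> f powr (1 / real CARD('n))
               * measure lebesgue \<Omega> powr \<delta>)"
proof -
  define q where "q = p / (p - 1)"
  have pq: "p > 1" "q > 1" "1/p + 1/q = 1" using assms(1) by (auto simp: q_def field_simps)
  define k where "k = 1 / (1 / (real CARD('n) * q) - \<delta>)"
  have \<delta>: "0 < \<delta>" "\<delta> < 1 / (real CARD('n) * q)" using assms by (simp_all add: q_def)
  have kpos: "k > 0" unfolding k_def using \<delta>(2) by simp
  \<comment> \<open>\<open>C\<close> is a function of the diameter fixed before the domain;
    \<open>max d 1\<close> keeps it positive for every real argument and still bounds the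
    diameter.\<close>
  define C where "C d = 2 * (decay_const TYPE('n) k (max d 1) * 2 powr (1 / (k * \<delta>)))" for d
  have Cpos: "C d > 0" for d
  proof -
    have "measure lborel (ball (0 :: complex^'n) 1) > 0" by (rule content_ball_pos) simp
    then have "root CARD('n) (1 / measure lborel (ball (0 :: complex^'n) 1)) > 0"
      by (intro real_root_gt_zero divide_pos_pos) auto
    moreover have "box_const (max d 1) > 0" by (rule box_const_pos) simp
    then have "box_const (max d 1) powr (real DIM(complex^'n) / k) > 0" by simp
    ultimately show ?thesis
      unfolding C_def decay_const_def using kpos by (intro mult_pos_pos) simp_all
  qed
  show ?thesis
  proof (intro exI[of _ C] conjI allI impI Cpos, elim conjE exE)
    fix \<Omega> :: "(complex^'n) set" and u \<phi> f :: "complex^'n \<Rightarrow> real" and U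
    assume pc: "bdd_strictly_pseudoconvex \<Omega>"
      and f0: "\<forall>x\<in>\<Omega>. f x \<ge> 0"
      and int: "integrable (lebesgue_on \<Omega>) (\<lambda>x. \<bar>f x\<bar> powr p)"
      and U: "closure \<Omega> \<subseteq> U" and u: "Cinf_on U u" and psh: "psh \<Omega> u"
      and ae: "AE x in lebesgue_on \<Omega>. MA_density u x = f x"
      and bv: "\<forall>z\<in>frontier \<Omega>. u z = \<phi> z"
    have \<Omega>: "open \<Omega>" "bounded \<Omega>" "\<Omega> \<noteq> {}" using pc by (auto simp: bdd_strictly_pseudoconvex_def)
    have fne: "frontier \<Omega> \<noteq> {}" using \<Omega> by (intro frontier_not_empty) auto
    have cuc: "continuous_on (closure \<Omega>) u"
      using u U continuous_on_subset unfolding Cinf_on_def by (metis iter_dd.simps(1))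
    have "compact (frontier \<Omega>)" using \<Omega>(2) by (rule compact_frontier_bounded)
    moreover have "continuous_on (frontier \<Omega>) u"
      by (rule continuous_on_subset[OF cuc]) (simp add: frontier_def)
    ultimately have bb: "bdd_below (u ` frontier \<Omega>)"
      by (intro bounded_imp_bdd_below compact_imp_bounded compact_continuous_image)
    define m where "m = Inf (\<phi> ` frontier \<Omega>)"
    have m: "m = Inf (u ` frontier \<Omega>)" unfolding m_def using bv by (intro arg_cong[of _ _ Inf] image_cong) auto
    have bd: "u z \<ge> - (- m)" if "z \<in> frontier \<Omega>" for z
      unfolding m using cInf_lower[OF imageI[OF that] bb] by simp
    define E where "E = C (diameter \<Omega>) * Lp_norm_on p \<Omega> f powr (1 / real CARD('n)) * measure lebesgue \<Omega> powr \<delta>"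
    have E0: "E \<ge> 0" unfolding E_def using Cpos[of "diameter \<Omega>"] by (intro mult_nonneg_nonneg) auto
    have L0: "Lp_norm_on p \<Omega> f \<ge> 0" by (simp add: Lp_norm_on_def)
    have rt: "root CARD('n) (Lp_norm_on p \<Omega> f) = Lp_norm_on p \<Omega> f powr (1 / real CARD('n))"
      by (cases "Lp_norm_on p \<Omega> f = 0") (use L0 in \<open>simp_all add: root_powr_inverse\<close>)
    have ms: "measure lebesgue \<Omega> = measure lborel \<Omega>" using \<Omega>(1) by (simp add: measure_completion)
    have low: "m - E \<le> u z" if "z \<in> \<Omega>" for z
    proof -
      have "max (diameter \<Omega>) 1 > 0" "diameter \<Omega> \<le> max (diameter \<Omega>) 1" by auto
      from interior_lower_bound[OF u U \<Omega> psh bd this pq \<delta> k_def f0 int ae that]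
      show ?thesis unfolding E_def C_def rt ms by (simp add: mult_ac)
    qed
    have bbu: "bdd_below (u ` \<Omega>)" using low by (intro bdd_belowI2[of _ "m - E"])
    have lower: "m - E \<le> Inf (u ` \<Omega>)" using \<Omega>(3) low by (intro cInf_greatest) auto
    \<comment> \<open>Only continuity up to the boundary enters: a lower bound on
      \<open>\<Omega>\<close> persists on its closure.\<close>
    have upper: "Inf (u ` \<Omega>) \<le> m"
      unfolding m
    proof (rule cInf_greatest)
      fix y assume "y \<in> u ` frontier \<Omega>"
      then obtain w where w: "w \<in> frontier \<Omega>" "y = u w" by blast
      have "Inf (u ` \<Omega>) \<le> u w"
        using cuc by (rule continuous_ge_on_closure) (use w bbu in \<open>auto simp: frontier_def intro: cInf_lower\<close>)
      then show "Inf (u ` \<Omega>) \<le> y" using w(2) by simp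
    qed (use fne in simp)
    have "\<bar>Inf (u ` \<Omega>)\<bar> \<le> \<bar>m\<bar> + E" using lower upper E0 by linarith
    then show "\<bar>Inf (u ` \<Omega>)\<bar> \<le> \<bar>Inf (\<phi> ` frontier \<Omega>)\<bar>
             + C (diameter \<Omega>) * Lp_norm_on p \<Omega> f powr (1 / real CARD('n)) * measure lebesgue \<Omega> powr \<delta>"
      unfolding m_def E_def .
  qed
qed

end
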